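(* Let $\mathscr{A}=(\{\mathcal{A}_{s,t}\}_{0<s<t},\{\Delta_{r,s,t}\}_{0<r<s<t})$ be a co-unital $C^*$-subproduct system and $\{\varphi_{s,t}\}_{0<s<t}$ be a co-unit of $\mathscr{A}$. Let $(\pi_{s,t},H_{s,t})$ be the GNS representation of $\mathcal{A}_{s,t}$ associated with $\varphi_{s,t}$, for every $0<s<t$. Then the family $\{H_{s,t}\}_{0<s<t}$ can be assembled into a Tsirelson subproduct system of Hilbert spaces; that is, there is a family $\{V_{r,s,t}\}_{0<r<s<t}$ of isometries $V_{r,s,t}:H_{r,t}\to H_{r,s}\otimes H_{s,t}$ such that $(\{H_{s,t}\}_{0<s<t},\{V_{r,s,t}\}_{0<r<s<t})$ is a Tsirelson subproduct system of Hilbert spaces.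
   Context: All tensor products of $C^*$-algebras are injective (minimal) tensor products; a $*$-monomorphism is an injective $*$-homomorphism. A $C^*$-subproduct system is a pair $\mathscr{A}=(\{\mathcal{A}_{s,t}\}_{0<s<t},\{\Delta_{r,s,t}\}_{0<r<s<t})$ of $C^*$-algebras $\mathcal{A}_{s,t}$ and $*$-monomorphisms $\Delta_{r,s,t}:\mathcal{A}_{r,t}\to\mathcal{A}_{r,s}\otimes\mathcal{A}_{s,t}$ such that $(\mathrm{id}_{\mathcal{A}_{r,s}}\otimes\Delta_{s,t,u})\Delta_{r,s,u}=(\Delta_{r,s,t}\otimes\mathrm{id}_{\mathcal{A}_{t,u}})\Delta_{r,t,u}$ for all $0<r<s<t<u$. A co-unit of $\mathscr{A}$ is a family of states $\varphi_{s,t}$ of $\mathcal{A}_{s,t}$, $0<s<t$, with $\varphi_{r,t}=(\varphi_{r,s}\otimes\varphi_{s,t})\circ\Delta_{r,s,t}$ for all $0<r<s<t$; $\mathscr{A}$ is co-unital if it admits a co-unit. A Tsirelson subproduct system of Hilbert spaces is a pair $(\{H_{s,t}\}_{0<s<t},\{U_{r,s,t}\}_{0<r<s<t})$ of Hilbert spaces $H_{s,t}$ (not necessarily separable) and isometric operators $U_{r,s,t}:H_{r,t}\to H_{r,s}\otimes H_{s,t}$ satisfying $(1_{H_{r,s}}\otimes U_{s,t,u})U_{r,s,u}=(U_{r,s,t}\otimes 1_{H_{t,u}})U_{r,t,u}$ for all $0<r<s<t<u$. *)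

theory Defs
  imports
    "HOL-Algebra.Module"
    "HOL-Analysis.Abstract_Metric_Spaces"
    "HOL-Library.Lub_Glb"
    "HOL-Library.Nonpos_Ints"
begin

text \<open>
  A family of $C^*$-algebras or Hilbert spaces indexed by pairs $s < t$ has members with different
  underlying sets, so all structures are carrier-based, on top of the modules of HOL-Algebra.
  As is usual there, fields of the underlying ring record that are irrelevant for a structure are
  left unconstrained: the unit of a $C^*$-algebra (algebras need not be unital), and product and
  unit of a Hilbert space.
\<close>

definition complex_ring :: "complex ring" where
  "complex_ring = \<lparr>carrier = UNIV, mult = (*), one = 1, zero = 0, add = (+)\<rparr>"

lemma cring_complex_ring: "cring complex_ring"
proof (rule cringI)
  show "abelian_group complex_ring"
    by (rule abelian_groupI)
      (auto simp: complex_ring_def algebra_simps intro: exI[of _ "- x" for x] left_minus)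
  show "Group.comm_monoid complex_ring"
    by (rule comm_monoidI) (auto simp: complex_ring_def algebra_simps)
qed (simp add: complex_ring_def algebra_simps)


section \<open>$C^*$-algebras\<close>

record 'a cstar = "(complex, 'a) module" +
  star :: "'a \<Rightarrow> 'a"
  cnorm :: "'a \<Rightarrow> real"

text \<open>
  Distances are set to 0 off the carrier because \<^locale>\<open>Metric_space\<close> constrains the distance
  function on the whole type.
\<close>

definition cdist :: "'a cstar \<Rightarrow> 'a \<Rightarrow> 'a \<Rightarrow> real" where
  "cdist A x y = (if x \<in> carrier A \<and> y \<in> carrier A then cnorm A (x \<ominus>\<^bsub>A\<^esub> y) else 0)"

locale cstar_algebra = Module.module complex_ring A for A :: "'a cstar" (structure) +
  assumes mult_closed: "\<lbrakk>x \<in> carrier A; y \<in> carrier A\<rbrakk> \<Longrightarrow> x \<otimes> y \<in> carrier A"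
    and mult_assoc: "\<lbrakk>x \<in> carrier A; y \<in> carrier A; z \<in> carrier A\<rbrakk> \<Longrightarrow> (x \<otimes> y) \<otimes> z = x \<otimes> (y \<otimes> z)"
    and mult_l_distr: "\<lbrakk>x \<in> carrier A; y \<in> carrier A; z \<in> carrier A\<rbrakk> \<Longrightarrow> (x \<oplus> y) \<otimes> z = x \<otimes> z \<oplus> y \<otimes> z"
    and mult_r_distr: "\<lbrakk>x \<in> carrier A; y \<in> carrier A; z \<in> carrier A\<rbrakk> \<Longrightarrow> z \<otimes> (x \<oplus> y) = z \<otimes> x \<oplus> z \<otimes> y"
    and smult_mult_l: "\<lbrakk>x \<in> carrier A; y \<in> carrier A\<rbrakk> \<Longrightarrow> (c \<odot> x) \<otimes> y = c \<odot> (x \<otimes> y)"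
    and smult_mult_r: "\<lbrakk>x \<in> carrier A; y \<in> carrier A\<rbrakk> \<Longrightarrow> x \<otimes> (c \<odot> y) = c \<odot> (x \<otimes> y)"
    and star_closed: "x \<in> carrier A \<Longrightarrow> star A x \<in> carrier A"
    and star_add: "\<lbrakk>x \<in> carrier A; y \<in> carrier A\<rbrakk> \<Longrightarrow> star A (x \<oplus> y) = star A x \<oplus> star A y"
    and star_smult: "x \<in> carrier A \<Longrightarrow> star A (c \<odot> x) = cnj c \<odot> star A x"
    and star_mult: "\<lbrakk>x \<in> carrier A; y \<in> carrier A\<rbrakk> \<Longrightarrow> star A (x \<otimes> y) = star A y \<otimes> star A x"
    and star_star: "x \<in> carrier A \<Longrightarrow> star A (star A x) = x"
    and cnorm_nonneg: "x \<in> carrier A \<Longrightarrow> 0 \<le> cnorm A x"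
    and cnorm_eq_0: "x \<in> carrier A \<Longrightarrow> cnorm A x = 0 \<longleftrightarrow> x = \<zero>"
    and cnorm_smult: "x \<in> carrier A \<Longrightarrow> cnorm A (c \<odot> x) = cmod c * cnorm A x"
    and cnorm_triangle: "\<lbrakk>x \<in> carrier A; y \<in> carrier A\<rbrakk> \<Longrightarrow> cnorm A (x \<oplus> y) \<le> cnorm A x + cnorm A y"
    and cnorm_mult: "\<lbrakk>x \<in> carrier A; y \<in> carrier A\<rbrakk> \<Longrightarrow> cnorm A (x \<otimes> y) \<le> cnorm A x * cnorm A y"
    and cnorm_cstar: "x \<in> carrier A \<Longrightarrow> cnorm A (star A x \<otimes> x) = (cnorm A x)\<^sup>2"
    and cnorm_complete: "Metric_space.mcomplete (carrier A) (cdist A)"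

definition cdense :: "'a cstar \<Rightarrow> 'a set \<Rightarrow> bool" where
  "cdense A S \<longleftrightarrow> Metric_space.mtopology (carrier A) (cdist A) closure_of S = carrier A"

definition linear_on ::
  "(complex, 'a, 'm) module_scheme \<Rightarrow> (complex, 'b, 'n) module_scheme \<Rightarrow> ('a \<Rightarrow> 'b) \<Rightarrow> bool" where
  "linear_on V W f \<longleftrightarrow>
     f \<in> carrier V \<rightarrow> carrier W \<and>
     (\<forall>x\<in>carrier V. \<forall>y\<in>carrier V. f (x \<oplus>\<^bsub>V\<^esub> y) = f x \<oplus>\<^bsub>W\<^esub> f y) \<and>
     (\<forall>c. \<forall>x\<in>carrier V. f (c \<odot>\<^bsub>V\<^esub> x) = c \<odot>\<^bsub>W\<^esub> f x)"

definition linear_functional :: "(complex, 'a, 'm) module_scheme \<Rightarrow> ('a \<Rightarrow> complex) \<Rightarrow> bool" where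
  "linear_functional V f \<longleftrightarrow>
     (\<forall>x\<in>carrier V. \<forall>y\<in>carrier V. f (x \<oplus>\<^bsub>V\<^esub> y) = f x + f y) \<and>
     (\<forall>c. \<forall>x\<in>carrier V. f (c \<odot>\<^bsub>V\<^esub> x) = c * f x)"

definition bilinear_on ::
  "(complex, 'a, 'm) module_scheme \<Rightarrow> (complex, 'b, 'n) module_scheme \<Rightarrow>
   (complex, 'c, 'k) module_scheme \<Rightarrow> ('a \<Rightarrow> 'b \<Rightarrow> 'c) \<Rightarrow> bool" where
  "bilinear_on V W X f \<longleftrightarrow>
     (\<forall>x\<in>carrier V. linear_on W X (f x)) \<and> (\<forall>y\<in>carrier W. linear_on V X (\<lambda>x. f x y))"

definition star_hom :: "'a cstar \<Rightarrow> 'b cstar \<Rightarrow> ('a \<Rightarrow> 'b) \<Rightarrow> bool" where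
  "star_hom A B f \<longleftrightarrow>
     linear_on A B f \<and>
     (\<forall>x\<in>carrier A. \<forall>y\<in>carrier A. f (x \<otimes>\<^bsub>A\<^esub> y) = f x \<otimes>\<^bsub>B\<^esub> f y) \<and>
     (\<forall>x\<in>carrier A. f (star A x) = star B (f x))"

definition star_mono :: "'a cstar \<Rightarrow> 'b cstar \<Rightarrow> ('a \<Rightarrow> 'b) \<Rightarrow> bool" where
  "star_mono A B f \<longleftrightarrow> star_hom A B f \<and> inj_on f (carrier A)"

text \<open>A state is a positive linear functional of norm 1.\<close>

definition state :: "'a cstar \<Rightarrow> ('a \<Rightarrow> complex) \<Rightarrow> bool" where
  "state A \<phi> \<longleftrightarrow>
     linear_functional A \<phi> \<and>
     (\<forall>x\<in>carrier A. \<phi> (star A x \<otimes>\<^bsub>A\<^esub> x) \<in> \<real>\<^sub>\<ge>\<^sub>0) \<and>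
     isLub UNIV {cmod (\<phi> x) |x. x \<in> carrier A \<and> cnorm A x \<le> 1} 1"


section \<open>Hilbert spaces and representations\<close>

record 'h hilb = "(complex, 'h) module" +
  iprod :: "'h \<Rightarrow> 'h \<Rightarrow> complex"

definition hnorm :: "'h hilb \<Rightarrow> 'h \<Rightarrow> real" where
  "hnorm H x = sqrt (Re (iprod H x x))"

definition hdist :: "'h hilb \<Rightarrow> 'h \<Rightarrow> 'h \<Rightarrow> real" where
  "hdist H x y = (if x \<in> carrier H \<and> y \<in> carrier H then hnorm H (x \<ominus>\<^bsub>H\<^esub> y) else 0)"

locale hilbert_space = Module.module complex_ring H for H :: "'h hilb" (structure) +
  assumes iprod_add: "\<lbrakk>x \<in> carrier H; y \<in> carrier H; z \<in> carrier H\<rbrakk> \<Longrightarrow> iprod H (x \<oplus> y) z = iprod H x z + iprod H y z"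
    and iprod_smult: "\<lbrakk>x \<in> carrier H; y \<in> carrier H\<rbrakk> \<Longrightarrow> iprod H (c \<odot> x) y = c * iprod H x y"
    and iprod_cnj: "\<lbrakk>x \<in> carrier H; y \<in> carrier H\<rbrakk> \<Longrightarrow> iprod H x y = cnj (iprod H y x)"
    and iprod_nonneg: "x \<in> carrier H \<Longrightarrow> iprod H x x \<in> \<real>\<^sub>\<ge>\<^sub>0"
    and iprod_eq_0: "x \<in> carrier H \<Longrightarrow> iprod H x x = 0 \<Longrightarrow> x = \<zero>"
    and hnorm_complete: "Metric_space.mcomplete (carrier H) (hdist H)"

definition hdense :: "'h hilb \<Rightarrow> 'h set \<Rightarrow> bool" where
  "hdense H S \<longleftrightarrow> Metric_space.mtopology (carrier H) (hdist H) closure_of S = carrier H"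

definition bounded_op :: "'h hilb \<Rightarrow> 'k hilb \<Rightarrow> ('h \<Rightarrow> 'k) \<Rightarrow> bool" where
  "bounded_op H K X \<longleftrightarrow>
     linear_on H K X \<and> (\<exists>C. \<forall>x\<in>carrier H. hnorm K (X x) \<le> C * hnorm H x)"

definition isometry_op :: "'h hilb \<Rightarrow> 'k hilb \<Rightarrow> ('h \<Rightarrow> 'k) \<Rightarrow> bool" where
  "isometry_op H K X \<longleftrightarrow> linear_on H K X \<and> (\<forall>x\<in>carrier H. hnorm K (X x) = hnorm H x)"

definition representation :: "'a cstar \<Rightarrow> 'h hilb \<Rightarrow> ('a \<Rightarrow> 'h \<Rightarrow> 'h) \<Rightarrow> bool" where
  "representation A H \<pi> \<longleftrightarrow>
     hilbert_space H \<and>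
     (\<forall>a\<in>carrier A. bounded_op H H (\<pi> a)) \<and>
     (\<forall>a\<in>carrier A. \<forall>b\<in>carrier A. \<forall>x\<in>carrier H. \<pi> (a \<oplus>\<^bsub>A\<^esub> b) x = \<pi> a x \<oplus>\<^bsub>H\<^esub> \<pi> b x) \<and>
     (\<forall>c. \<forall>a\<in>carrier A. \<forall>x\<in>carrier H. \<pi> (c \<odot>\<^bsub>A\<^esub> a) x = c \<odot>\<^bsub>H\<^esub> \<pi> a x) \<and>
     (\<forall>a\<in>carrier A. \<forall>b\<in>carrier A. \<forall>x\<in>carrier H. \<pi> (a \<otimes>\<^bsub>A\<^esub> b) x = \<pi> a (\<pi> b x)) \<and>
     (\<forall>a\<in>carrier A. \<forall>x\<in>carrier H. \<forall>y\<in>carrier H.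
        iprod H (\<pi> (star A a) x) y = iprod H x (\<pi> a y))"

text \<open>
  The GNS representation is determined up to unitary equivalence by the existence of a cyclic
  vector that implements the state; \<open>\<xi>\<close> is the vector for which \<open>\<pi> a \<xi>\<close> is the class of \<open>a\<close>
  in the completion of the quotient of the algebra by the null space of \<open>\<phi>\<close>.
\<close>

definition gns_representation :: "'a cstar \<Rightarrow> ('a \<Rightarrow> complex) \<Rightarrow> 'h hilb \<Rightarrow> ('a \<Rightarrow> 'h \<Rightarrow> 'h) \<Rightarrow> bool" where
  "gns_representation A \<phi> H \<pi> \<longleftrightarrow>
     representation A H \<pi> \<and>
     (\<exists>\<xi>\<in>carrier H. hdense H {\<pi> a \<xi> |a. a \<in> carrier A} \<and>
                   (\<forall>a\<in>carrier A. \<phi> a = iprod H (\<pi> a \<xi>) \<xi>))"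


section \<open>Tensor products of Hilbert spaces\<close>

text \<open>
  \<open>L\<close> with \<open>\<sigma> h k\<close> in the role of the elementary tensor is a Hilbert space tensor product of
  \<open>H\<close> and \<open>K\<close>, i.e. a completion of the algebraic tensor product for the product inner product.
\<close>

definition hilbert_tensor :: "'h hilb \<Rightarrow> 'k hilb \<Rightarrow> 'l hilb \<Rightarrow> ('h \<Rightarrow> 'k \<Rightarrow> 'l) \<Rightarrow> bool" where
  "hilbert_tensor H K L \<sigma> \<longleftrightarrow>
     hilbert_space H \<and> hilbert_space K \<and> hilbert_space L \<and>
     bilinear_on H K L \<sigma> \<and>
     (\<forall>h\<in>carrier H. \<forall>h'\<in>carrier H. \<forall>k\<in>carrier K. \<forall>k'\<in>carrier K.
        iprod L (\<sigma> h k) (\<sigma> h' k') = iprod H h h' * iprod K k k') \<and>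
     hdense L {\<Oplus>\<^bsub>L\<^esub>i\<in>{..<n}. \<sigma> (h i) (k i) |n h k.
                 (\<forall>i<(n::nat). h i \<in> carrier H \<and> k i \<in> carrier K)}"

text \<open>\<open>F = X \<otimes> Y\<close>, for the tensor products \<open>(L, \<sigma>)\<close> and \<open>(L', \<sigma>')\<close>\<close>

definition op_tensor ::
  "'h hilb \<Rightarrow> 'k hilb \<Rightarrow> 'l hilb \<Rightarrow> ('h \<Rightarrow> 'k \<Rightarrow> 'l) \<Rightarrow> 'm hilb \<Rightarrow> ('h2 \<Rightarrow> 'k2 \<Rightarrow> 'm) \<Rightarrow>
   ('h \<Rightarrow> 'h2) \<Rightarrow> ('k \<Rightarrow> 'k2) \<Rightarrow> ('l \<Rightarrow> 'm) \<Rightarrow> bool" where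
  "op_tensor H K L \<sigma> L' \<sigma>' X Y F \<longleftrightarrow>
     bounded_op L L' F \<and> (\<forall>h\<in>carrier H. \<forall>k\<in>carrier K. F (\<sigma> h k) = \<sigma>' (X h) (Y k))"


section \<open>Injective tensor products of $C^*$-algebras\<close>

text \<open>
  The norm of \<open>\<Sum>i\<in>I. h i \<otimes> k i\<close> in the algebraic tensor product of \<open>H\<close> and \<open>K\<close>
\<close>

definition alg_tensor_norm :: "'h hilb \<Rightarrow> 'k hilb \<Rightarrow> 'i set \<Rightarrow> ('i \<Rightarrow> 'h) \<Rightarrow> ('i \<Rightarrow> 'k) \<Rightarrow> real" where
  "alg_tensor_norm H K I h k =
     sqrt (Re (\<Sum>i\<in>I. \<Sum>j\<in>I. iprod H (h i) (h j) * iprod K (k i) (k j)))"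

text \<open>
  The supremum of the following set is the spatial norm of \<open>x = \<Sum>i<m. a i \<otimes> b i\<close>, that is, the
  supremum of the operator norms of \<open>(\<pi> \<otimes> \<rho>) x = \<Sum>i<m. \<pi> (a i) \<otimes> \<rho> (b i)\<close> over all
  representations \<open>\<pi>\<close> of \<open>A\<close> and \<open>\<rho>\<close> of \<open>B\<close>; the operator norms are computed on vectors
  \<open>\<Sum>j<n. h j \<otimes> k j\<close> of the algebraic tensor product of the two Hilbert spaces.

  The types \<^typ>\<open>'a \<Rightarrow> complex\<close> and \<^typ>\<open>'b \<Rightarrow> complex\<close> are large enough for the representation
  spaces. Every representation is a direct sum of a zero representation and cyclic ones, so cyclic
  representations suffice for the supremum; and if \<open>\<xi>\<close> is cyclic for \<open>\<pi>\<close>, then sending \<open>h\<close> to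
  the function \<open>a \<mapsto> \<langle>h, \<pi> a \<xi>\<rangle>\<close> embeds the Hilbert space linearly into the functions on \<open>A\<close>.
\<close>

definition spatial_norms :: "'a cstar \<Rightarrow> 'b cstar \<Rightarrow> nat \<Rightarrow> (nat \<Rightarrow> 'a) \<Rightarrow> (nat \<Rightarrow> 'b) \<Rightarrow> real set" where
  "spatial_norms A B m a b =
     {alg_tensor_norm H K ({..<m} \<times> {..<n}) (\<lambda>(i, j). \<pi> (a i) (h j)) (\<lambda>(i, j). \<rho> (b i) (k j))
      |(H :: ('a \<Rightarrow> complex) hilb) \<pi> (K :: ('b \<Rightarrow> complex) hilb) \<rho> n h k.
        representation A H \<pi> \<and> representation B K \<rho> \<and>
        (\<forall>j<(n::nat). h j \<in> carrier H \<and> k j \<in> carrier K) \<and>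
        alg_tensor_norm H K {..<n} h k \<le> 1}"

text \<open>
  \<open>T\<close> with \<open>\<tau> a b\<close> in the role of the elementary tensor is an injective tensor product of \<open>A\<close>
  and \<open>B\<close>, i.e. a completion of the algebraic tensor product for the spatial norm.
\<close>

definition injective_tensor :: "'a cstar \<Rightarrow> 'b cstar \<Rightarrow> 'c cstar \<Rightarrow> ('a \<Rightarrow> 'b \<Rightarrow> 'c) \<Rightarrow> bool" where
  "injective_tensor A B T \<tau> \<longleftrightarrow>
     cstar_algebra A \<and> cstar_algebra B \<and> cstar_algebra T \<and>
     bilinear_on A B T \<tau> \<and>
     (\<forall>a\<in>carrier A. \<forall>a'\<in>carrier A. \<forall>b\<in>carrier B. \<forall>b'\<in>carrier B.
        \<tau> a b \<otimes>\<^bsub>T\<^esub> \<tau> a' b' = \<tau> (a \<otimes>\<^bsub>A\<^esub> a') (b \<otimes>\<^bsub>B\<^esub> b')) \<and>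
     (\<forall>a\<in>carrier A. \<forall>b\<in>carrier B. star T (\<tau> a b) = \<tau> (star A a) (star B b)) \<and>
     (\<forall>m a b. (\<forall>i<m. a i \<in> carrier A \<and> b i \<in> carrier B) \<longrightarrow>
        isLub UNIV (spatial_norms A B m a b) (cnorm T (\<Oplus>\<^bsub>T\<^esub>i\<in>{..<m}. \<tau> (a i) (b i)))) \<and>
     cdense T {\<Oplus>\<^bsub>T\<^esub>i\<in>{..<m}. \<tau> (a i) (b i) |m a b.
                 (\<forall>i<(m::nat). a i \<in> carrier A \<and> b i \<in> carrier B)}"

text \<open>
  \<open>F = f \<otimes> g\<close> on the tensor product \<open>(T, \<tau>)\<close> of \<open>A\<close> and \<open>B\<close>, for \<open>f\<close> and \<open>g\<close> *-homomorphisms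
  into the factors of \<open>(T', \<tau>')\<close> or linear functionals, respectively; \<open>F\<close> is the unique continuous
  extension of the map on the algebraic tensor product.
\<close>

definition hom_tensor ::
  "'a cstar \<Rightarrow> 'b cstar \<Rightarrow> 'c cstar \<Rightarrow> ('a \<Rightarrow> 'b \<Rightarrow> 'c) \<Rightarrow> 'd cstar \<Rightarrow> ('a2 \<Rightarrow> 'b2 \<Rightarrow> 'd) \<Rightarrow>
   ('a \<Rightarrow> 'a2) \<Rightarrow> ('b \<Rightarrow> 'b2) \<Rightarrow> ('c \<Rightarrow> 'd) \<Rightarrow> bool" where
  "hom_tensor A B T \<tau> T' \<tau>' f g F \<longleftrightarrow>
     star_hom T T' F \<and>
     (\<exists>C. \<forall>x\<in>carrier T. cnorm T' (F x) \<le> C * cnorm T x) \<and>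
     (\<forall>a\<in>carrier A. \<forall>b\<in>carrier B. F (\<tau> a b) = \<tau>' (f a) (g b))"

definition functional_tensor ::
  "'a cstar \<Rightarrow> 'b cstar \<Rightarrow> 'c cstar \<Rightarrow> ('a \<Rightarrow> 'b \<Rightarrow> 'c) \<Rightarrow>
   ('a \<Rightarrow> complex) \<Rightarrow> ('b \<Rightarrow> complex) \<Rightarrow> ('c \<Rightarrow> complex) \<Rightarrow> bool" where
  "functional_tensor A B T \<tau> f g F \<longleftrightarrow>
     linear_functional T F \<and>
     (\<exists>C. \<forall>x\<in>carrier T. cmod (F x) \<le> C * cnorm T x) \<and>
     (\<forall>a\<in>carrier A. \<forall>b\<in>carrier B. F (\<tau> a b) = f a * g b)"


section \<open>Subproduct systems\<close>

text \<open>
  \<open>cstar_tensor_family\<close> fixes models of the tensor products that occur for a family \<open>A\<close>: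
  \<open>(T r s t, \<tau> r s t)\<close> for the tensor product of \<open>A r s\<close> and \<open>A s t\<close>, and \<open>T3 r s t u\<close> for the
  triple tensor products. The canonical identification of the two bracketings is expressed by
  equipping \<open>T3 r s t u\<close> with two elementary tensor maps, \<open>\<tau>l\<close> for the bracketing to the left and
  \<open>\<tau>r\<close> for the bracketing to the right, that agree on triples. The Hilbert space version is analogous.
\<close>

definition cstar_tensor_family ::
  "(real \<Rightarrow> real \<Rightarrow> 'a cstar) \<Rightarrow>
   (real \<Rightarrow> real \<Rightarrow> real \<Rightarrow> 'b cstar) \<Rightarrow> (real \<Rightarrow> real \<Rightarrow> real \<Rightarrow> 'a \<Rightarrow> 'a \<Rightarrow> 'b) \<Rightarrow>
   (real \<Rightarrow> real \<Rightarrow> real \<Rightarrow> real \<Rightarrow> 'c cstar) \<Rightarrow>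
   (real \<Rightarrow> real \<Rightarrow> real \<Rightarrow> real \<Rightarrow> 'b \<Rightarrow> 'a \<Rightarrow> 'c) \<Rightarrow>
   (real \<Rightarrow> real \<Rightarrow> real \<Rightarrow> real \<Rightarrow> 'a \<Rightarrow> 'b \<Rightarrow> 'c) \<Rightarrow> bool" where
  "cstar_tensor_family A T \<tau> T3 \<tau>l \<tau>r \<longleftrightarrow>
     (\<forall>r s t. 0 < r \<and> r < s \<and> s < t \<longrightarrow> injective_tensor (A r s) (A s t) (T r s t) (\<tau> r s t)) \<and>
     (\<forall>r s t u. 0 < r \<and> r < s \<and> s < t \<and> t < u \<longrightarrow>
        injective_tensor (T r s t) (A t u) (T3 r s t u) (\<tau>l r s t u) \<and>
        injective_tensor (A r s) (T s t u) (T3 r s t u) (\<tau>r r s t u) \<and>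
        (\<forall>a\<in>carrier (A r s). \<forall>b\<in>carrier (A s t). \<forall>c\<in>carrier (A t u).
           \<tau>l r s t u (\<tau> r s t a b) c = \<tau>r r s t u a (\<tau> s t u b c)))"

definition hilbert_tensor_family ::
  "(real \<Rightarrow> real \<Rightarrow> 'h hilb) \<Rightarrow>
   (real \<Rightarrow> real \<Rightarrow> real \<Rightarrow> 'k hilb) \<Rightarrow> (real \<Rightarrow> real \<Rightarrow> real \<Rightarrow> 'h \<Rightarrow> 'h \<Rightarrow> 'k) \<Rightarrow>
   (real \<Rightarrow> real \<Rightarrow> real \<Rightarrow> real \<Rightarrow> 'l hilb) \<Rightarrow>
   (real \<Rightarrow> real \<Rightarrow> real \<Rightarrow> real \<Rightarrow> 'k \<Rightarrow> 'h \<Rightarrow> 'l) \<Rightarrow>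
   (real \<Rightarrow> real \<Rightarrow> real \<Rightarrow> real \<Rightarrow> 'h \<Rightarrow> 'k \<Rightarrow> 'l) \<Rightarrow> bool" where
  "hilbert_tensor_family H L \<sigma> L3 \<sigma>l \<sigma>r \<longleftrightarrow>
     (\<forall>r s t. 0 < r \<and> r < s \<and> s < t \<longrightarrow> hilbert_tensor (H r s) (H s t) (L r s t) (\<sigma> r s t)) \<and>
     (\<forall>r s t u. 0 < r \<and> r < s \<and> s < t \<and> t < u \<longrightarrow>
        hilbert_tensor (L r s t) (H t u) (L3 r s t u) (\<sigma>l r s t u) \<and>
        hilbert_tensor (H r s) (L s t u) (L3 r s t u) (\<sigma>r r s t u) \<and>
        (\<forall>x\<in>carrier (H r s). \<forall>y\<in>carrier (H s t). \<forall>z\<in>carrier (H t u).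
           \<sigma>l r s t u (\<sigma> r s t x y) z = \<sigma>r r s t u x (\<sigma> s t u y z)))"

text \<open>
  In the co-associativity laws, \<open>F\<close> and \<open>G\<close> are the tensor products of the identity with \<open>\<Delta> s t u\<close>
  and of \<open>\<Delta> r s t\<close> with the identity; likewise for \<open>U\<close>.
\<close>

definition cstar_subproduct_system ::
  "(real \<Rightarrow> real \<Rightarrow> 'a cstar) \<Rightarrow>
   (real \<Rightarrow> real \<Rightarrow> real \<Rightarrow> 'b cstar) \<Rightarrow> (real \<Rightarrow> real \<Rightarrow> real \<Rightarrow> 'a \<Rightarrow> 'a \<Rightarrow> 'b) \<Rightarrow>
   (real \<Rightarrow> real \<Rightarrow> real \<Rightarrow> real \<Rightarrow> 'c cstar) \<Rightarrow>
   (real \<Rightarrow> real \<Rightarrow> real \<Rightarrow> real \<Rightarrow> 'b \<Rightarrow> 'a \<Rightarrow> 'c) \<Rightarrow>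
   (real \<Rightarrow> real \<Rightarrow> real \<Rightarrow> real \<Rightarrow> 'a \<Rightarrow> 'b \<Rightarrow> 'c) \<Rightarrow>
   (real \<Rightarrow> real \<Rightarrow> real \<Rightarrow> 'a \<Rightarrow> 'b) \<Rightarrow> bool" where
  "cstar_subproduct_system A T \<tau> T3 \<tau>l \<tau>r \<Delta> \<longleftrightarrow>
     (\<forall>s t. 0 < s \<and> s < t \<longrightarrow> cstar_algebra (A s t)) \<and>
     (\<forall>r s t. 0 < r \<and> r < s \<and> s < t \<longrightarrow> star_mono (A r t) (T r s t) (\<Delta> r s t)) \<and>
     (\<forall>r s t u. 0 < r \<and> r < s \<and> s < t \<and> t < u \<longrightarrow>
        (\<exists>F G. hom_tensor (A r s) (A s u) (T r s u) (\<tau> r s u) (T3 r s t u) (\<tau>r r s t u)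
                 (\<lambda>a. a) (\<Delta> s t u) F \<and>
               hom_tensor (A r t) (A t u) (T r t u) (\<tau> r t u) (T3 r s t u) (\<tau>l r s t u)
                 (\<Delta> r s t) (\<lambda>a. a) G \<and>
               (\<forall>a\<in>carrier (A r u). F (\<Delta> r s u a) = G (\<Delta> r t u a))))"

definition counit ::
  "(real \<Rightarrow> real \<Rightarrow> 'a cstar) \<Rightarrow>
   (real \<Rightarrow> real \<Rightarrow> real \<Rightarrow> 'b cstar) \<Rightarrow> (real \<Rightarrow> real \<Rightarrow> real \<Rightarrow> 'a \<Rightarrow> 'a \<Rightarrow> 'b) \<Rightarrow>
   (real \<Rightarrow> real \<Rightarrow> real \<Rightarrow> 'a \<Rightarrow> 'b) \<Rightarrow> (real \<Rightarrow> real \<Rightarrow> 'a \<Rightarrow> complex) \<Rightarrow> bool" where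
  "counit A T \<tau> \<Delta> \<phi> \<longleftrightarrow>
     (\<forall>s t. 0 < s \<and> s < t \<longrightarrow> state (A s t) (\<phi> s t)) \<and>
     (\<forall>r s t. 0 < r \<and> r < s \<and> s < t \<longrightarrow>
        (\<exists>\<omega>. functional_tensor (A r s) (A s t) (T r s t) (\<tau> r s t) (\<phi> r s) (\<phi> s t) \<omega> \<and>
             (\<forall>a\<in>carrier (A r t). \<phi> r t a = \<omega> (\<Delta> r s t a))))"

definition tsirelson_subproduct_system ::
  "(real \<Rightarrow> real \<Rightarrow> 'h hilb) \<Rightarrow>
   (real \<Rightarrow> real \<Rightarrow> real \<Rightarrow> 'k hilb) \<Rightarrow> (real \<Rightarrow> real \<Rightarrow> real \<Rightarrow> 'h \<Rightarrow> 'h \<Rightarrow> 'k) \<Rightarrow>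
   (real \<Rightarrow> real \<Rightarrow> real \<Rightarrow> real \<Rightarrow> 'l hilb) \<Rightarrow>
   (real \<Rightarrow> real \<Rightarrow> real \<Rightarrow> real \<Rightarrow> 'k \<Rightarrow> 'h \<Rightarrow> 'l) \<Rightarrow>
   (real \<Rightarrow> real \<Rightarrow> real \<Rightarrow> real \<Rightarrow> 'h \<Rightarrow> 'k \<Rightarrow> 'l) \<Rightarrow>
   (real \<Rightarrow> real \<Rightarrow> real \<Rightarrow> 'h \<Rightarrow> 'k) \<Rightarrow> bool" where
  "tsirelson_subproduct_system H L \<sigma> L3 \<sigma>l \<sigma>r U \<longleftrightarrow>
     (\<forall>s t. 0 < s \<and> s < t \<longrightarrow> hilbert_space (H s t)) \<and>
     (\<forall>r s t. 0 < r \<and> r < s \<and> s < t \<longrightarrow> isometry_op (H r t) (L r s t) (U r s t)) \<and>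
     (\<forall>r s t u. 0 < r \<and> r < s \<and> s < t \<and> t < u \<longrightarrow>
        (\<exists>F G. op_tensor (H r s) (H s u) (L r s u) (\<sigma> r s u) (L3 r s t u) (\<sigma>r r s t u)
                 (\<lambda>x. x) (U s t u) F \<and>
               op_tensor (H r t) (H t u) (L r t u) (\<sigma> r t u) (L3 r s t u) (\<sigma>l r s t u)
                 (U r s t) (\<lambda>x. x) G \<and>
               (\<forall>x\<in>carrier (H r u). F (U r s u x) = G (U r t u x))))"

end

theory Submission
  imports Defs
begin

text \<open>
  Let \<open>\<Lambda>\<close> be the GNS map \<open>a \<mapsto> \<pi> a \<xi>\<close>. The GNS maps of two algebras induce a GNS map \<open>N\<close> of the injective
  tensor product into the Hilbert space tensor product, with \<open>N (a \<otimes> b) = \<Lambda> a \<otimes> \<Lambda> b\<close>: the norm of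
  \<open>\<Sum> \<Lambda> (a i) \<otimes> \<Lambda> (b i)\<close> is bounded by the spatial norm of \<open>\<Sum> a i \<otimes> b i\<close>. The co-unit identity
  says that \<open>\<parallel>N (\<Delta> a)\<parallel> = \<parallel>\<Lambda> a\<parallel>\<close>, so \<open>V (\<Lambda> a) = N (\<Delta> a)\<close> defines an isometry. The GNS maps that the two
  bracketings induce on a triple tensor product coincide, and so co-associativity of \<open>\<Delta>\<close> passes to \<open>V\<close>.
\<close>


section \<open>Carrier-based normed spaces\<close>

text \<open>The algebras may lack a unit, so the cyclic vector is kept as separate data and need not
  lie in the range of the GNS map. All bounds come from one device: for ||x|| < 1 there is a
  self-adjoint b with x* x + b b = 2 b, whence ||\<Lambda> x||^2 + ||\<Lambda> b - \<zeta>||^2 =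
  ||\<zeta>||^2, and so ||\<Lambda> x|| \<le> ||\<zeta>|| without any continuity assumption. Other
  vectors in place of \<zeta> yield bounds for left multiplications, in a tensor product even for
  those by elements of one factor. The spatial norm is a supremum over representations on spaces of
  functions. Before it can bound anything, each GNS map has to be completed to a representation and
  carried over to such a space; the bound is then evaluation at a multiple of one elementary tensor
  of cyclic vectors. For the two bracketings the obstacle is that their GNS maps visibly agree only
  on triple elementary tensors, while the elementary tensor maps come without a continuity
  statement.\<close>

lemma complex_ring_simps [simp]:
  "carrier complex_ring = UNIV" "a \<oplus>\<^bsub>complex_ring\<^esub> b = a + b" "a \<otimes>\<^bsub>complex_ring\<^esub> b = a * b"
  "\<zero>\<^bsub>complex_ring\<^esub> = 0" "\<one>\<^bsub>complex_ring\<^esub> = 1"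
  by (simp_all add: complex_ring_def)

text \<open>The record extension \<open>'m\<close> stays free so that one development serves both
  \<open>cstar\<close> and \<open>hilb\<close> records.\<close>

locale complex_module = Module.module complex_ring V for V :: "(complex, 'a, 'm) module_scheme" (structure)
begin

lemma smult_closed' [simp, intro]: "x \<in> carrier V \<Longrightarrow> c \<odot> x \<in> carrier V"
  by (simp add: smult_closed)

lemma smult_simps [simp]:
  assumes "x \<in> carrier V"
  shows "0 \<odot> x = \<zero>" "1 \<odot> x = x" "a \<odot> (b \<odot> x) = (a * b) \<odot> x"
  using smult_l_null[OF assms] smult_one[OF assms] smult_assoc1[OF _ _ assms] by simp_all

lemma smult_add_left: "x \<in> carrier V \<Longrightarrow> (a + b) \<odot> x = a \<odot> x \<oplus> b \<odot> x"
  using smult_l_distr[of a b x] by simp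

lemma smult_add_right: "\<lbrakk>x \<in> carrier V; y \<in> carrier V\<rbrakk> \<Longrightarrow> c \<odot> (x \<oplus> y) = c \<odot> x \<oplus> c \<odot> y"
  using smult_r_distr[of c x y] by simp

lemma smult_zero [simp]: "c \<odot> \<zero> = \<zero>"
  using smult_r_null[of c] by simp

lemma neg_eq_smult: "x \<in> carrier V \<Longrightarrow> \<ominus> x = (- 1) \<odot> x"
  using smult_add_left[of x "- 1" 1] by (intro minus_equality) simp_all

lemma diff_eq_smult: "\<lbrakk>x \<in> carrier V; y \<in> carrier V\<rbrakk> \<Longrightarrow> x \<ominus> y = x \<oplus> (- 1) \<odot> y"
  by (simp add: minus_eq neg_eq_smult)

lemma diff_eq_zero_iff: "\<lbrakk>x \<in> carrier V; y \<in> carrier V\<rbrakk> \<Longrightarrow> x \<ominus> y = \<zero> \<longleftrightarrow> x = y"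
  by (metis M.minus_equality M.minus_minus M.r_neg a_inv_closed minus_eq)

lemma diff_add_diff:
  "\<lbrakk>x \<in> carrier V; y \<in> carrier V; z \<in> carrier V\<rbrakk> \<Longrightarrow> (x \<ominus> y) \<oplus> (y \<ominus> z) = x \<ominus> z"
  by (simp add: minus_eq M.a_assoc M.r_neg1)

lemma add_diff_add:
  "\<lbrakk>x \<in> carrier V; y \<in> carrier V; x' \<in> carrier V; y' \<in> carrier V\<rbrakk> \<Longrightarrow>
   (x \<oplus> y) \<ominus> (x' \<oplus> y') = (x \<ominus> x') \<oplus> (y \<ominus> y')"
  by (simp add: minus_eq M.minus_add M.a_ac)

lemma smult_diff: "\<lbrakk>x \<in> carrier V; y \<in> carrier V\<rbrakk> \<Longrightarrow> c \<odot> (x \<ominus> y) = c \<odot> x \<ominus> c \<odot> y"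
  by (simp add: diff_eq_smult smult_add_right)

lemma diff_add_cancel: "\<lbrakk>x \<in> carrier V; y \<in> carrier V\<rbrakk> \<Longrightarrow> (x \<ominus> y) \<oplus> y = x"
  by (simp add: minus_eq M.a_assoc M.l_neg)

lemma neg_diff: "\<lbrakk>x \<in> carrier V; y \<in> carrier V\<rbrakk> \<Longrightarrow> (- 1) \<odot> (x \<ominus> y) = y \<ominus> x"
  by (simp add: diff_eq_smult smult_add_right M.a_comm)

lemma finsum_lessThan_Suc:
  assumes "\<And>i. i < Suc n \<Longrightarrow> f i \<in> carrier V"
  shows "(\<Oplus>i\<in>{..<Suc n}. f i) = (\<Oplus>i\<in>{..<n}. f i) \<oplus> f n"
proof -
  have "(\<Oplus>i\<in>{..<Suc n}. f i) = f n \<oplus> (\<Oplus>i\<in>{..<n}. f i)"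
    unfolding lessThan_Suc using assms by (intro M.finsum_insert) auto
  then show ?thesis using assms by (simp add: M.a_comm Pi_def)
qed

text \<open>Concatenating index families is what makes the finite sums of a total family closed
  under addition.\<close>

lemma finsum_append:
  assumes "\<And>i. i < n \<Longrightarrow> f i \<in> carrier V" "\<And>i. i < m \<Longrightarrow> g i \<in> carrier V"
  shows "(\<Oplus>i\<in>{..<n + m::nat}. if i < n then f i else g (i - n)) = (\<Oplus>i\<in>{..<n}. f i) \<oplus> (\<Oplus>i\<in>{..<m}. g i)"
  using assms(2)
proof (induction m)
  case 0
  have "(\<Oplus>i\<in>{..<n}. if i < n then f i else g (i - n)) = (\<Oplus>i\<in>{..<n}. f i)"
    using assms(1) by (intro M.finsum_cong') auto
  then show ?case using assms(1) by (simp add: Pi_def)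
next
  case (Suc m)
  have "(\<Oplus>i\<in>{..<n + Suc m}. if i < n then f i else g (i - n))
      = (\<Oplus>i\<in>{..<n + m::nat}. if i < n then f i else g (i - n)) \<oplus> g m"
    using assms(1) Suc.prems by (simp add: finsum_lessThan_Suc del: M.add.finprod_Suc)
  then show ?case
    using assms(1) Suc by (simp add: finsum_lessThan_Suc M.a_assoc Pi_def)
qed

end

section \<open>Linear and bilinear maps\<close>

lemma linear_onD:
  assumes "linear_on V W f"
  shows "x \<in> carrier V \<Longrightarrow> f x \<in> carrier W"
    and "\<lbrakk>x \<in> carrier V; y \<in> carrier V\<rbrakk> \<Longrightarrow> f (x \<oplus>\<^bsub>V\<^esub> y) = f x \<oplus>\<^bsub>W\<^esub> f y"
    and "x \<in> carrier V \<Longrightarrow> f (c \<odot>\<^bsub>V\<^esub> x) = c \<odot>\<^bsub>W\<^esub> f x"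
  using assms by (auto simp: linear_on_def)

lemma linear_onI:
  assumes "\<And>x. x \<in> carrier V \<Longrightarrow> f x \<in> carrier W"
    and "\<And>x y. \<lbrakk>x \<in> carrier V; y \<in> carrier V\<rbrakk> \<Longrightarrow> f (x \<oplus>\<^bsub>V\<^esub> y) = f x \<oplus>\<^bsub>W\<^esub> f y"
    and "\<And>c x. x \<in> carrier V \<Longrightarrow> f (c \<odot>\<^bsub>V\<^esub> x) = c \<odot>\<^bsub>W\<^esub> f x"
  shows "linear_on V W f"
  using assms by (auto simp: linear_on_def)

lemma linear_on_comp: "\<lbrakk>linear_on V W f; linear_on W X g\<rbrakk> \<Longrightarrow> linear_on V X (\<lambda>x. g (f x))"
  by (auto simp: linear_on_def Pi_def)

lemma linear_on_diff:
  assumes "linear_on V W f" "complex_module V" "complex_module W" "x \<in> carrier V" "y \<in> carrier V"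
  shows "f (x \<ominus>\<^bsub>V\<^esub> y) = f x \<ominus>\<^bsub>W\<^esub> f y"
proof -
  interpret V: complex_module V by fact
  interpret W: complex_module W by fact
  show ?thesis using assms by (simp add: V.diff_eq_smult W.diff_eq_smult linear_onD)
qed

lemma linear_on_finsum:
  assumes f: "linear_on V W f" and V: "complex_module V" and W: "complex_module W"
    and v: "\<And>i. i < n \<Longrightarrow> v i \<in> carrier V"
  shows "f (\<Oplus>\<^bsub>V\<^esub>i\<in>{..<n::nat}. v i) = (\<Oplus>\<^bsub>W\<^esub>i\<in>{..<n}. f (v i))"
  using v
proof (induction n)
  interpret V: complex_module V by fact
  interpret W: complex_module W by fact
  case 0
  \<comment> \<open>\<open>linear_on\<close> determines \<open>f\<close> at zero only through
    homogeneity with scalar 0.\<close>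
  have "f (0 \<odot>\<^bsub>V\<^esub> \<zero>\<^bsub>V\<^esub>) = 0 \<odot>\<^bsub>W\<^esub> f \<zero>\<^bsub>V\<^esub>"
    using f by (intro linear_onD(3)) auto
  then show ?case using linear_onD(1)[OF f V.zero_closed] by simp
next
  interpret V: complex_module V by fact
  interpret W: complex_module W by fact
  case (Suc n)
  then show ?case
    using linear_onD(1)[OF f] by (simp add: V.finsum_lessThan_Suc W.finsum_lessThan_Suc linear_onD(2)[OF f] Pi_def)
qed

lemma bilinear_onD:
  assumes "bilinear_on V W X f"
  shows "x \<in> carrier V \<Longrightarrow> linear_on W X (f x)" "y \<in> carrier W \<Longrightarrow> linear_on V X (\<lambda>x. f x y)"
    "\<lbrakk>x \<in> carrier V; y \<in> carrier W\<rbrakk> \<Longrightarrow> f x y \<in> carrier X"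
  using assms by (auto simp: bilinear_on_def linear_on_def)

text \<open>The norm is a parameter because the two record types carry it differently:
  \<open>cnorm\<close> is a field, while \<open>hnorm\<close> is derived from
  \<open>iprod\<close>.\<close>

locale normed_module = complex_module V for V :: "(complex, 'a, 'm) module_scheme" (structure) +
  fixes N :: "'a \<Rightarrow> real"
  assumes N_nonneg: "x \<in> carrier V \<Longrightarrow> 0 \<le> N x"
    and N_eq_0: "x \<in> carrier V \<Longrightarrow> N x = 0 \<longleftrightarrow> x = \<zero>"
    and N_smult: "x \<in> carrier V \<Longrightarrow> N (c \<odot> x) = cmod c * N x"
    and N_triangle: "\<lbrakk>x \<in> carrier V; y \<in> carrier V\<rbrakk> \<Longrightarrow> N (x \<oplus> y) \<le> N x + N y"
begin

text \<open>Extended by 0 off the carrier so that it coincides with \<open>cdist\<close> and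
  \<open>hdist\<close>; completeness and density in the definitions then refer to this
  metric.\<close>

definition ndist :: "'a \<Rightarrow> 'a \<Rightarrow> real" where
  "ndist x y = (if x \<in> carrier V \<and> y \<in> carrier V then N (x \<ominus> y) else 0)"

lemma N_diff_commute: "\<lbrakk>x \<in> carrier V; y \<in> carrier V\<rbrakk> \<Longrightarrow> N (x \<ominus> y) = N (y \<ominus> x)"
  using N_smult[of "x \<ominus> y" "- 1"] by (simp add: neg_diff)

lemma N_diff_triangle:
  "\<lbrakk>x \<in> carrier V; y \<in> carrier V; z \<in> carrier V\<rbrakk> \<Longrightarrow> N (x \<ominus> z) \<le> N (x \<ominus> y) + N (y \<ominus> z)"
  using N_triangle[of "x \<ominus> y" "y \<ominus> z"] by (simp add: diff_add_diff)

lemma N_diff_le: "\<lbrakk>x \<in> carrier V; y \<in> carrier V\<rbrakk> \<Longrightarrow> N x \<le> N (x \<ominus> y) + N y"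
  using N_triangle[of "x \<ominus> y" y] by (simp add: diff_add_cancel)

lemma abs_N_diff_le: "\<lbrakk>x \<in> carrier V; y \<in> carrier V\<rbrakk> \<Longrightarrow> \<bar>N x - N y\<bar> \<le> N (x \<ominus> y)"
  using N_diff_le[of x y] N_diff_le[of y x] N_diff_commute[of x y] by linarith

sublocale Metric: Metric_space "carrier V" ndist
proof
  fix x y z assume "x \<in> carrier V" "y \<in> carrier V"
  then show "ndist x y = 0 \<longleftrightarrow> x = y" by (simp add: ndist_def N_eq_0 diff_eq_zero_iff)
  assume "z \<in> carrier V"
  with \<open>x \<in> carrier V\<close> \<open>y \<in> carrier V\<close> show "ndist x z \<le> ndist x y + ndist y z"
    by (simp add: ndist_def N_diff_triangle)
qed (auto simp: ndist_def N_nonneg N_diff_commute)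

text \<open>\<open>S\<close> may stick out of the carrier, as \<open>closure_of\<close> allows;
  hence the extra membership.\<close>

definition dense :: "'a set \<Rightarrow> bool" where
  "dense S \<longleftrightarrow> (\<forall>x\<in>carrier V. \<forall>e>0. \<exists>y\<in>S. y \<in> carrier V \<and> N (x \<ominus> y) < e)"

lemma dense_iff_closure_of: "dense S \<longleftrightarrow> Metric.mtopology closure_of S = carrier V"
  unfolding dense_def Metric.metric_closure_of by (auto simp: ndist_def set_eq_iff)

lemma denseE:
  assumes "dense S" "x \<in> carrier V" "0 < e"
  obtains y where "y \<in> S" "y \<in> carrier V" "N (x \<ominus> y) < e"
  using assms unfolding dense_def by blast

lemma complete_imp_limit:
  assumes "Metric.mcomplete" "\<And>n. s n \<in> carrier V"
    and "\<And>e. 0 < e \<Longrightarrow> \<exists>M::nat. \<forall>m\<ge>M. \<forall>n\<ge>M. N (s m \<ominus> s n) < e"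
  obtains l where "l \<in> carrier V" "(\<lambda>n. N (s n \<ominus> l)) \<longlonglongrightarrow> 0"
proof -
  have "Metric.MCauchy s"
    using assms(2,3) unfolding Metric.MCauchy_def by (auto simp: ndist_def)
  then obtain l where l: "limitin Metric.mtopology s l sequentially"
    using assms(1) unfolding Metric.mcomplete_def by blast
  then have lc: "l \<in> carrier V" and lim: "\<And>e. e > 0 \<Longrightarrow> \<exists>M. \<forall>n\<ge>M. ndist (s n) l < e"
    unfolding Metric.limit_metric_sequentially by blast+
  moreover have "(\<lambda>n. N (s n \<ominus> l)) \<longlonglongrightarrow> 0"
  proof (rule LIMSEQ_I)
    fix e :: real assume "e > 0"
    with lim obtain M where "\<forall>n\<ge>M. ndist (s n) l < e" by blast
    then show "\<exists>no. \<forall>n\<ge>no. norm (N (s n \<ominus> l) - 0) < e"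
      using lc assms(2) by (auto simp: ndist_def N_nonneg)
  qed
  ultimately show thesis using that by blast
qed

text \<open>Lipschitz estimates stand in for continuity: they are what bounded linear maps and norms
  supply on a carrier, where no type class provides a topology.\<close>

lemma dense_agree:
  fixes F G :: "'a \<Rightarrow> 'z::real_normed_vector"
  assumes S: "dense S" and eq: "\<And>x. \<lbrakk>x \<in> S; x \<in> carrier V\<rbrakk> \<Longrightarrow> F x = G x" and x: "x \<in> carrier V"
    and F: "\<And>x y. \<lbrakk>x \<in> carrier V; y \<in> carrier V\<rbrakk> \<Longrightarrow> norm (F x - F y) \<le> C * N (x \<ominus> y)"
    and G: "\<And>x y. \<lbrakk>x \<in> carrier V; y \<in> carrier V\<rbrakk> \<Longrightarrow> norm (G x - G y) \<le> D * N (x \<ominus> y)"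
  shows "F x = G x"
proof -
  \<comment> \<open>\<open>C\<close> and \<open>D\<close> carry no sign assumption; \<open>E\<close>
    is positive and at least \<open>C + D\<close>.\<close>
  define E where "E = \<bar>C\<bar> + \<bar>D\<bar> + 1"
  have E: "E > 0" "C + D \<le> E" by (auto simp: E_def)
  have "norm (F x - G x) < e" if e: "e > 0" for e
  proof -
    obtain y where y: "y \<in> S" "y \<in> carrier V" "N (x \<ominus> y) < e / E"
      using denseE[OF S x, of "e / E"] e E by auto
    have "norm (F x - G x) \<le> norm (F x - F y) + norm (G x - G y)"
      using eq[OF y(1,2)] norm_triangle_ineq4[of "F x - F y" "G x - G y"] by simp
    also have "\<dots> \<le> (C + D) * N (x \<ominus> y)"
      using F[OF x y(2)] G[OF x y(2)] by (simp add: algebra_simps)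
    also have "\<dots> \<le> E * N (x \<ominus> y)"
      using E N_nonneg[of "x \<ominus> y"] x y by (intro mult_right_mono) auto
    also have "\<dots> < e" using y E by (simp add: field_simps)
    finally show ?thesis .
  qed
  then have "norm (F x - G x) \<le> 0" by (meson not_less_iff_gr_or_eq not_le)
  then show ?thesis by simp
qed

end

section \<open>Uniqueness and extension of bounded maps\<close>

lemma complex_moduleI: "normed_module V N \<Longrightarrow> complex_module V"
  by (rule normed_module.axioms)

text \<open>The target is a carrier and not a normed type, so \<open>dense_agree\<close> is applied
  to the real function M (f x - g x) and to 0.\<close>

lemma linear_bounded_agree:
  assumes V: "normed_module V N" and W: "normed_module W M"
    and f: "linear_on V W f" "\<And>x. x \<in> carrier V \<Longrightarrow> M (f x) \<le> C * N x"
    and g: "linear_on V W g" "\<And>x. x \<in> carrier V \<Longrightarrow> M (g x) \<le> D * N x"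
    and S: "normed_module.dense V N S" and eq: "\<And>x. \<lbrakk>x \<in> S; x \<in> carrier V\<rbrakk> \<Longrightarrow> f x = g x"
    and x: "x \<in> carrier V"
  shows "f x = g x"
proof -
  interpret V: normed_module V N by fact
  interpret W: normed_module W M by fact
  have fc: "f y \<in> carrier W" and gc: "g y \<in> carrier W" if "y \<in> carrier V" for y
    using that f(1) g(1) by (auto simp: linear_onD)
  have "M (f x \<ominus>\<^bsub>W\<^esub> g x) = 0"
  proof (rule V.dense_agree[OF S _ x, where C = "C + D" and D = 0])
    fix y assume "y \<in> S" "y \<in> carrier V"
    then show "M (f y \<ominus>\<^bsub>W\<^esub> g y) = 0"
      using fc[of y] gc[of y] eq[of y] by (simp add: W.N_eq_0 W.diff_eq_zero_iff)
  next
    fix y z assume yz: "y \<in> carrier V" "z \<in> carrier V"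
    let ?d = "y \<ominus>\<^bsub>V\<^esub> z"
    have "(f y \<ominus>\<^bsub>W\<^esub> g y) \<ominus>\<^bsub>W\<^esub> (f z \<ominus>\<^bsub>W\<^esub> g z) = (f y \<ominus>\<^bsub>W\<^esub> f z) \<oplus>\<^bsub>W\<^esub> (-1) \<odot>\<^bsub>W\<^esub> (g y \<ominus>\<^bsub>W\<^esub> g z)"
      using yz fc gc by (simp add: W.diff_eq_smult W.smult_add_right W.M.a_ac)
    also have "\<dots> = f ?d \<oplus>\<^bsub>W\<^esub> (-1) \<odot>\<^bsub>W\<^esub> g ?d"
      using yz by (simp add: linear_on_diff[OF f(1)] linear_on_diff[OF g(1)] V.complex_module_axioms W.complex_module_axioms)
    finally have "M ((f y \<ominus>\<^bsub>W\<^esub> g y) \<ominus>\<^bsub>W\<^esub> (f z \<ominus>\<^bsub>W\<^esub> g z)) \<le> M (f ?d) + M (g ?d)"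
      using yz fc[of ?d] gc[of ?d] W.N_triangle[of "f ?d" "(-1) \<odot>\<^bsub>W\<^esub> g ?d"] by (simp add: W.N_smult)
    also have "\<dots> \<le> (C + D) * N ?d"
      using f(2)[of ?d] g(2)[of ?d] yz by (simp add: algebra_simps)
    finally show "norm (M (f y \<ominus>\<^bsub>W\<^esub> g y) - M (f z \<ominus>\<^bsub>W\<^esub> g z)) \<le> (C + D) * N ?d"
      using W.abs_N_diff_le[of "f y \<ominus>\<^bsub>W\<^esub> g y" "f z \<ominus>\<^bsub>W\<^esub> g z"] yz fc gc by simp
  qed simp
  then show ?thesis using fc[OF x] gc[OF x] by (simp add: W.N_eq_0 W.diff_eq_zero_iff)
qed

lemma linear_functionalD:
  assumes "linear_functional V f"
  shows "\<lbrakk>x \<in> carrier V; y \<in> carrier V\<rbrakk> \<Longrightarrow> f (x \<oplus>\<^bsub>V\<^esub> y) = f x + f y"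
    and "x \<in> carrier V \<Longrightarrow> f (c \<odot>\<^bsub>V\<^esub> x) = c * f x"
  using assms by (auto simp: linear_functional_def)

lemma linear_functional_comp:
  "\<lbrakk>linear_on V W f; linear_functional W g\<rbrakk> \<Longrightarrow> linear_functional V (\<lambda>x. g (f x))"
  by (auto simp: linear_on_def linear_functional_def Pi_def)

lemma functional_bounded_agree:
  assumes V: "normed_module V N"
    and f: "linear_functional V f" "\<And>x. x \<in> carrier V \<Longrightarrow> cmod (f x) \<le> C * N x"
    and g: "linear_functional V g" "\<And>x. x \<in> carrier V \<Longrightarrow> cmod (g x) \<le> D * N x"
    and S: "normed_module.dense V N S" and eq: "\<And>x. \<lbrakk>x \<in> S; x \<in> carrier V\<rbrakk> \<Longrightarrow> f x = g x"
    and x: "x \<in> carrier V"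
  shows "f x = g x"
proof -
  interpret V: normed_module V N by fact
  have lip: "norm (h y - h z) \<le> K * N (y \<ominus>\<^bsub>V\<^esub> z)"
    if "linear_functional V h" "\<And>x. x \<in> carrier V \<Longrightarrow> cmod (h x) \<le> K * N x" "y \<in> carrier V" "z \<in> carrier V"
    for h K y z
    using that(2)[of "y \<ominus>\<^bsub>V\<^esub> z"] that(3,4) by (simp add: V.diff_eq_smult linear_functionalD[OF that(1)])
  show ?thesis
    by (rule V.dense_agree[OF S eq x lip[OF f] lip[OF g]])
qed

lemma functional_finsum:
  assumes f: "linear_functional V f" and V: "complex_module V"
    and v: "\<And>i. i < n \<Longrightarrow> v i \<in> carrier V"
  shows "f (\<Oplus>\<^bsub>V\<^esub>i\<in>{..<n::nat}. v i) = (\<Sum>i<n. f (v i))"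
proof -
  interpret V: complex_module V by fact
  have f0: "f \<zero>\<^bsub>V\<^esub> = 0"
    using linear_functionalD(2)[OF f V.zero_closed, of 0] by simp
  show ?thesis
    using v
    by (induction n) (simp_all add: f0 V.finsum_lessThan_Suc linear_functionalD(1)[OF f] Pi_def)
qed

text \<open>The map to be extended is given as a relation because a vector can have many
  presentations, as \<open>\<Lambda> a\<close> or as a sum of tensors. The bound, applied to
  differences, makes the relation single-valued, so that no separate argument for well-definedness
  arises later.\<close>

lemma linear_bounded_extension:
  assumes V: "normed_module V N" and W: "normed_module W M"
    and complete: "Metric_space.mcomplete (carrier W) (normed_module.ndist W M)"
    and R: "\<And>v w. R v w \<Longrightarrow> v \<in> carrier V \<and> w \<in> carrier W"
    and R_add: "\<And>v w v' w'. \<lbrakk>R v w; R v' w'\<rbrakk> \<Longrightarrow> R (v \<oplus>\<^bsub>V\<^esub> v') (w \<oplus>\<^bsub>W\<^esub> w')"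
    and R_smult: "\<And>c v w. R v w \<Longrightarrow> R (c \<odot>\<^bsub>V\<^esub> v) (c \<odot>\<^bsub>W\<^esub> w)"
    and R_dense: "normed_module.dense V N {v. \<exists>w. R v w}"
    and R_bound: "\<And>v w. R v w \<Longrightarrow> M w \<le> C * N v" and C: "0 \<le> C"
  obtains f where "linear_on V W f" "\<And>v. v \<in> carrier V \<Longrightarrow> M (f v) \<le> C * N v" "\<And>v w. R v w \<Longrightarrow> f v = w"
proof -
  interpret V: normed_module V N by fact
  interpret W: normed_module W M by fact
  \<comment> \<open>\<open>P\<close> is the closure of the graph \<open>R\<close>. It inherits
    linearity and the bound; density of the domain and completeness of \<open>W\<close> make it
    total.\<close>
  define P where "P v w \<longleftrightarrow> v \<in> carrier V \<and> w \<in> carrier W \<and>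
    (\<forall>e>0. \<exists>v' w'. R v' w' \<and> N (v \<ominus>\<^bsub>V\<^esub> v') < e \<and> M (w \<ominus>\<^bsub>W\<^esub> w') < e)" for v w
  have P_add: "P (v1 \<oplus>\<^bsub>V\<^esub> v2) (w1 \<oplus>\<^bsub>W\<^esub> w2)" if P: "P v1 w1" "P v2 w2" for v1 w1 v2 w2
    unfolding P_def
  proof (intro conjI allI impI)
    show "v1 \<oplus>\<^bsub>V\<^esub> v2 \<in> carrier V" "w1 \<oplus>\<^bsub>W\<^esub> w2 \<in> carrier W" using P by (auto simp: P_def)
    fix e :: real assume "e > 0"
    then have e2: "e / 2 > 0" by simp
    obtain v1' w1' where 1: "R v1' w1'" "N (v1 \<ominus>\<^bsub>V\<^esub> v1') < e / 2" "M (w1 \<ominus>\<^bsub>W\<^esub> w1') < e / 2"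
      using P(1) e2 unfolding P_def by blast
    obtain v2' w2' where 2: "R v2' w2'" "N (v2 \<ominus>\<^bsub>V\<^esub> v2') < e / 2" "M (w2 \<ominus>\<^bsub>W\<^esub> w2') < e / 2"
      using P(2) e2 unfolding P_def by blast
    have c: "v1 \<in> carrier V" "v2 \<in> carrier V" "v1' \<in> carrier V" "v2' \<in> carrier V"
      "w1 \<in> carrier W" "w2 \<in> carrier W" "w1' \<in> carrier W" "w2' \<in> carrier W"
      using P R[OF 1(1)] R[OF 2(1)] by (auto simp: P_def)
    have "N ((v1 \<oplus>\<^bsub>V\<^esub> v2) \<ominus>\<^bsub>V\<^esub> (v1' \<oplus>\<^bsub>V\<^esub> v2')) < e"
      using V.N_triangle[of "v1 \<ominus>\<^bsub>V\<^esub> v1'" "v2 \<ominus>\<^bsub>V\<^esub> v2'"] c 1 2 by (simp add: V.add_diff_add)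
    moreover have "M ((w1 \<oplus>\<^bsub>W\<^esub> w2) \<ominus>\<^bsub>W\<^esub> (w1' \<oplus>\<^bsub>W\<^esub> w2')) < e"
      using W.N_triangle[of "w1 \<ominus>\<^bsub>W\<^esub> w1'" "w2 \<ominus>\<^bsub>W\<^esub> w2'"] c 1 2 by (simp add: W.add_diff_add)
    ultimately show "\<exists>v' w'. R v' w' \<and> N ((v1 \<oplus>\<^bsub>V\<^esub> v2) \<ominus>\<^bsub>V\<^esub> v') < e \<and> M ((w1 \<oplus>\<^bsub>W\<^esub> w2) \<ominus>\<^bsub>W\<^esub> w') < e"
      using R_add[OF 1(1) 2(1)] by blast
  qed
  have P_smult: "P (c \<odot>\<^bsub>V\<^esub> v) (c \<odot>\<^bsub>W\<^esub> w)" if P: "P v w" for c v w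
    unfolding P_def
  proof (intro conjI allI impI)
    show "c \<odot>\<^bsub>V\<^esub> v \<in> carrier V" "c \<odot>\<^bsub>W\<^esub> w \<in> carrier W" using P by (auto simp: P_def)
    fix e :: real assume "e > 0"
    \<comment> \<open>The summand 1 covers \<open>c = 0\<close>.\<close>
    then have "e / (cmod c + 1) > 0" by (simp add: add_nonneg_pos)
    then obtain v' w' where 1: "R v' w'" "N (v \<ominus>\<^bsub>V\<^esub> v') < e / (cmod c + 1)" "M (w \<ominus>\<^bsub>W\<^esub> w') < e / (cmod c + 1)"
      using P unfolding P_def by blast
    have c: "v \<in> carrier V" "v' \<in> carrier V" "w \<in> carrier W" "w' \<in> carrier W"
      using P R[OF 1(1)] by (auto simp: P_def)
    have *: "cmod c * t < e" if "0 \<le> t" "t < e / (cmod c + 1)" for t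
    proof -
      have "cmod c * t \<le> (cmod c + 1) * t" using that by (simp add: mult_right_mono)
      also have "\<dots> < e" using that by (simp add: pos_less_divide_eq add_nonneg_pos mult.commute)
      finally show ?thesis .
    qed
    have "N (c \<odot>\<^bsub>V\<^esub> v \<ominus>\<^bsub>V\<^esub> c \<odot>\<^bsub>V\<^esub> v') < e" "M (c \<odot>\<^bsub>W\<^esub> w \<ominus>\<^bsub>W\<^esub> c \<odot>\<^bsub>W\<^esub> w') < e"
      using * 1 c by (simp_all add: V.smult_diff[symmetric] W.smult_diff[symmetric] V.N_smult W.N_smult V.N_nonneg W.N_nonneg)
    then show "\<exists>v' w'. R v' w' \<and> N (c \<odot>\<^bsub>V\<^esub> v \<ominus>\<^bsub>V\<^esub> v') < e \<and> M (c \<odot>\<^bsub>W\<^esub> w \<ominus>\<^bsub>W\<^esub> w') < e"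
      using R_smult[OF 1(1)] by blast
  qed
  have P_bound: "M w \<le> C * N v" if P: "P v w" for v w
  proof (rule field_le_epsilon)
    fix e :: real assume "e > 0"
    \<comment> \<open>The error in \<open>w\<close> counts once and the error in \<open>v\<close>
      counts \<open>C\<close> times, together \<open>C + 1\<close> shares of
      \<open>e\<close>.\<close>
    then have "e / (C + 1) > 0" using C by simp
    then obtain v' w' where 1: "R v' w'" "N (v \<ominus>\<^bsub>V\<^esub> v') < e / (C + 1)" "M (w \<ominus>\<^bsub>W\<^esub> w') < e / (C + 1)"
      using P unfolding P_def by blast
    have c: "v \<in> carrier V" "v' \<in> carrier V" "w \<in> carrier W" "w' \<in> carrier W"
      using P R[OF 1(1)] by (auto simp: P_def)
    have "N v' \<le> N v + e / (C + 1)"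
      using V.N_diff_le[of v' v] 1(2) c by (simp add: V.N_diff_commute)
    then have "C * N v' \<le> C * (N v + e / (C + 1))" using C by (rule mult_left_mono)
    then have "M w \<le> e / (C + 1) + C * (N v + e / (C + 1))"
      using W.N_diff_le[of w w'] 1(3) c R_bound[OF 1(1)] by linarith
    also have "\<dots> = C * N v + (C + 1) * (e / (C + 1))" by (simp add: algebra_simps add_divide_distrib)
    also have "\<dots> = C * N v + e" using C by simp
    finally show "M w \<le> C * N v + e" .
  qed
  have P_unique: "w = w'" if P: "P v w" "P v w'" for v w w'
  proof -
    have c: "v \<in> carrier V" "w \<in> carrier W" "w' \<in> carrier W" using P by (auto simp: P_def)
    \<comment> \<open>By linearity the difference of two values at \<open>v\<close> is a value at
      zero, where the bound forces it to vanish.\<close>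
    have "P (v \<ominus>\<^bsub>V\<^esub> v) (w \<ominus>\<^bsub>W\<^esub> w')"
      using P_add[OF P(1) P_smult[OF P(2), of "-1"]] c by (simp add: V.diff_eq_smult W.diff_eq_smult)
    from P_bound[OF this] have "M (w \<ominus>\<^bsub>W\<^esub> w') \<le> 0"
      using c V.diff_eq_zero_iff[of v v] V.N_eq_0[of "\<zero>\<^bsub>V\<^esub>"] by simp
    then show ?thesis
      using c W.N_nonneg[of "w \<ominus>\<^bsub>W\<^esub> w'"] by (simp add: W.N_eq_0 W.diff_eq_zero_iff)
  qed
  have P_exists: "\<exists>w. P v w" if v: "v \<in> carrier V" for v
  proof -
    have "\<exists>v' w'. R v' w' \<and> N (v \<ominus>\<^bsub>V\<^esub> v') < 1 / Suc n" for n
    proof -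
      have "0 < 1 / real (Suc n)" by simp
      from V.denseE[OF R_dense v this] show ?thesis by blast
    qed
    then obtain vs ws where vs: "\<And>n. R (vs n) (ws n)" "\<And>n. N (v \<ominus>\<^bsub>V\<^esub> vs n) < 1 / Suc n"
      by metis
    have c: "vs n \<in> carrier V" "ws n \<in> carrier W" for n using R[OF vs(1)] by auto
    \<comment> \<open>\<open>R\<close> contains the differences of the approximants, so
      \<open>ws\<close> is Cauchy because \<open>vs\<close> is.\<close>
    have diff: "M (ws m \<ominus>\<^bsub>W\<^esub> ws n) \<le> C * N (vs m \<ominus>\<^bsub>V\<^esub> vs n)" for m n
      using R_bound[OF R_add[OF vs(1)[of m] R_smult[OF vs(1)[of n], of "-1"]]] c
      by (simp add: V.diff_eq_smult W.diff_eq_smult)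
    have small: "\<exists>k. \<forall>n\<ge>k. 1 / Suc n < e" if e: "e > 0" for e :: real
    proof -
      obtain k where k: "1 / Suc k < e" by (rule nat_approx_posE[OF e])
      have "1 / Suc n < e" if "n \<ge> k" for n
      proof -
        have "1 / real (Suc n) \<le> 1 / Suc k" using that by (intro divide_left_mono) auto
        then show ?thesis using k by linarith
      qed
      then show ?thesis by blast
    qed
    obtain w where w: "w \<in> carrier W" "(\<lambda>n. M (ws n \<ominus>\<^bsub>W\<^esub> w)) \<longlonglongrightarrow> 0"
    proof (rule W.complete_imp_limit[OF complete c(2)])
      fix e :: real assume "e > 0"
      \<comment> \<open>Both \<open>vs m\<close> and \<open>vs n\<close> are this close to
        \<open>v\<close>, hence within \<open>e / (C + 1)\<close> of each other.\<close>
      then have "e / (C + 1) / 2 > 0" using C by simp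
      then obtain k where k: "\<And>n. n \<ge> k \<Longrightarrow> 1 / Suc n < e / (C + 1) / 2" using small by blast
      have "M (ws m \<ominus>\<^bsub>W\<^esub> ws n) < e" if mn: "m \<ge> k" "n \<ge> k" for m n
      proof -
        have "N (vs m \<ominus>\<^bsub>V\<^esub> vs n) \<le> N (v \<ominus>\<^bsub>V\<^esub> vs m) + N (v \<ominus>\<^bsub>V\<^esub> vs n)"
          using V.N_diff_triangle[of "vs m" v "vs n"] c v by (simp add: V.N_diff_commute)
        then have le: "N (vs m \<ominus>\<^bsub>V\<^esub> vs n) < e / (C + 1)"
          using vs(2)[of m] vs(2)[of n] k[OF mn(1)] k[OF mn(2)] by linarith
        have "M (ws m \<ominus>\<^bsub>W\<^esub> ws n) \<le> C * N (vs m \<ominus>\<^bsub>V\<^esub> vs n)" by (rule diff)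
        also have "\<dots> \<le> (C + 1) * N (vs m \<ominus>\<^bsub>V\<^esub> vs n)"
          using c by (intro mult_right_mono) (auto simp: V.N_nonneg)
        also have "\<dots> < e" using le C by (simp add: pos_less_divide_eq mult.commute)
        finally show ?thesis .
      qed
      then show "\<exists>k. \<forall>m\<ge>k. \<forall>n\<ge>k. M (ws m \<ominus>\<^bsub>W\<^esub> ws n) < e" by blast
    qed blast
    have "P v w"
      unfolding P_def
    proof (intro conjI allI impI)
      fix e :: real assume e: "e > 0"
      obtain k where k: "\<And>n. n \<ge> k \<Longrightarrow> 1 / Suc n < e" using small[OF e] by blast
      obtain k' where k': "\<And>n. n \<ge> k' \<Longrightarrow> \<bar>M (ws n \<ominus>\<^bsub>W\<^esub> w)\<bar> < e"
        using LIMSEQ_D[OF w(2) e] by auto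
      let ?n = "max k k'"
      have "N (v \<ominus>\<^bsub>V\<^esub> vs ?n) < e" using vs(2)[of ?n] k[of ?n] by linarith
      moreover have "M (w \<ominus>\<^bsub>W\<^esub> ws ?n) < e"
        using k'[of ?n] w(1) c W.N_diff_commute[of w "ws ?n"] by auto
      ultimately show "\<exists>v' w'. R v' w' \<and> N (v \<ominus>\<^bsub>V\<^esub> v') < e \<and> M (w \<ominus>\<^bsub>W\<^esub> w') < e"
        using vs(1) by blast
    qed (use v w in auto)
    then show ?thesis ..
  qed
  define f where "f v = (SOME w. P v w)" for v
  have Pf: "P v (f v)" if "v \<in> carrier V" for v
    unfolding f_def using P_exists[OF that] by (rule someI_ex)
  show thesis
  proof (rule that[of f])
    show "linear_on V W f"
    proof (rule linear_onI)
      show "f x \<in> carrier W" if "x \<in> carrier V" for x using Pf[OF that] by (simp add: P_def)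
      show "f (x \<oplus>\<^bsub>V\<^esub> y) = f x \<oplus>\<^bsub>W\<^esub> f y" if "x \<in> carrier V" "y \<in> carrier V" for x y
        using that by (intro P_unique[OF Pf P_add[OF Pf Pf]]) auto
      show "f (c \<odot>\<^bsub>V\<^esub> x) = c \<odot>\<^bsub>W\<^esub> f x" if "x \<in> carrier V" for c x
        using that by (intro P_unique[OF Pf P_smult[OF Pf]]) auto
    qed
    show "M (f v) \<le> C * N v" if "v \<in> carrier V" for v using P_bound[OF Pf[OF that]] .
    show "f v = w" if "R v w" for v w
    proof -
      have c: "v \<in> carrier V" "w \<in> carrier W" using R[OF that] by auto
      have "P v w"
        unfolding P_def using c that V.diff_eq_zero_iff[of v v] W.diff_eq_zero_iff[of w w]
          V.N_eq_0[of "\<zero>\<^bsub>V\<^esub>"] W.N_eq_0[of "\<zero>\<^bsub>W\<^esub>"]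
        by (auto intro!: exI[of _ v] exI[of _ w])
      then show ?thesis using P_unique[OF Pf[OF c(1)]] by blast
    qed
  qed
qed

text \<open>The common shape of the dense sets in \<open>hilbert_tensor\<close> and
  \<open>injective_tensor\<close>, with \<open>D\<close> a product of carriers. No coefficients
  occur, since a scalar can be absorbed into one factor of a tensor.\<close>

definition finite_sums :: "(complex, 'a, 'm) module_scheme \<Rightarrow> 'i set \<Rightarrow> ('i \<Rightarrow> 'a) \<Rightarrow> 'a set" where
  "finite_sums V D e = {\<Oplus>\<^bsub>V\<^esub>i\<in>{..<n}. e (p i) |n p. \<forall>i<(n::nat). p i \<in> D}"

lemma finite_sums_Times:
  "finite_sums V (X \<times> Y) (\<lambda>(x, y). f x y) =
     {\<Oplus>\<^bsub>V\<^esub>i\<in>{..<n}. f (x i) (y i) |n x y. \<forall>i<(n::nat). x i \<in> X \<and> y i \<in> Y}" (is "?A = ?B")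
proof (intro equalityI subsetI)
  fix v assume "v \<in> ?A"
  then obtain n p where "\<forall>i<(n::nat). p i \<in> X \<times> Y" "v = (\<Oplus>\<^bsub>V\<^esub>i\<in>{..<n}. (\<lambda>(x, y). f x y) (p i))"
    unfolding finite_sums_def by blast
  then show "v \<in> ?B"
    by (intro CollectI exI[of _ n] exI[of _ "fst \<circ> p"] exI[of _ "snd \<circ> p"]) (auto simp: case_prod_beta mem_Times_iff)
next
  fix v assume "v \<in> ?B"
  then obtain n x y where "\<forall>i<(n::nat). x i \<in> X \<and> y i \<in> Y" "v = (\<Oplus>\<^bsub>V\<^esub>i\<in>{..<n}. f (x i) (y i))"
    by blast
  then show "v \<in> ?A"
    unfolding finite_sums_def by (intro CollectI exI[of _ n] exI[of _ "\<lambda>i. (x i, y i)"]) auto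
qed

text \<open>For maps out of a tensor product this reduces equality to elementary tensors.\<close>

lemma linear_bounded_agree_total:
  assumes V: "normed_module V N" and W: "normed_module W M"
    and f: "linear_on V W f" "\<And>x. x \<in> carrier V \<Longrightarrow> M (f x) \<le> C * N x"
    and g: "linear_on V W g" "\<And>x. x \<in> carrier V \<Longrightarrow> M (g x) \<le> C' * N x"
    and S: "normed_module.dense V N (finite_sums V D e)"
    and e: "\<And>i. i \<in> D \<Longrightarrow> e i \<in> carrier V" and eq: "\<And>i. i \<in> D \<Longrightarrow> f (e i) = g (e i)"
    and x: "x \<in> carrier V"
  shows "f x = g x"
proof (rule linear_bounded_agree[OF V W f g S _ x])
  fix y assume "y \<in> finite_sums V D e"
  then obtain n p where p: "\<forall>i<(n::nat). p i \<in> D" and y: "y = (\<Oplus>\<^bsub>V\<^esub>i\<in>{..<n}. e (p i))"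
    unfolding finite_sums_def by blast
  interpret W: normed_module W M by fact
  have "f y = (\<Oplus>\<^bsub>W\<^esub>i\<in>{..<n}. f (e (p i)))"
    unfolding y using p e V W by (intro linear_on_finsum[OF f(1)] complex_moduleI) auto
  also have "\<dots> = (\<Oplus>\<^bsub>W\<^esub>i\<in>{..<n}. g (e (p i)))"
    using p eq e linear_onD(1)[OF g(1)] by (intro W.finsum_cong') auto
  also have "\<dots> = g y"
    unfolding y using p e V W by (intro linear_on_finsum[OF g(1), symmetric] complex_moduleI) auto
  finally show "f y = g y" .
qed

lemma functional_bounded_agree_total:
  assumes V: "normed_module V N"
    and f: "linear_functional V f" "\<And>x. x \<in> carrier V \<Longrightarrow> cmod (f x) \<le> C * N x"
    and g: "linear_functional V g" "\<And>x. x \<in> carrier V \<Longrightarrow> cmod (g x) \<le> C' * N x"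
    and S: "normed_module.dense V N (finite_sums V D e)"
    and e: "\<And>i. i \<in> D \<Longrightarrow> e i \<in> carrier V" and eq: "\<And>i. i \<in> D \<Longrightarrow> f (e i) = g (e i)"
    and x: "x \<in> carrier V"
  shows "f x = g x"
proof (rule functional_bounded_agree[OF V f g S _ x])
  fix y assume "y \<in> finite_sums V D e"
  then obtain n p where p: "\<forall>i<(n::nat). p i \<in> D" and y: "y = (\<Oplus>\<^bsub>V\<^esub>i\<in>{..<n}. e (p i))"
    unfolding finite_sums_def by blast
  have "f y = (\<Sum>i<n. f (e (p i)))" "g y = (\<Sum>i<n. g (e (p i)))"
    unfolding y using p e V
    by (auto intro!: functional_finsum[OF f(1)] functional_finsum[OF g(1)] complex_moduleI)
  moreover have "(\<Sum>i<n. f (e (p i))) = (\<Sum>i<n. g (e (p i)))"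
    using p eq by (intro sum.cong) auto
  ultimately show "f y = g y" by simp
qed

text \<open>By \<open>smult\<close>, multiplying a sum by a scalar amounts to changing its indices
  within \<open>D\<close>. The bound, applied to differences of sums, shows that equal sums have
  equal images, whatever linear relations hold in the family \<open>e\<close>.\<close>

lemma linear_bounded_extension_total:
  assumes V: "normed_module V N" and W: "normed_module W M"
    and complete: "Metric_space.mcomplete (carrier W) (normed_module.ndist W M)"
    and e: "\<And>i. i \<in> D \<Longrightarrow> e i \<in> carrier V" and e': "\<And>i. i \<in> D \<Longrightarrow> e' i \<in> carrier W"
    and smult: "\<And>c i. i \<in> D \<Longrightarrow> \<exists>j\<in>D. e j = c \<odot>\<^bsub>V\<^esub> e i \<and> e' j = c \<odot>\<^bsub>W\<^esub> e' i"
    and S: "normed_module.dense V N (finite_sums V D e)"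
    and bound: "\<And>n p. \<forall>i<(n::nat). p i \<in> D \<Longrightarrow>
      M (\<Oplus>\<^bsub>W\<^esub>i\<in>{..<n}. e' (p i)) \<le> C * N (\<Oplus>\<^bsub>V\<^esub>i\<in>{..<n}. e (p i))" and C: "0 \<le> C"
  obtains f where "linear_on V W f" "\<And>v. v \<in> carrier V \<Longrightarrow> M (f v) \<le> C * N v" "\<And>i. i \<in> D \<Longrightarrow> f (e i) = e' i"
proof -
  interpret V: normed_module V N by fact
  interpret W: normed_module W M by fact
  define R where "R v w \<longleftrightarrow> (\<exists>n p. (\<forall>i<(n::nat). p i \<in> D) \<and>
    v = (\<Oplus>\<^bsub>V\<^esub>i\<in>{..<n}. e (p i)) \<and> w = (\<Oplus>\<^bsub>W\<^esub>i\<in>{..<n}. e' (p i)))" for v w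
  show thesis
  proof (rule linear_bounded_extension[OF V W complete, of R C])
    show "v \<in> carrier V \<and> w \<in> carrier W" if "R v w" for v w
      using that e e' unfolding R_def by (auto intro!: V.finsum_closed W.finsum_closed)
    show "R (v \<oplus>\<^bsub>V\<^esub> v') (w \<oplus>\<^bsub>W\<^esub> w')" if R: "R v w" "R v' w'" for v w v' w'
    proof -
      obtain n p where p: "\<forall>i<(n::nat). p i \<in> D" "v = (\<Oplus>\<^bsub>V\<^esub>i\<in>{..<n}. e (p i))" "w = (\<Oplus>\<^bsub>W\<^esub>i\<in>{..<n}. e' (p i))"
        using R(1) unfolding R_def by blast
      obtain m q where q: "\<forall>i<(m::nat). q i \<in> D" "v' = (\<Oplus>\<^bsub>V\<^esub>i\<in>{..<m}. e (q i))" "w' = (\<Oplus>\<^bsub>W\<^esub>i\<in>{..<m}. e' (q i))"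
        using R(2) unfolding R_def by blast
      let ?r = "\<lambda>i. if i < n then p i else q (i - n)"
      have "(\<Oplus>\<^bsub>V\<^esub>i\<in>{..<n + m}. e (?r i)) = v \<oplus>\<^bsub>V\<^esub> v'"
        using V.finsum_append[of n "\<lambda>i. e (p i)" m "\<lambda>i. e (q i)"] p q e by (simp add: if_distrib)
      moreover have "(\<Oplus>\<^bsub>W\<^esub>i\<in>{..<n + m}. e' (?r i)) = w \<oplus>\<^bsub>W\<^esub> w'"
        using W.finsum_append[of n "\<lambda>i. e' (p i)" m "\<lambda>i. e' (q i)"] p q e' by (simp add: if_distrib)
      moreover have "\<forall>i<n + m. ?r i \<in> D" using p q by auto
      ultimately show ?thesis unfolding R_def by (intro exI[of _ "n + m"] exI[of _ ?r]) simp
    qed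
    show "R (c \<odot>\<^bsub>V\<^esub> v) (c \<odot>\<^bsub>W\<^esub> w)" if R: "R v w" for c v w
    proof -
      obtain n p where p: "\<forall>i<(n::nat). p i \<in> D" "v = (\<Oplus>\<^bsub>V\<^esub>i\<in>{..<n}. e (p i))" "w = (\<Oplus>\<^bsub>W\<^esub>i\<in>{..<n}. e' (p i))"
        using R unfolding R_def by blast
      have "\<forall>i. \<exists>j. i < n \<longrightarrow> j \<in> D \<and> e j = c \<odot>\<^bsub>V\<^esub> e (p i) \<and> e' j = c \<odot>\<^bsub>W\<^esub> e' (p i)"
        using p(1) smult by blast
      then obtain q where q: "\<And>i. i < n \<Longrightarrow> q i \<in> D \<and> e (q i) = c \<odot>\<^bsub>V\<^esub> e (p i) \<and> e' (q i) = c \<odot>\<^bsub>W\<^esub> e' (p i)"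
        by metis
      have "c \<odot>\<^bsub>V\<^esub> v = (\<Oplus>\<^bsub>V\<^esub>i\<in>{..<n}. c \<odot>\<^bsub>V\<^esub> e (p i))"
        unfolding p using p(1) e by (intro V.finsum_smult_ldistr) auto
      also have "\<dots> = (\<Oplus>\<^bsub>V\<^esub>i\<in>{..<n}. e (q i))"
        using q e by (intro V.finsum_cong') auto
      finally have 1: "c \<odot>\<^bsub>V\<^esub> v = (\<Oplus>\<^bsub>V\<^esub>i\<in>{..<n}. e (q i))" .
      have "c \<odot>\<^bsub>W\<^esub> w = (\<Oplus>\<^bsub>W\<^esub>i\<in>{..<n}. c \<odot>\<^bsub>W\<^esub> e' (p i))"
        unfolding p using p(1) e' by (intro W.finsum_smult_ldistr) auto
      also have "\<dots> = (\<Oplus>\<^bsub>W\<^esub>i\<in>{..<n}. e' (q i))"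
        using q e' by (intro W.finsum_cong') auto
      finally show ?thesis unfolding R_def using 1 q by (intro exI[of _ n] exI[of _ q]) simp
    qed
    have "finite_sums V D e \<subseteq> {v. \<exists>w. R v w}"
    proof
      fix v assume "v \<in> finite_sums V D e"
      then obtain n p where "\<forall>i<(n::nat). p i \<in> D" "v = (\<Oplus>\<^bsub>V\<^esub>i\<in>{..<n}. e (p i))"
        unfolding finite_sums_def by blast
      then have "R v (\<Oplus>\<^bsub>W\<^esub>i\<in>{..<n}. e' (p i))" unfolding R_def by (intro exI[of _ n] exI[of _ p]) simp
      then show "v \<in> {v. \<exists>w. R v w}" by blast
    qed
    then show "V.dense {v. \<exists>w. R v w}" using S unfolding V.dense_def by (meson subsetD)
    show "M w \<le> C * N v" if "R v w" for v w using that bound unfolding R_def by clarsimp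
    fix f assume f: "linear_on V W f" "\<And>v. v \<in> carrier V \<Longrightarrow> M (f v) \<le> C * N v" "\<And>v w. R v w \<Longrightarrow> f v = w"
    \<comment> \<open>A member of the family is a sum of length 1.\<close>
    have "R (e i) (e' i)" if "i \<in> D" for i
      unfolding R_def using that e e'
      by (intro exI[of _ 1] exI[of _ "\<lambda>_. i"]) (simp add: V.finsum_lessThan_Suc W.finsum_lessThan_Suc)
    with f show thesis by (intro that) auto
  qed (rule C)
qed


section \<open>Hilbert spaces and $C^*$-algebras\<close>

context hilbert_space
begin

sublocale complex_module H
  by unfold_locales

lemma iprod_add_right:
  "\<lbrakk>x \<in> carrier H; y \<in> carrier H; z \<in> carrier H\<rbrakk> \<Longrightarrow> iprod H x (y \<oplus> z) = iprod H x y + iprod H x z"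
  using iprod_add[of y z x] iprod_cnj[of x "y \<oplus> z"] iprod_cnj[of x y] iprod_cnj[of x z] by simp

lemma iprod_smult_right:
  "\<lbrakk>x \<in> carrier H; y \<in> carrier H\<rbrakk> \<Longrightarrow> iprod H x (c \<odot> y) = cnj c * iprod H x y"
  using iprod_smult[of y x c] iprod_cnj[of x "c \<odot> y"] iprod_cnj[of x y] by simp

lemma linear_functional_iprod_left: "y \<in> carrier H \<Longrightarrow> linear_functional H (\<lambda>x. iprod H x y)"
  by (simp add: linear_functional_def iprod_add iprod_smult)

text \<open>Conjugation makes the second slot linear, so the density arguments for functionals cover
  both slots.\<close>

lemma linear_functional_iprod_right: "x \<in> carrier H \<Longrightarrow> linear_functional H (\<lambda>y. cnj (iprod H x y))"
  by (simp add: linear_functional_def iprod_add_right iprod_smult_right)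

lemma hnorm_nonneg: "x \<in> carrier H \<Longrightarrow> 0 \<le> hnorm H x"
  using iprod_nonneg[of x] by (auto simp: hnorm_def complex_nonneg_Reals_iff)

lemma iprod_self: "x \<in> carrier H \<Longrightarrow> iprod H x x = complex_of_real ((hnorm H x)\<^sup>2)"
  using iprod_nonneg[of x] by (auto simp: hnorm_def complex_nonneg_Reals_iff complex_eq_iff)

lemma iprod_zero [simp]: "x \<in> carrier H \<Longrightarrow> iprod H \<zero> x = 0" "x \<in> carrier H \<Longrightarrow> iprod H x \<zero> = 0"
  using iprod_smult[of \<zero> x 0] iprod_smult_right[of x \<zero> 0] by simp_all

lemma iprod_diff:
  assumes "x \<in> carrier H" "y \<in> carrier H" "z \<in> carrier H"
  shows "iprod H (x \<ominus> y) z = iprod H x z - iprod H y z" "iprod H z (x \<ominus> y) = iprod H z x - iprod H z y"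
  using assms by (simp_all add: diff_eq_smult iprod_add iprod_smult iprod_add_right iprod_smult_right)

text \<open>This expansion underlies the Cauchy-Schwarz and triangle inequalities, polarization and
  the GNS estimate.\<close>

lemma hnorm_diff_square:
  assumes "x \<in> carrier H" "y \<in> carrier H"
  shows "(hnorm H (x \<ominus> y))\<^sup>2 = (hnorm H x)\<^sup>2 - 2 * Re (iprod H x y) + (hnorm H y)\<^sup>2"
proof -
  have "complex_of_real ((hnorm H (x \<ominus> y))\<^sup>2) =
      iprod H x x - iprod H x y - iprod H y x + iprod H y y"
    using assms by (simp add: iprod_self[symmetric] iprod_diff del: of_real_power)
  then have "(hnorm H (x \<ominus> y))\<^sup>2 = Re (iprod H x x - iprod H x y - cnj (iprod H x y) + iprod H y y)"
    using assms iprod_cnj[of y x] by (metis Re_complex_of_real)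
  then show ?thesis using assms by (simp add: iprod_self)
qed

lemma hnorm_smult: "x \<in> carrier H \<Longrightarrow> hnorm H (c \<odot> x) = cmod c * hnorm H x"
proof -
  assume x: "x \<in> carrier H"
  have "complex_of_real ((hnorm H (c \<odot> x))\<^sup>2) = c * cnj c * iprod H x x"
    using x by (simp add: iprod_self[symmetric] iprod_smult iprod_smult_right del: of_real_power)
  also have "\<dots> = complex_of_real ((cmod c * hnorm H x)\<^sup>2)"
    using x by (simp add: iprod_self complex_norm_square[symmetric] power_mult_distrib)
  finally have "(hnorm H (c \<odot> x))\<^sup>2 = (cmod c * hnorm H x)\<^sup>2" by (simp only: of_real_eq_iff)
  then show ?thesis using x by (simp add: hnorm_nonneg power2_eq_iff_nonneg)
qed

lemma hnorm_eq_0: "x \<in> carrier H \<Longrightarrow> hnorm H x = 0 \<longleftrightarrow> x = \<zero>"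
  using iprod_eq_0[of x] iprod_self[of x] by auto

lemma Cauchy_Schwarz:
  assumes "x \<in> carrier H" "y \<in> carrier H"
  shows "cmod (iprod H x y) \<le> hnorm H x * hnorm H y"
proof (cases "hnorm H y = 0")
  case True
  then show ?thesis using assms by (simp add: hnorm_eq_0 hnorm_nonneg)
next
  case False
  \<comment> \<open>\<open>c \<odot> y\<close> is the orthogonal projection of \<open>x\<close> onto
    the line spanned by \<open>y\<close>.\<close>
  define c where "c = iprod H x y / complex_of_real ((hnorm H y)\<^sup>2)"
  have "(hnorm H (x \<ominus> c \<odot> y))\<^sup>2 = (hnorm H x)\<^sup>2 - 2 * Re (cnj c * iprod H x y) + (cmod c * hnorm H y)\<^sup>2"
    using assms by (simp add: hnorm_diff_square hnorm_smult iprod_smult_right)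
  also have "cnj c * iprod H x y = complex_of_real ((cmod (iprod H x y))\<^sup>2 / (hnorm H y)\<^sup>2)"
    by (simp add: c_def complex_norm_square mult.commute del: of_real_power)
  also have "(cmod c * hnorm H y)\<^sup>2 = (cmod (iprod H x y))\<^sup>2 / (hnorm H y)\<^sup>2"
    using False by (simp add: c_def norm_divide norm_mult power2_eq_square)
  finally have "0 \<le> (hnorm H x)\<^sup>2 - (cmod (iprod H x y))\<^sup>2 / (hnorm H y)\<^sup>2"
    using zero_le_power2[of "hnorm H (x \<ominus> c \<odot> y)"] by simp
  then have "(cmod (iprod H x y))\<^sup>2 \<le> (hnorm H x * hnorm H y)\<^sup>2"
    using False by (simp add: field_simps power_mult_distrib)
  then show ?thesis by (rule power2_le_imp_le) (intro mult_nonneg_nonneg hnorm_nonneg assms)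
qed

sublocale normed_module H "hnorm H"
proof
  fix x y assume xy: "x \<in> carrier H" "y \<in> carrier H"
  \<comment> \<open>The sum is written as a difference to reuse
    \<open>hnorm_diff_square\<close>.\<close>
  have "(hnorm H (x \<oplus> y))\<^sup>2 = (hnorm H (x \<ominus> (-1) \<odot> y))\<^sup>2"
    using xy by (simp add: diff_eq_smult)
  also have "\<dots> = (hnorm H x)\<^sup>2 + 2 * Re (iprod H x y) + (hnorm H y)\<^sup>2"
    using xy by (simp only: smult_closed' hnorm_diff_square hnorm_smult iprod_smult_right) simp
  also have "\<dots> \<le> (hnorm H x)\<^sup>2 + 2 * (hnorm H x * hnorm H y) + (hnorm H y)\<^sup>2"
    using Cauchy_Schwarz[OF xy] complex_Re_le_cmod[of "iprod H x y"] by simp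
  also have "\<dots> = (hnorm H x + hnorm H y)\<^sup>2" by (simp add: power2_sum)
  finally show "hnorm H (x \<oplus> y) \<le> hnorm H x + hnorm H y"
    by (rule power2_le_imp_le) (intro add_nonneg_nonneg hnorm_nonneg xy)
qed (simp_all add: hnorm_nonneg hnorm_eq_0 hnorm_smult)

lemma ndist_eq_hdist: "ndist = hdist H"
  by (intro ext) (simp add: ndist_def hdist_def)

lemma hdense_iff: "hdense H S \<longleftrightarrow> dense S"
  by (simp add: hdense_def dense_iff_closure_of ndist_eq_hdist)

lemma complete: "Metric.mcomplete"
  using hnorm_complete by (simp add: ndist_eq_hdist)

lemma normed_module: "normed_module H (hnorm H)"
  by (rule normed_module_axioms)

text \<open>By density the orthogonality reaches \<open>x\<close> itself, so
  \<open>iprod H x x\<close> vanishes.\<close>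

lemma orthogonal_dense_imp_zero:
  assumes S: "dense S" and x: "x \<in> carrier H" and orth: "\<And>y. \<lbrakk>y \<in> S; y \<in> carrier H\<rbrakk> \<Longrightarrow> iprod H x y = 0"
  shows "x = \<zero>"
proof -
  have "cnj (iprod H x x) = 0"
  proof (rule functional_bounded_agree[OF normed_module linear_functional_iprod_right[OF x] _ _ _ S _ x])
    show "cmod (cnj (iprod H x y)) \<le> hnorm H x * hnorm H y" if "y \<in> carrier H" for y
      using Cauchy_Schwarz[OF x that] by simp
    show "linear_functional H (\<lambda>_. 0)" by (simp add: linear_functional_def)
    show "cmod 0 \<le> 0 * hnorm H y" if "y \<in> carrier H" for y by simp
  qed (use orth in auto)
  then show ?thesis using x iprod_eq_0 by simp
qed

lemma iprod_finsum_finsum: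
  assumes "\<And>i. i < n \<Longrightarrow> u i \<in> carrier H" "\<And>i. i < m \<Longrightarrow> v i \<in> carrier H"
  shows "iprod H (\<Oplus>i\<in>{..<n::nat}. u i) (\<Oplus>j\<in>{..<m::nat}. v j) = (\<Sum>i<n. \<Sum>j<m. iprod H (u i) (v j))"
proof -
  let ?v = "\<Oplus>j\<in>{..<m::nat}. v j"
  have v: "?v \<in> carrier H" using assms(2) by (auto intro!: M.finsum_closed)
  have "iprod H (\<Oplus>i\<in>{..<n}. u i) ?v = (\<Sum>i<n. iprod H (u i) ?v)"
    by (intro functional_finsum linear_functional_iprod_left v assms complex_module_axioms)
  also have "\<dots> = (\<Sum>i<n. \<Sum>j<m. iprod H (u i) (v j))"
  proof (rule sum.cong)
    fix i assume "i \<in> {..<n}"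
    then have "cnj (iprod H (u i) ?v) = (\<Sum>j<m. cnj (iprod H (u i) (v j)))"
      using assms by (intro functional_finsum linear_functional_iprod_right complex_module_axioms) auto
    then show "iprod H (u i) ?v = (\<Sum>j<m. iprod H (u i) (v j))"
      by (metis (no_types, lifting) cnj_sum complex_cnj_cnj sum.cong)
  qed simp
  finally show ?thesis .
qed

end

text \<open>Polarization: the norms of x, y and x - y determine the real part of the inner
  product.\<close>

lemma isometry_iprod:
  assumes H: "hilbert_space H" and K: "hilbert_space K" and X: "isometry_op H K X"
    and x: "x \<in> carrier H" and y: "y \<in> carrier H"
  shows "iprod K (X x) (X y) = iprod H x y"
proof -
  interpret H: hilbert_space H by fact
  interpret K: hilbert_space K by fact
  have lin: "linear_on H K X" and iso: "\<And>x. x \<in> carrier H \<Longrightarrow> hnorm K (X x) = hnorm H x"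
    using X by (auto simp: isometry_op_def)
  have Re: "Re (iprod K (X u) (X v)) = Re (iprod H u v)" if "u \<in> carrier H" "v \<in> carrier H" for u v
    using H.hnorm_diff_square[OF that] K.hnorm_diff_square[of "X u" "X v"] that iso[of "u \<ominus>\<^bsub>H\<^esub> v"]
    by (simp add: iso linear_onD(1)[OF lin] linear_on_diff[OF lin H.complex_module_axioms K.complex_module_axioms])
  \<comment> \<open>As \<open>iprod\<close> is conjugate-linear in the second slot, its real part at
    (x, i y) is its imaginary part at (x, y).\<close>
  have "Im (iprod K (X x) (X y)) = Im (iprod H x y)"
    using Re[of x "\<i> \<odot>\<^bsub>H\<^esub> y"] x y
    by (simp add: linear_onD[OF lin] H.iprod_smult_right K.iprod_smult_right)
  then show ?thesis using Re[OF x y] by (simp add: complex_eq_iff)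
qed

section \<open>C*-algebras and automatic boundedness\<close>

context cstar_algebra
begin

sublocale normed_module A "cnorm A"
  by unfold_locales (simp_all add: cnorm_nonneg cnorm_eq_0 cnorm_smult cnorm_triangle)

lemma ndist_eq_cdist: "ndist = cdist A"
  by (intro ext) (simp add: ndist_def cdist_def)

lemma cdense_iff: "cdense A S \<longleftrightarrow> dense S"
  by (simp add: cdense_def dense_iff_closure_of ndist_eq_cdist)

lemma complete: "Metric.mcomplete"
  using cnorm_complete by (simp add: ndist_eq_cdist)

lemma normed_module: "normed_module A (cnorm A)"
  by (rule normed_module_axioms)

lemmas alg_closed [simp, intro] = mult_closed star_closed

lemma mult_diff:
  assumes "x \<in> carrier A" "y \<in> carrier A" "z \<in> carrier A"
  shows "z \<otimes> (x \<ominus> y) = z \<otimes> x \<ominus> z \<otimes> y" "(x \<ominus> y) \<otimes> z = x \<otimes> z \<ominus> y \<otimes> z"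
  using assms by (simp_all add: diff_eq_smult mult_r_distr mult_l_distr smult_mult_l smult_mult_r)

text \<open>The C*-identity and submultiplicativity give ||x||^2 \<le> ||x*|| ||x||. Cancelling
  ||x|| gives one inequality, and replacing x by x* the other.\<close>

lemma cnorm_star: "x \<in> carrier A \<Longrightarrow> cnorm A (star A x) = cnorm A x"
proof -
  have le: "cnorm A x \<le> cnorm A (star A x)" if x: "x \<in> carrier A" for x
  proof (cases "cnorm A x = 0")
    case True
    then show ?thesis using x cnorm_nonneg by simp
  next
    case False
    then have "0 < cnorm A x" using cnorm_nonneg[OF x] by simp
    moreover have "cnorm A x * cnorm A x \<le> cnorm A (star A x) * cnorm A x"
      using cnorm_cstar[OF x] cnorm_mult[of "star A x" x] x by (simp add: power2_eq_square)
    ultimately show ?thesis by simp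
  qed
  show ?thesis if "x \<in> carrier A" using le[OF that] le[of "star A x"] that by (simp add: star_star)
qed

lemma star_diff: "\<lbrakk>x \<in> carrier A; y \<in> carrier A\<rbrakk> \<Longrightarrow> star A (x \<ominus> y) = star A x \<ominus> star A y"
  by (simp add: diff_eq_smult star_add star_smult)

text \<open>
  The element \<open>b\<close> stands for \<open>1 - sqrt (1 - x\<^sup>* x)\<close>; it is the fixed point of the contraction
  \<open>b \<mapsto> (x\<^sup>* x + b\<^sup>2) / 2\<close> of the ball of radius \<open>1 - sqrt (1 - \<parallel>x\<parallel>\<^sup>2)\<close>.
\<close>

lemma exists_one_minus_sqrt:
  assumes x: "x \<in> carrier A" and less1: "cnorm A x < 1"
  obtains b where "b \<in> carrier A" "star A b = b" "star A x \<otimes> x \<oplus> b \<otimes> b = 2 \<odot> b"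
proof -
  define w where "w = star A x \<otimes> x"
  define q where "q = (cnorm A x)\<^sup>2"
  define \<beta> where "\<beta> = 1 - sqrt (1 - q)"
  define S where "S u = (1/2) \<odot> (w \<oplus> u \<otimes> u)" for u
  define b where "b n = (S ^^ n) \<zero>" for n
  have q: "0 \<le> q" "q < 1" using less1 cnorm_nonneg[OF x] by (auto simp: q_def power_less_one_iff abs_square_less_1)
  have \<beta>: "0 \<le> \<beta>" "\<beta> < 1" using q by (auto simp: \<beta>_def)
  \<comment> \<open>\<open>\<beta>\<close> is a fixed point of t \<mapsto> (q + t^2) / 2, which is
    the recursion for the norms; so \<open>S\<close> maps the ball of radius \<open>\<beta>\<close>
    into itself.\<close>
  have \<beta>_eq: "(q + \<beta>\<^sup>2) / 2 = \<beta>"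
    using q by (simp add: \<beta>_def power2_diff)
  have w: "w \<in> carrier A" "star A w = w" "cnorm A w = q"
    using x by (auto simp: w_def star_mult star_star cnorm_cstar q_def)
  have S: "S u \<in> carrier A" if "u \<in> carrier A" for u
    using that w by (simp add: S_def)
  have S_star: "star A (S u) = S u" if "u \<in> carrier A" "star A u = u" for u
    using that w by (simp add: S_def star_smult star_add star_mult)
  have S_norm: "cnorm A (S u) \<le> \<beta>" if u: "u \<in> carrier A" "cnorm A u \<le> \<beta>" for u
  proof -
    have "cnorm A (w \<oplus> u \<otimes> u) \<le> q + cnorm A u * cnorm A u"
      using cnorm_triangle[of w "u \<otimes> u"] cnorm_mult[of u u] u w by simp
    also have "\<dots> \<le> q + \<beta>\<^sup>2"
      using u(2) cnorm_nonneg[OF u(1)] by (simp add: power2_eq_square mult_mono)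
    finally show ?thesis using u w \<beta>_eq by (simp add: S_def cnorm_smult)
  qed
  have S_diff: "cnorm A (S u \<ominus> S v) \<le> \<beta> * cnorm A (u \<ominus> v)"
    if u: "u \<in> carrier A" "cnorm A u \<le> \<beta>" and v: "v \<in> carrier A" "cnorm A v \<le> \<beta>" for u v
  proof -
    have "S u \<ominus> S v = (1/2) \<odot> ((w \<oplus> u \<otimes> u) \<ominus> (w \<oplus> v \<otimes> v))"
      using u v w by (simp add: S_def smult_diff)
    also have "(w \<oplus> u \<otimes> u) \<ominus> (w \<oplus> v \<otimes> v) = u \<otimes> u \<ominus> v \<otimes> v"
      using u v w diff_eq_zero_iff[of w w] by (simp add: add_diff_add)
    \<comment> \<open>\<open>u\<close> and \<open>v\<close> need not commute, hence this form of the
      difference of two squares.\<close>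
    also have "\<dots> = u \<otimes> (u \<ominus> v) \<oplus> (u \<ominus> v) \<otimes> v"
      using u v by (simp add: mult_diff diff_add_diff)
    finally have "cnorm A (S u \<ominus> S v) = cnorm A (u \<otimes> (u \<ominus> v) \<oplus> (u \<ominus> v) \<otimes> v) / 2"
      using u v by (simp add: cnorm_smult)
    also have "cnorm A (u \<otimes> (u \<ominus> v) \<oplus> (u \<ominus> v) \<otimes> v)
        \<le> cnorm A u * cnorm A (u \<ominus> v) + cnorm A (u \<ominus> v) * cnorm A v"
      using cnorm_triangle[of "u \<otimes> (u \<ominus> v)" "(u \<ominus> v) \<otimes> v"] cnorm_mult[of u "u \<ominus> v"] cnorm_mult[of "u \<ominus> v" v] u v
      by simp
    also have "\<dots> \<le> \<beta> * cnorm A (u \<ominus> v) + cnorm A (u \<ominus> v) * \<beta>"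
      using u v by (intro add_mono mult_mono) (auto simp: cnorm_nonneg \<beta>)
    finally show ?thesis by simp
  qed
  have b: "b n \<in> carrier A \<and> star A (b n) = b n \<and> cnorm A (b n) \<le> \<beta>" for n
  proof (induction n)
    case 0
    have "star A \<zero> = \<zero>" using star_smult[of \<zero> 0] by simp
    then show ?case using \<beta> cnorm_eq_0[of \<zero>] by (simp add: b_def)
  next
    case (Suc n)
    then show ?case using S S_star S_norm by (simp add: b_def)
  qed
  \<comment> \<open>The induction starts from ||b k|| \<le> \<beta> \<le> 1, and every application
    of \<open>S\<close> contributes a factor \<open>\<beta>\<close>.\<close>
  have cauchy: "cnorm A (b (n + k) \<ominus> b n) \<le> \<beta> ^ n" for n k
  proof (induction n)
    case 0
    have "b 0 = \<zero>" by (simp add: b_def)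
    then have "b (0 + k) \<ominus> b 0 = b k" using b[of k] by (simp add: diff_eq_smult)
    then show ?case using b[of k] \<beta> by simp
  next
    case (Suc n)
    have "cnorm A (b (Suc n + k) \<ominus> b (Suc n)) \<le> \<beta> * cnorm A (b (n + k) \<ominus> b n)"
      using S_diff[of "b (n + k)" "b n"] b by (simp add: b_def)
    also have "\<dots> \<le> \<beta> * \<beta> ^ n" using Suc \<beta> by (intro mult_left_mono) auto
    finally show ?case by simp
  qed
  have pow: "(\<lambda>n. \<beta> ^ n) \<longlonglongrightarrow> 0" using \<beta> by (intro LIMSEQ_power_zero) simp
  obtain l where l: "l \<in> carrier A" "(\<lambda>n. cnorm A (b n \<ominus> l)) \<longlonglongrightarrow> 0"
  proof (rule complete_imp_limit[OF complete])
    show "b n \<in> carrier A" for n using b by simp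
    fix e :: real assume "e > 0"
    then obtain k where k: "\<And>n. n \<ge> k \<Longrightarrow> \<bar>\<beta> ^ n\<bar> < e"
      using LIMSEQ_D[OF pow] by auto
    have "cnorm A (b m \<ominus> b n) < e" if "m \<ge> k" "n \<ge> k" for m n
    proof (cases "n \<le> m")
      case True
      then show ?thesis using cauchy[of n "m - n"] k[of n] that by simp
    next
      case False
      then show ?thesis using cauchy[of m "n - m"] k[of m] that b N_diff_commute[of "b m" "b n"] by simp
    qed
    then show "\<exists>k. \<forall>m\<ge>k. \<forall>n\<ge>k. cnorm A (b m \<ominus> b n) < e" by blast
  qed
  \<comment> \<open>Self-adjointness of the limit and the fixed-point equation are both obtained by
    bounding a distance by a null sequence.\<close>
  have zeroI: "u = v" if u: "u \<in> carrier A" and v: "v \<in> carrier A"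
    and le: "\<And>n. cnorm A (u \<ominus> v) \<le> t n" and t: "t \<longlonglongrightarrow> 0" for u v and t :: "nat \<Rightarrow> real"
  proof -
    have "cnorm A (u \<ominus> v) \<le> 0" using le by (intro LIMSEQ_le_const[OF t]) auto
    then show ?thesis using u v cnorm_nonneg[of "u \<ominus> v"] by (simp add: cnorm_eq_0 diff_eq_zero_iff)
  qed
  have l_norm: "cnorm A l \<le> \<beta>"
  proof (rule LIMSEQ_le_const[OF tendsto_add[OF l(2) tendsto_const, of \<beta>, simplified]])
    show "\<exists>N. \<forall>n\<ge>N. cnorm A l \<le> cnorm A (b n \<ominus> l) + \<beta>"
    proof (intro exI allI impI)
      show "cnorm A l \<le> cnorm A (b n \<ominus> l) + \<beta>" for n
        using N_diff_le[OF l(1), of "b n"] b[of n] N_diff_commute[OF l(1), of "b n"] by simp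
    qed
  qed
  have l_star: "star A l = l"
  proof (rule zeroI)
    show "cnorm A (star A l \<ominus> l) \<le> cnorm A (b n \<ominus> l) + cnorm A (b n \<ominus> l)" for n
    proof -
      have "star A l \<ominus> b n = star A (l \<ominus> b n)" using l b by (simp add: star_diff)
      then have "cnorm A (star A l \<ominus> b n) = cnorm A (b n \<ominus> l)"
        using l b by (simp add: cnorm_star N_diff_commute)
      then show ?thesis using N_diff_triangle[of "star A l" "b n" l] l b by simp
    qed
    show "(\<lambda>n. cnorm A (b n \<ominus> l) + cnorm A (b n \<ominus> l)) \<longlonglongrightarrow> 0" using tendsto_add[OF l(2) l(2)] by simp
  qed (use l in auto)
  have "S l = l"
  proof (rule zeroI)
    show "cnorm A (S l \<ominus> l) \<le> \<beta> * cnorm A (b n \<ominus> l) + cnorm A (b (Suc n) \<ominus> l)" for n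
    proof -
      have "cnorm A (S l \<ominus> b (Suc n)) \<le> \<beta> * cnorm A (b n \<ominus> l)"
        using S_diff[of l "b n"] l l_norm b N_diff_commute[of l "b n"] by (simp add: b_def)
      then show ?thesis using N_diff_triangle[of "S l" "b (Suc n)" l] l b S by (smt (verit))
    qed
    show "(\<lambda>n. \<beta> * cnorm A (b n \<ominus> l) + cnorm A (b (Suc n) \<ominus> l)) \<longlonglongrightarrow> 0"
      using tendsto_add[OF tendsto_mult_left[OF l(2), of \<beta>] LIMSEQ_Suc[OF l(2)]] by simp
  qed (use l S in auto)
  then have "2 \<odot> l = 2 \<odot> S l" by simp
  then have "w \<oplus> l \<otimes> l = 2 \<odot> l" using l w by (simp add: S_def)
  then show thesis using that[OF l(1) l_star] by (simp add: w_def)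
qed

end

text \<open>For ||x|| < 1 take \<open>b\<close> from \<open>exists_one_minus_sqrt\<close>. The GNS
  identity turns x* x + b b = 2 b into ||f b - h||^2 = ||h||^2 - ||f x||^2, and the left-hand side
  is nonnegative. The general \<open>f\<close> and \<open>h\<close> allow uses beyond the GNS map of
  \<open>A\<close> itself.\<close>

lemma gns_contractive:
  assumes A: "cstar_algebra A" and H: "hilbert_space H" and f: "linear_on A H f" and h: "h \<in> carrier H"
    and gns: "\<And>a b. \<lbrakk>a \<in> carrier A; b \<in> carrier A\<rbrakk> \<Longrightarrow> iprod H (f a) (f b) = iprod H (f (star A b \<otimes>\<^bsub>A\<^esub> a)) h"
    and x: "x \<in> carrier A"
  shows "hnorm H (f x) \<le> cnorm A x * hnorm H h"
proof -
  interpret A: cstar_algebra A by fact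
  interpret H: hilbert_space H by fact
  have fc: "f a \<in> carrier H" if "a \<in> carrier A" for a using f that by (rule linear_onD)
  have unit: "hnorm H (f x) \<le> hnorm H h" if x: "x \<in> carrier A" "cnorm A x < 1" for x
  proof -
    obtain b where b: "b \<in> carrier A" "star A b = b" "star A x \<otimes>\<^bsub>A\<^esub> x \<oplus>\<^bsub>A\<^esub> b \<otimes>\<^bsub>A\<^esub> b = 2 \<odot>\<^bsub>A\<^esub> b"
      using A.exists_one_minus_sqrt[OF x] by blast
    have "iprod H (f (star A x \<otimes>\<^bsub>A\<^esub> x)) h + iprod H (f (b \<otimes>\<^bsub>A\<^esub> b)) h
        = iprod H (f (star A x \<otimes>\<^bsub>A\<^esub> x \<oplus>\<^bsub>A\<^esub> b \<otimes>\<^bsub>A\<^esub> b)) h"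
      using x(1) b(1) h fc by (simp add: linear_onD[OF f] H.iprod_add)
    also have "\<dots> = 2 * iprod H (f b) h"
      using b(1) h fc[OF b(1)] unfolding b(3) linear_onD(3)[OF f b(1)] by (simp add: H.iprod_smult)
    finally have "iprod H (f x) (f x) + iprod H (f b) (f b) = 2 * iprod H (f b) h"
      using gns[of x x] gns[of b b] x b by simp
    then have "(hnorm H (f x))\<^sup>2 + (hnorm H (f b))\<^sup>2 = 2 * Re (iprod H (f b) h)"
      using H.iprod_self[OF fc[OF x(1)]] H.iprod_self[OF fc[OF b(1)]] by (simp add: complex_eq_iff)
    then have "(hnorm H (f b \<ominus>\<^bsub>H\<^esub> h))\<^sup>2 = (hnorm H h)\<^sup>2 - (hnorm H (f x))\<^sup>2"
      using H.hnorm_diff_square[OF fc h] b by simp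
    then have "(hnorm H (f x))\<^sup>2 \<le> (hnorm H h)\<^sup>2"
      using zero_le_power2[of "hnorm H (f b \<ominus>\<^bsub>H\<^esub> h)"] by linarith
    then show ?thesis by (rule power2_le_imp_le) (rule H.hnorm_nonneg[OF h])
  qed
  \<comment> \<open>\<open>t\<close> exceeds the norm strictly because the fixed point needs an
    element of norm less than 1.\<close>
  have "hnorm H (f x) \<le> t * hnorm H h" if t: "cnorm A x < t" for t
  proof -
    have t0: "t > 0" using A.cnorm_nonneg[OF x] t by simp
    have "hnorm H (f (complex_of_real (1 / t) \<odot>\<^bsub>A\<^esub> x)) \<le> hnorm H h"
      using x t t0 by (intro unit) (auto simp: A.cnorm_smult norm_divide)
    then show ?thesis
      using x t0 fc by (simp add: linear_onD(3)[OF f] H.hnorm_smult norm_divide field_simps)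
  qed
  note le = this
  show ?thesis
  proof (cases "hnorm H h = 0")
    case True
    then show ?thesis using le[of "cnorm A x + 1"] by simp
  next
    case False
    then have pos: "0 < hnorm H h" using H.hnorm_nonneg[OF h] by simp
    have "hnorm H (f x) / hnorm H h \<le> cnorm A x"
    proof (rule dense_ge)
      fix t assume "cnorm A x < t"
      from le[OF this] show "hnorm H (f x) / hnorm H h \<le> t" using pos by (simp add: pos_divide_le_eq)
    qed
    then show ?thesis using pos by (simp add: pos_divide_le_eq)
  qed
qed


section \<open>GNS maps\<close>

text \<open>
  \<open>\<Lambda>\<close> sends \<open>a\<close> to its class in the GNS space of the functional \<open>a \<mapsto> \<langle>\<Lambda> a, \<zeta>\<rangle>\<close>. Boundedness of
  \<open>\<Lambda>\<close> is automatic.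
\<close>

locale gns_map = A: cstar_algebra A + H: hilbert_space H
  for A :: "'a cstar" and H :: "'h hilb" and \<Lambda> :: "'a \<Rightarrow> 'h" and \<zeta> :: 'h +
  assumes linear: "linear_on A H \<Lambda>" and cyclic_closed: "\<zeta> \<in> carrier H"
    and dense: "H.dense (\<Lambda> ` carrier A)"
    and gns: "\<lbrakk>a \<in> carrier A; b \<in> carrier A\<rbrakk> \<Longrightarrow>
      iprod H (\<Lambda> a) (\<Lambda> b) = iprod H (\<Lambda> (star A b \<otimes>\<^bsub>A\<^esub> a)) \<zeta>"
begin

lemma closed [simp, intro]: "a \<in> carrier A \<Longrightarrow> \<Lambda> a \<in> carrier H"
  using linear by (rule linear_onD)

lemma bounded: "a \<in> carrier A \<Longrightarrow> hnorm H (\<Lambda> a) \<le> hnorm H \<zeta> * cnorm A a"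
  using gns_contractive[OF A.cstar_algebra_axioms H.hilbert_space_axioms linear cyclic_closed gns]
  by (simp add: mult.commute)

text \<open>The adjoint relation of the representation to be built, on the dense range of
  \<open>\<Lambda>\<close>.\<close>

lemma iprod_mult:
  assumes "a \<in> carrier A" "b \<in> carrier A" "c \<in> carrier A"
  shows "iprod H (\<Lambda> (a \<otimes>\<^bsub>A\<^esub> b)) (\<Lambda> c) = iprod H (\<Lambda> b) (\<Lambda> (star A a \<otimes>\<^bsub>A\<^esub> c))"
  using assms by (simp add: gns A.star_mult A.star_star A.mult_assoc)

lemma linear_mult_right: "b \<in> carrier A \<Longrightarrow> linear_on A H (\<lambda>a. \<Lambda> (a \<otimes>\<^bsub>A\<^esub> b))"
  by (intro linear_onI) (auto simp: A.mult_l_distr A.smult_mult_l linear_onD[OF linear])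

text \<open>The map a \<mapsto> \<Lambda> (a b) is again of GNS type, with
  \<open>\<Lambda> b\<close> as its vector. This takes the place of the operator inequality b* a* a
  b \<le> ||a||^2 b* b.\<close>

lemma contractive_mult:
  assumes a: "a \<in> carrier A" and b: "b \<in> carrier A"
  shows "hnorm H (\<Lambda> (a \<otimes>\<^bsub>A\<^esub> b)) \<le> cnorm A a * hnorm H (\<Lambda> b)"
proof (rule gns_contractive[OF A.cstar_algebra_axioms H.hilbert_space_axioms linear_mult_right[OF b] closed[OF b] _ a])
  fix c d assume "c \<in> carrier A" "d \<in> carrier A"
  then show "iprod H (\<Lambda> (c \<otimes>\<^bsub>A\<^esub> b)) (\<Lambda> (d \<otimes>\<^bsub>A\<^esub> b)) = iprod H (\<Lambda> (star A d \<otimes>\<^bsub>A\<^esub> c \<otimes>\<^bsub>A\<^esub> b)) (\<Lambda> b)"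
    using b iprod_mult[of "star A d" "c \<otimes>\<^bsub>A\<^esub> b" b] by (simp add: A.star_star A.mult_assoc)
qed

text \<open>By \<open>contractive_mult\<close> the value depends only on \<open>\<Lambda> b\<close>
  and not on \<open>b\<close>, and it extends from the dense range.\<close>

lemma exists_left_mult:
  assumes a: "a \<in> carrier A"
  shows "\<exists>f. linear_on H H f \<and> (\<forall>x\<in>carrier H. hnorm H (f x) \<le> cnorm A a * hnorm H x) \<and>
             (\<forall>b\<in>carrier A. f (\<Lambda> b) = \<Lambda> (a \<otimes>\<^bsub>A\<^esub> b))"
proof -
  have d: "{v. \<exists>w b. b \<in> carrier A \<and> v = \<Lambda> b \<and> w = \<Lambda> (a \<otimes>\<^bsub>A\<^esub> b)} = \<Lambda> ` carrier A" by auto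
  obtain f where "linear_on H H f" "\<And>x. x \<in> carrier H \<Longrightarrow> hnorm H (f x) \<le> cnorm A a * hnorm H x"
    "\<And>v w. \<exists>b. b \<in> carrier A \<and> v = \<Lambda> b \<and> w = \<Lambda> (a \<otimes>\<^bsub>A\<^esub> b) \<Longrightarrow> f v = w"
  proof (rule linear_bounded_extension[OF H.normed_module H.normed_module H.complete,
      where R = "\<lambda>v w. \<exists>b. b \<in> carrier A \<and> v = \<Lambda> b \<and> w = \<Lambda> (a \<otimes>\<^bsub>A\<^esub> b)" and C = "cnorm A a"])
    show "H.dense {v. \<exists>w b. b \<in> carrier A \<and> v = \<Lambda> b \<and> w = \<Lambda> (a \<otimes>\<^bsub>A\<^esub> b)}"
      unfolding d by (rule dense)
  next
    fix v w v' w'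
    assume "\<exists>b. b \<in> carrier A \<and> v = \<Lambda> b \<and> w = \<Lambda> (a \<otimes>\<^bsub>A\<^esub> b)" "\<exists>b. b \<in> carrier A \<and> v' = \<Lambda> b \<and> w' = \<Lambda> (a \<otimes>\<^bsub>A\<^esub> b)"
    then obtain b b' where b: "b \<in> carrier A" "v = \<Lambda> b" "w = \<Lambda> (a \<otimes>\<^bsub>A\<^esub> b)"
      and b': "b' \<in> carrier A" "v' = \<Lambda> b'" "w' = \<Lambda> (a \<otimes>\<^bsub>A\<^esub> b')" by blast
    then show "\<exists>b. b \<in> carrier A \<and> v \<oplus>\<^bsub>H\<^esub> v' = \<Lambda> b \<and> w \<oplus>\<^bsub>H\<^esub> w' = \<Lambda> (a \<otimes>\<^bsub>A\<^esub> b)"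
      using a by (intro exI[of _ "b \<oplus>\<^bsub>A\<^esub> b'"]) (simp add: linear_onD[OF linear] A.mult_r_distr)
  next
    fix c v w
    assume "\<exists>b. b \<in> carrier A \<and> v = \<Lambda> b \<and> w = \<Lambda> (a \<otimes>\<^bsub>A\<^esub> b)"
    then obtain b where b: "b \<in> carrier A" "v = \<Lambda> b" "w = \<Lambda> (a \<otimes>\<^bsub>A\<^esub> b)" by blast
    then show "\<exists>b. b \<in> carrier A \<and> c \<odot>\<^bsub>H\<^esub> v = \<Lambda> b \<and> c \<odot>\<^bsub>H\<^esub> w = \<Lambda> (a \<otimes>\<^bsub>A\<^esub> b)"
      using a by (intro exI[of _ "c \<odot>\<^bsub>A\<^esub> b"]) (simp add: linear_onD[OF linear] A.smult_mult_r)
  qed (use a contractive_mult A.cnorm_nonneg in auto)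
  then show ?thesis by blast
qed

text \<open>\<open>spatial_norms\<close> quantifies over representations, so a GNS map has to be
  turned back into one. The algebraic laws are checked on the range of \<open>\<Lambda>\<close> and
  extended by density.\<close>

lemma exists_representation:
  obtains \<pi> where "representation A H \<pi>" "\<And>a. a \<in> carrier A \<Longrightarrow> \<pi> a \<zeta> = \<Lambda> a"
proof -
  have "\<forall>a. \<exists>f. a \<in> carrier A \<longrightarrow> linear_on H H f \<and> (\<forall>x\<in>carrier H. hnorm H (f x) \<le> cnorm A a * hnorm H x) \<and>
             (\<forall>b\<in>carrier A. f (\<Lambda> b) = \<Lambda> (a \<otimes>\<^bsub>A\<^esub> b))"
    using exists_left_mult by blast
  then obtain \<pi> where
    lin: "\<And>a. a \<in> carrier A \<Longrightarrow> linear_on H H (\<pi> a)" and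
    bd: "\<And>a x. \<lbrakk>a \<in> carrier A; x \<in> carrier H\<rbrakk> \<Longrightarrow> hnorm H (\<pi> a x) \<le> cnorm A a * hnorm H x" and
    mult: "\<And>a b. \<lbrakk>a \<in> carrier A; b \<in> carrier A\<rbrakk> \<Longrightarrow> \<pi> a (\<Lambda> b) = \<Lambda> (a \<otimes>\<^bsub>A\<^esub> b)"
    by metis
  have cl [simp]: "\<pi> a x \<in> carrier H" if "a \<in> carrier A" "x \<in> carrier H" for a x
    using lin[OF that(1)] that(2) by (rule linear_onD)
  have agree: "f x = g x"
    if "linear_on H H f" "\<And>y. y \<in> carrier H \<Longrightarrow> hnorm H (f y) \<le> C * hnorm H y"
      "linear_on H H g" "\<And>y. y \<in> carrier H \<Longrightarrow> hnorm H (g y) \<le> D * hnorm H y"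
      "\<And>b. b \<in> carrier A \<Longrightarrow> f (\<Lambda> b) = g (\<Lambda> b)" "x \<in> carrier H" for f g C D x
    by (rule linear_bounded_agree[OF H.normed_module H.normed_module that(1,2,3,4) dense _ that(6)])
      (use that(5) in auto)
  have rep: "representation A H \<pi>"
    unfolding representation_def
  proof (intro conjI ballI allI)
    show "hilbert_space H" by (rule H.hilbert_space_axioms)
    show "bounded_op H H (\<pi> a)" if "a \<in> carrier A" for a
      using lin[OF that] bd[OF that] unfolding bounded_op_def by blast
  next
    fix a b x assume a: "a \<in> carrier A" and b: "b \<in> carrier A" and x: "x \<in> carrier H"
    show "\<pi> (a \<oplus>\<^bsub>A\<^esub> b) x = \<pi> a x \<oplus>\<^bsub>H\<^esub> \<pi> b x"
    proof (rule agree[OF lin bd _ _ _ x])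
      show "linear_on H H (\<lambda>x. \<pi> a x \<oplus>\<^bsub>H\<^esub> \<pi> b x)"
        using a b by (intro linear_onI) (simp_all add: linear_onD[OF lin] H.smult_add_right H.M.a_ac)
      show "hnorm H (\<pi> a y \<oplus>\<^bsub>H\<^esub> \<pi> b y) \<le> (cnorm A a + cnorm A b) * hnorm H y" if "y \<in> carrier H" for y
        using H.N_triangle[of "\<pi> a y" "\<pi> b y"] bd[OF a that] bd[OF b that] a b that
        by (simp add: algebra_simps)
    qed (use a b in \<open>auto simp: mult A.mult_l_distr linear_onD[OF linear]\<close>)
    show "\<pi> (a \<otimes>\<^bsub>A\<^esub> b) x = \<pi> a (\<pi> b x)"
    proof (rule agree[OF lin bd _ _ _ x])
      show "linear_on H H (\<lambda>x. \<pi> a (\<pi> b x))" using lin[OF b] lin[OF a] by (rule linear_on_comp)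
      show "hnorm H (\<pi> a (\<pi> b y)) \<le> (cnorm A a * cnorm A b) * hnorm H y" if "y \<in> carrier H" for y
      proof -
        have "hnorm H (\<pi> a (\<pi> b y)) \<le> cnorm A a * hnorm H (\<pi> b y)" using a b that by (intro bd) auto
        also have "\<dots> \<le> cnorm A a * (cnorm A b * hnorm H y)"
          using a b that by (intro mult_left_mono bd A.cnorm_nonneg)
        finally show ?thesis by (simp add: mult.assoc)
      qed
    qed (use a b in \<open>auto simp: mult A.mult_assoc\<close>)
  next
    fix c a x assume a: "a \<in> carrier A" and x: "x \<in> carrier H"
    show "\<pi> (c \<odot>\<^bsub>A\<^esub> a) x = c \<odot>\<^bsub>H\<^esub> \<pi> a x"
    proof (rule agree[OF lin bd _ _ _ x])
      show "linear_on H H (\<lambda>x. c \<odot>\<^bsub>H\<^esub> \<pi> a x)"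
        using a by (intro linear_onI) (simp_all add: linear_onD[OF lin] H.smult_add_right mult.commute)
      show "hnorm H (c \<odot>\<^bsub>H\<^esub> \<pi> a y) \<le> (cmod c * cnorm A a) * hnorm H y" if "y \<in> carrier H" for y
        using mult_left_mono[OF bd[OF a that] norm_ge_zero[of c]] a that by (simp add: H.hnorm_smult mult.assoc)
    qed (use a in \<open>auto simp: mult A.smult_mult_l linear_onD[OF linear]\<close>)
  next
    fix a x y assume a: "a \<in> carrier A" and x: "x \<in> carrier H" and y: "y \<in> carrier H"
    have bd': "cmod (iprod H u (\<pi> a v)) \<le> (hnorm H u * cnorm A a) * hnorm H v"
      if "a \<in> carrier A" "u \<in> carrier H" "v \<in> carrier H" for a u v
    proof -
      have "cmod (iprod H u (\<pi> a v)) \<le> hnorm H u * hnorm H (\<pi> a v)"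
        using that by (intro H.Cauchy_Schwarz) auto
      also have "\<dots> \<le> hnorm H u * (cnorm A a * hnorm H v)"
        using that by (intro mult_left_mono bd H.hnorm_nonneg)
      finally show ?thesis by (simp add: mult.assoc)
    qed
    have sa: "star A a \<in> carrier A" using a by simp
    \<comment> \<open>The adjoint relation needs density in both slots. Here the first vector is in
      the range of \<open>\<Lambda>\<close> and the second becomes arbitrary.\<close>
    have right: "cnj (iprod H (\<pi> (star A a) (\<Lambda> b)) y) = cnj (iprod H (\<Lambda> b) (\<pi> a y))"
      if b: "b \<in> carrier A" and y: "y \<in> carrier H" for b y
    proof (rule functional_bounded_agree[OF H.normed_module _ _ _ _ dense _ y])
      show "linear_functional H (\<lambda>y. cnj (iprod H (\<pi> (star A a) (\<Lambda> b)) y))"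
        using a b by (intro H.linear_functional_iprod_right) simp
      show "cmod (cnj (iprod H (\<pi> (star A a) (\<Lambda> b)) y)) \<le> hnorm H (\<pi> (star A a) (\<Lambda> b)) * hnorm H y"
        if "y \<in> carrier H" for y
        using H.Cauchy_Schwarz[of "\<pi> (star A a) (\<Lambda> b)" y] a b that by simp
      show "linear_functional H (\<lambda>y. cnj (iprod H (\<Lambda> b) (\<pi> a y)))"
        by (rule linear_functional_comp[OF lin[OF a] H.linear_functional_iprod_right[OF closed[OF b]]])
      show "cmod (cnj (iprod H (\<Lambda> b) (\<pi> a y))) \<le> (hnorm H (\<Lambda> b) * cnorm A a) * hnorm H y"
        if "y \<in> carrier H" for y
        using bd'[OF a _ that] b by simp
      show "cnj (iprod H (\<pi> (star A a) (\<Lambda> b)) y) = cnj (iprod H (\<Lambda> b) (\<pi> a y))"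
        if y: "y \<in> \<Lambda> ` carrier A" for y
      proof -
        obtain c where c: "c \<in> carrier A" "y = \<Lambda> c" using y by blast
        show ?thesis using iprod_mult[OF sa b c(1)] a b c by (simp add: mult A.star_star)
      qed
    qed
    show "iprod H (\<pi> (star A a) x) y = iprod H x (\<pi> a y)"
    proof (rule functional_bounded_agree[OF H.normed_module _ _ _ _ dense _ x])
      show "linear_functional H (\<lambda>x. iprod H (\<pi> (star A a) x) y)"
        by (rule linear_functional_comp[OF lin[OF sa] H.linear_functional_iprod_left[OF y]])
      show "cmod (iprod H (\<pi> (star A a) x) y) \<le> (hnorm H y * cnorm A (star A a)) * hnorm H x"
        if x: "x \<in> carrier H" for x
      proof -
        have "iprod H (\<pi> (star A a) x) y = cnj (iprod H y (\<pi> (star A a) x))"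
          using a x y by (intro H.iprod_cnj) auto
        then show ?thesis using bd'[OF sa y x] by simp
      qed
      show "linear_functional H (\<lambda>x. iprod H x (\<pi> a y))"
        using a y by (intro H.linear_functional_iprod_left) simp
      show "cmod (iprod H x (\<pi> a y)) \<le> hnorm H (\<pi> a y) * hnorm H x" if "x \<in> carrier H" for x
        using H.Cauchy_Schwarz[of x "\<pi> a y"] a y that by (simp add: mult.commute)
      show "iprod H (\<pi> (star A a) x) y = iprod H x (\<pi> a y)" if x: "x \<in> \<Lambda> ` carrier A" for x
        using x right[OF _ y] complex_cnj_cancel_iff by blast
    qed
  qed
  \<comment> \<open>Nothing places \<open>\<zeta>\<close> in the range of \<open>\<Lambda>\<close>.
    Both sides are therefore tested against the vectors \<open>\<Lambda> b\<close>, where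
    \<open>gns\<close> expresses the pairing with \<open>\<zeta>\<close>.\<close>
  have "\<pi> a \<zeta> = \<Lambda> a" if a: "a \<in> carrier A" for a
  proof -
    have "\<pi> a \<zeta> \<ominus>\<^bsub>H\<^esub> \<Lambda> a = \<zero>\<^bsub>H\<^esub>"
    proof (rule H.orthogonal_dense_imp_zero[OF dense])
      fix y assume "y \<in> \<Lambda> ` carrier A"
      then obtain b where b: "b \<in> carrier A" "y = \<Lambda> b" by blast
      have "iprod H (\<pi> (star A (star A a)) \<zeta>) (\<Lambda> b) = iprod H \<zeta> (\<pi> (star A a) (\<Lambda> b))"
        using rep a b cyclic_closed unfolding representation_def by (simp only: A.star_closed closed)
      then have "iprod H (\<pi> a \<zeta>) (\<Lambda> b) = iprod H \<zeta> (\<Lambda> (star A a \<otimes>\<^bsub>A\<^esub> b))"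
        using a b by (simp add: A.star_star mult)
      also have "\<dots> = cnj (iprod H (\<Lambda> (star A a \<otimes>\<^bsub>A\<^esub> b)) \<zeta>)"
        using a b cyclic_closed by (intro H.iprod_cnj) auto
      also have "\<dots> = cnj (iprod H (\<Lambda> b) (\<Lambda> a))" using gns[OF b(1) a] by simp
      also have "\<dots> = iprod H (\<Lambda> a) (\<Lambda> b)" using a b by (intro H.iprod_cnj[symmetric]) auto
      finally show "iprod H (\<pi> a \<zeta> \<ominus>\<^bsub>H\<^esub> \<Lambda> a) y = 0"
        using a b cyclic_closed by (simp add: H.iprod_diff)
    qed (use a cyclic_closed in auto)
    then show ?thesis using a cyclic_closed by (simp add: H.diff_eq_zero_iff)
  qed
  then show thesis using rep that by blast
qed

end

section \<open>GNS representations and their transport to function spaces\<close>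

lemma gns_representation_imp_gns_map:
  assumes A: "cstar_algebra A" and gns: "gns_representation A \<phi> H \<pi>"
  obtains \<xi> where "gns_map A H (\<lambda>a. \<pi> a \<xi>) \<xi>" "\<And>a. a \<in> carrier A \<Longrightarrow> \<phi> a = iprod H (\<pi> a \<xi>) \<xi>"
proof -
  obtain \<xi> where rep: "representation A H \<pi>" and \<xi>: "\<xi> \<in> carrier H"
    and dense: "hdense H {\<pi> a \<xi> |a. a \<in> carrier A}"
    and \<phi>: "\<And>a. a \<in> carrier A \<Longrightarrow> \<phi> a = iprod H (\<pi> a \<xi>) \<xi>"
    using gns unfolding gns_representation_def by blast
  interpret A: cstar_algebra A by fact
  interpret H: hilbert_space H using rep by (simp add: representation_def)
  have lin: "linear_on H H (\<pi> a)" if "a \<in> carrier A" for a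
    using rep that by (auto simp: representation_def bounded_op_def)
  have "gns_map A H (\<lambda>a. \<pi> a \<xi>) \<xi>"
  proof
    show "linear_on A H (\<lambda>a. \<pi> a \<xi>)"
      using rep \<xi> by (intro linear_onI linear_onD(1)[OF lin]) (simp_all add: representation_def)
    show "H.dense ((\<lambda>a. \<pi> a \<xi>) ` carrier A)"
      using dense unfolding H.hdense_iff by (simp add: image_def Collect_conj_eq setcompr_eq_image)
    \<comment> \<open>Move \<open>\<pi> b\<close> to the first slot as
      \<open>\<pi> (star A b)\<close> and use multiplicativity.\<close>
    show "iprod H (\<pi> a \<xi>) (\<pi> b \<xi>) = iprod H (\<pi> (star A b \<otimes>\<^bsub>A\<^esub> a) \<xi>) \<xi>"
      if "a \<in> carrier A" "b \<in> carrier A" for a b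
      using rep \<xi> that linear_onD(1)[OF lin[OF that(1)] \<xi>] by (simp add: representation_def)
  qed fact
  then show thesis using \<phi> by (rule that)
qed

text \<open>
  Moves GNS spaces into the types over which \<^const>\<open>spatial_norms\<close> quantifies.
\<close>

definition transported :: "('h \<Rightarrow> 'x) \<Rightarrow> 'h hilb \<Rightarrow> 'x hilb" where
  "transported U H = (let G = inv_into (carrier H) U in
     \<lparr>carrier = U ` carrier H, mult = undefined, one = undefined, zero = U \<zero>\<^bsub>H\<^esub>,
      add = \<lambda>x y. U (G x \<oplus>\<^bsub>H\<^esub> G y), smult = \<lambda>c x. U (c \<odot>\<^bsub>H\<^esub> G x), iprod = \<lambda>x y. iprod H (G x) (G y)\<rparr>)"

lemma transported_simps:
  assumes "inj_on U (carrier H)"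
  shows "carrier (transported U H) = U ` carrier H" "\<zero>\<^bsub>transported U H\<^esub> = U \<zero>\<^bsub>H\<^esub>"
    and "\<lbrakk>x \<in> carrier H; y \<in> carrier H\<rbrakk> \<Longrightarrow> U x \<oplus>\<^bsub>transported U H\<^esub> U y = U (x \<oplus>\<^bsub>H\<^esub> y)"
    and "x \<in> carrier H \<Longrightarrow> c \<odot>\<^bsub>transported U H\<^esub> U x = U (c \<odot>\<^bsub>H\<^esub> x)"
    and "\<lbrakk>x \<in> carrier H; y \<in> carrier H\<rbrakk> \<Longrightarrow> iprod (transported U H) (U x) (U y) = iprod H x y"
  using assms by (simp_all add: transported_def Let_def)

text \<open>\<open>U\<close> is unitary onto its image by construction, so every axiom is pulled
  back along it; for completeness a Cauchy sequence is lifted to \<open>H\<close>.\<close>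

lemma hilbert_space_transported:
  assumes H: "hilbert_space H" and inj: "inj_on U (carrier H)"
  shows "hilbert_space (transported U H)"
proof -
  interpret H: hilbert_space H by fact
  let ?K = "transported U H"
  note [simp] = transported_simps[OF inj]
  have ag: "abelian_group ?K"
  proof (rule abelian_groupI)
    fix x assume "x \<in> carrier ?K"
    then obtain u where "u \<in> carrier H" "x = U u" by auto
    then show "\<exists>y\<in>carrier ?K. y \<oplus>\<^bsub>?K\<^esub> x = \<zero>\<^bsub>?K\<^esub>"
      by (intro bexI[of _ "U (\<ominus>\<^bsub>H\<^esub> u)"]) (simp_all add: H.M.l_neg)
  qed (auto simp: H.M.a_ac)
  have md: "Module.module complex_ring ?K"
    by (rule moduleI[OF cring_complex_ring ag])
      (auto simp: H.smult_add_left H.smult_add_right)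
  interpret K: complex_module ?K
    using md by (simp add: complex_module_def)
  have diff: "U x \<ominus>\<^bsub>?K\<^esub> U y = U (x \<ominus>\<^bsub>H\<^esub> y)" if "x \<in> carrier H" "y \<in> carrier H" for x y
    using that by (simp add: K.diff_eq_smult H.diff_eq_smult)
  have dist: "hdist ?K (U x) (U y) = hdist H x y" if "x \<in> carrier H" "y \<in> carrier H" for x y
    using that by (simp add: hdist_def diff hnorm_def)
  interpret M: Metric_space "carrier H" "hdist H"
    using H.Metric.Metric_space_axioms by (simp add: H.ndist_eq_hdist)
  interpret KM: Metric_space "carrier ?K" "hdist ?K"
  proof
    show "0 \<le> hdist ?K x y" for x y
      using M.nonneg dist by (cases "x \<in> carrier ?K \<and> y \<in> carrier ?K") (auto simp: hdist_def[of ?K])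
    show "hdist ?K x y = hdist ?K y x" for x y
      using M.commute dist by (cases "x \<in> carrier ?K \<and> y \<in> carrier ?K") (auto simp: hdist_def[of ?K])
    show "hdist ?K x y = 0 \<longleftrightarrow> x = y" if "x \<in> carrier ?K" "y \<in> carrier ?K" for x y
      using that inj by (auto simp: dist inj_on_eq_iff)
    show "hdist ?K x z \<le> hdist ?K x y + hdist ?K y z"
      if "x \<in> carrier ?K" "y \<in> carrier ?K" "z \<in> carrier ?K" for x y z
      using that M.triangle by (auto simp: dist)
  qed
  have "KM.mcomplete"
    unfolding KM.mcomplete_def
  proof (intro allI impI)
    fix s assume s: "KM.MCauchy s"
    have "\<forall>n. \<exists>u. u \<in> carrier H \<and> s n = U u"
      using s unfolding KM.MCauchy_def by (auto simp: image_subset_iff)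
    then obtain u where u: "\<And>n. u n \<in> carrier H" "\<And>n. s n = U (u n)" by metis
    have "M.MCauchy u"
      using s u unfolding M.MCauchy_def KM.MCauchy_def by (auto simp: dist)
    then obtain l where "limitin M.mtopology u l sequentially"
      using H.hnorm_complete unfolding M.mcomplete_def by blast
    then have l: "l \<in> carrier H" and lim: "\<And>e. e > 0 \<Longrightarrow> \<exists>N. \<forall>n\<ge>N. hdist H (u n) l < e"
      unfolding M.limit_metric_sequentially by blast+
    have "hdist ?K (s n) (U l) = hdist H (u n) l" for n using u l by (simp add: dist)
    then have lim': "\<exists>N. \<forall>n\<ge>N. hdist ?K (s n) (U l) < e" if "e > 0" for e using lim[OF that] by simp
    have c: "s n \<in> carrier ?K" "U l \<in> carrier ?K" for n using u l by simp_all
    have "limitin KM.mtopology s (U l) sequentially"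
      unfolding KM.limit_metric_sequentially using lim' by (simp only: c simp_thms) blast
    then show "\<exists>x. limitin KM.mtopology s x sequentially" ..
  qed
  show ?thesis
  proof (intro hilbert_space.intro md hilbert_space_axioms.intro)
    show "iprod ?K x y = cnj (iprod ?K y x)" if "x \<in> carrier ?K" "y \<in> carrier ?K" for x y
      using that by (auto intro: H.iprod_cnj)
    show "x = \<zero>\<^bsub>?K\<^esub>" if "x \<in> carrier ?K" "iprod ?K x x = 0" for x
      using that H.iprod_eq_0 by auto
    show "Metric_space.mcomplete (carrier ?K) (hdist ?K)" by fact
  qed (auto simp: H.iprod_add H.iprod_smult H.iprod_nonneg)
qed

text \<open>The embedding sends h to the function a \<mapsto>
  \<open>iprod H h (\<Lambda> a)\<close>, and it is injective because \<open>\<Lambda>\<close> has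
  dense range. The recorded inner products and the norm of the cyclic vector are what the spatial
  norm estimate uses.\<close>

lemma (in gns_map) transport:
  obtains H' :: "('a \<Rightarrow> complex) hilb" and \<Lambda>' \<zeta>'
  where "gns_map A H' \<Lambda>' \<zeta>'" "hnorm H' \<zeta>' = hnorm H \<zeta>"
    "\<And>a b. \<lbrakk>a \<in> carrier A; b \<in> carrier A\<rbrakk> \<Longrightarrow> iprod H' (\<Lambda>' a) (\<Lambda>' b) = iprod H (\<Lambda> a) (\<Lambda> b)"
proof -
  define U where "U h = (\<lambda>a. if a \<in> carrier A then iprod H h (\<Lambda> a) else 0)" for h
  have inj: "inj_on U (carrier H)"
  proof (rule inj_onI)
    fix x y assume xy: "x \<in> carrier H" "y \<in> carrier H" and eq: "U x = U y"
    have "x \<ominus>\<^bsub>H\<^esub> y = \<zero>\<^bsub>H\<^esub>"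
    proof (rule H.orthogonal_dense_imp_zero[OF dense])
      fix z assume "z \<in> \<Lambda> ` carrier A"
      then obtain a where a: "a \<in> carrier A" "z = \<Lambda> a" by blast
      have "iprod H x (\<Lambda> a) = iprod H y (\<Lambda> a)" using fun_cong[OF eq, of a] a by (simp add: U_def)
      then show "iprod H (x \<ominus>\<^bsub>H\<^esub> y) z = 0" using xy a by (simp add: H.iprod_diff)
    qed (use xy in simp)
    then show "x = y" using xy by (simp add: H.diff_eq_zero_iff)
  qed
  let ?K = "transported U H"
  note [simp] = transported_simps[OF inj]
  interpret K: hilbert_space ?K by (rule hilbert_space_transported[OF H.hilbert_space_axioms inj])
  have linU: "linear_on H ?K U" by (intro linear_onI) auto
  have norm: "hnorm ?K (U x) = hnorm H x" if "x \<in> carrier H" for x using that by (simp add: hnorm_def)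
  have "gns_map A ?K (\<lambda>a. U (\<Lambda> a)) (U \<zeta>)"
  proof
    show "linear_on A ?K (\<lambda>a. U (\<Lambda> a))" using linear linU by (rule linear_on_comp)
    show "K.dense ((\<lambda>a. U (\<Lambda> a)) ` carrier A)"
      unfolding K.dense_def
    proof (intro ballI allI impI)
      fix x and e :: real assume "x \<in> carrier ?K" "e > 0"
      then obtain u where u: "u \<in> carrier H" "x = U u" by auto
      obtain a where a: "a \<in> carrier A" "hnorm H (u \<ominus>\<^bsub>H\<^esub> \<Lambda> a) < e"
        using H.denseE[OF dense u(1) \<open>e > 0\<close>] by blast
      have "U u \<ominus>\<^bsub>?K\<^esub> U (\<Lambda> a) = U (u \<ominus>\<^bsub>H\<^esub> \<Lambda> a)"
        using u a by (intro linear_on_diff[OF linU, symmetric] H.complex_module_axioms K.complex_module_axioms) auto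
      then have "hnorm ?K (x \<ominus>\<^bsub>?K\<^esub> U (\<Lambda> a)) < e" using a u by (simp add: norm)
      then show "\<exists>y\<in>(\<lambda>a. U (\<Lambda> a)) ` carrier A. y \<in> carrier ?K \<and> hnorm ?K (x \<ominus>\<^bsub>?K\<^esub> y) < e"
        using a by (intro bexI[of _ "U (\<Lambda> a)"]) auto
    qed
  qed (use cyclic_closed gns in auto)
  then show thesis
    by (rule that) (use cyclic_closed norm in auto)
qed


section \<open>Tensor products\<close>

text \<open>Serves for the density of the range of a tensor GNS map: as \<open>S\<close> is closed
  under sums, it is enough to approximate one elementary tensor at a time.\<close>

lemma (in normed_module) dense_if_total_approximable:
  assumes total: "dense (finite_sums V D e)" and e: "\<And>i. i \<in> D \<Longrightarrow> e i \<in> carrier V"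
    and S: "S \<subseteq> carrier V" "\<zero> \<in> S" "\<And>x y. \<lbrakk>x \<in> S; y \<in> S\<rbrakk> \<Longrightarrow> x \<oplus> y \<in> S"
    and approx: "\<And>i \<epsilon>. \<lbrakk>i \<in> D; 0 < \<epsilon>\<rbrakk> \<Longrightarrow> \<exists>y\<in>S. N (e i \<ominus> y) < \<epsilon>"
  shows "dense S"
proof -
  have sums: "\<exists>y\<in>S. N ((\<Oplus>i\<in>{..<n}. e (p i)) \<ominus> y) < \<epsilon>"
    if "\<forall>i<(n::nat). p i \<in> D" "0 < \<epsilon>" for n p \<epsilon>
    using that
  proof (induction n arbitrary: \<epsilon>)
    case 0
    then show ?case
      using S(2) N_eq_0[of \<zero>] diff_eq_zero_iff[of \<zero> \<zero>] by (intro bexI[of _ \<zero>]) simp_all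
  next
    case (Suc n)
    let ?s = "\<Oplus>i\<in>{..<n}. e (p i)"
    obtain y where y: "y \<in> S" "N (?s \<ominus> y) < \<epsilon> / 2" using Suc.IH[of "\<epsilon> / 2"] Suc.prems by auto
    obtain z where z: "z \<in> S" "N (e (p n) \<ominus> z) < \<epsilon> / 2" using approx[of "p n" "\<epsilon> / 2"] Suc.prems by auto
    have c: "?s \<in> carrier V" "e (p n) \<in> carrier V" "y \<in> carrier V" "z \<in> carrier V"
      using Suc.prems e y z S(1) by (auto intro!: M.finsum_closed)
    have "(\<Oplus>i\<in>{..<Suc n}. e (p i)) = ?s \<oplus> e (p n)"
      using Suc.prems e by (intro finsum_lessThan_Suc) auto
    then have "N ((\<Oplus>i\<in>{..<Suc n}. e (p i)) \<ominus> (y \<oplus> z)) < \<epsilon>"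
      using N_triangle[of "?s \<ominus> y" "e (p n) \<ominus> z"] c y z by (simp only: add_diff_add) simp
    then show ?case using S(3)[OF y(1) z(1)] by blast
  qed
  show ?thesis
    unfolding dense_def
  proof (intro ballI allI impI)
    fix x and \<epsilon> :: real assume x: "x \<in> carrier V" and \<epsilon>: "0 < \<epsilon>"
    obtain v where v: "v \<in> finite_sums V D e" "v \<in> carrier V" "N (x \<ominus> v) < \<epsilon> / 2"
      using denseE[OF total x, of "\<epsilon> / 2"] \<epsilon> by auto
    obtain y where y: "y \<in> S" "N (v \<ominus> y) < \<epsilon> / 2"
    proof -
      obtain n p where "\<forall>i<(n::nat). p i \<in> D" "v = (\<Oplus>i\<in>{..<n}. e (p i))"
        using v(1) unfolding finite_sums_def by blast
      with sums[of n p "\<epsilon> / 2"] \<epsilon> show ?thesis using that by auto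
    qed
    have "y \<in> carrier V" using y(1) S(1) by blast
    then have "N (x \<ominus> y) < \<epsilon>"
      using N_diff_triangle[OF x v(2), of y] v(3) y(2) by simp
    then show "\<exists>y\<in>S. y \<in> carrier V \<and> N (x \<ominus> y) < \<epsilon>" using y(1) S(1) by blast
  qed
qed

text \<open>The constant in \<open>bounded_op\<close> may be negative if all norms vanish; its
  absolute value can be used in monotonicity arguments.\<close>

lemma bounded_opE:
  assumes "bounded_op H K X" "hilbert_space H"
  obtains C where "0 \<le> C" "\<And>x. x \<in> carrier H \<Longrightarrow> hnorm K (X x) \<le> C * hnorm H x"
proof -
  interpret hilbert_space H by fact
  obtain C where C: "\<And>x. x \<in> carrier H \<Longrightarrow> hnorm K (X x) \<le> C * hnorm H x"
    using assms(1) unfolding bounded_op_def by blast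
  have "hnorm K (X x) \<le> \<bar>C\<bar> * hnorm H x" if "x \<in> carrier H" for x
    using C[OF that] mult_right_mono[OF abs_ge_self[of C] hnorm_nonneg[OF that]] by linarith
  then show thesis using that[of "\<bar>C\<bar>"] by simp
qed

section \<open>Hilbert space tensor products\<close>

locale tensor_hilbert = H: hilbert_space H + K: hilbert_space K + L: hilbert_space L
  for H :: "'h hilb" and K :: "'k hilb" and L :: "'l hilb" and \<sigma> :: "'h \<Rightarrow> 'k \<Rightarrow> 'l" +
  assumes tensor: "hilbert_tensor H K L \<sigma>"
begin

lemma bilinear: "bilinear_on H K L \<sigma>"
  using tensor by (simp add: hilbert_tensor_def)

lemmas linear_right = bilinear_onD(1)[OF bilinear]
  and linear_left = bilinear_onD(2)[OF bilinear]
  and closed [simp, intro] = bilinear_onD(3)[OF bilinear]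

lemma iprod_tensor:
  "\<lbrakk>h \<in> carrier H; h' \<in> carrier H; k \<in> carrier K; k' \<in> carrier K\<rbrakk> \<Longrightarrow>
    iprod L (\<sigma> h k) (\<sigma> h' k') = iprod H h h' * iprod K k k'"
  using tensor by (simp add: hilbert_tensor_def)

lemma total: "L.dense (finite_sums L (carrier H \<times> carrier K) (\<lambda>(h, k). \<sigma> h k))"
  using tensor unfolding hilbert_tensor_def L.hdense_iff finite_sums_Times by blast

lemma hnorm_tensor:
  assumes "h \<in> carrier H" "k \<in> carrier K"
  shows "hnorm L (\<sigma> h k) = hnorm H h * hnorm K k"
proof -
  have "iprod L (\<sigma> h k) (\<sigma> h k) = complex_of_real ((hnorm H h)\<^sup>2 * (hnorm K k)\<^sup>2)"
    using assms by (simp add: iprod_tensor H.iprod_self K.iprod_self)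
  then show ?thesis
    using assms by (simp add: hnorm_def[of L] real_sqrt_mult H.hnorm_nonneg K.hnorm_nonneg)
qed

text \<open>The norm depends only on the Gram data of the factors. This makes different models of a
  tensor product comparable with each other and with the spatial norm.\<close>

lemma hnorm_sum_tensor:
  assumes "\<And>i. i < n \<Longrightarrow> h i \<in> carrier H" "\<And>i. i < n \<Longrightarrow> k i \<in> carrier K"
  shows "hnorm L (\<Oplus>\<^bsub>L\<^esub>i\<in>{..<n::nat}. \<sigma> (h i) (k i)) = alg_tensor_norm H K {..<n} h k"
proof -
  have "iprod L (\<Oplus>\<^bsub>L\<^esub>i\<in>{..<n}. \<sigma> (h i) (k i)) (\<Oplus>\<^bsub>L\<^esub>i\<in>{..<n}. \<sigma> (h i) (k i))
      = (\<Sum>i<n. \<Sum>j<n. iprod L (\<sigma> (h i) (k i)) (\<sigma> (h j) (k j)))"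
    using assms by (intro L.iprod_finsum_finsum) auto
  also have "\<dots> = (\<Sum>i<n. \<Sum>j<n. iprod H (h i) (h j) * iprod K (k i) (k j))"
    using assms by (intro sum.cong refl iprod_tensor) auto
  finally show ?thesis unfolding hnorm_def alg_tensor_norm_def by simp
qed

text \<open>One factor is changed at a time; \<open>k'\<close> is chosen after \<open>h'\<close>
  because the second error carries the factor ||h'||.\<close>

lemma approximable:
  assumes S: "H.dense S" and S': "K.dense S'" and h: "h \<in> carrier H" and k: "k \<in> carrier K" and \<epsilon>: "0 < \<epsilon>"
  shows "\<exists>h'\<in>S. \<exists>k'\<in>S'. h' \<in> carrier H \<and> k' \<in> carrier K \<and> hnorm L (\<sigma> h k \<ominus>\<^bsub>L\<^esub> \<sigma> h' k') < \<epsilon>"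
proof -
  \<comment> \<open>The summand 1 keeps the denominator positive when \<open>k\<close>
    vanishes.\<close>
  have "0 < \<epsilon> / 2 / (hnorm K k + 1)" using \<epsilon> K.hnorm_nonneg[OF k] by simp
  then obtain h' where h': "h' \<in> S" "h' \<in> carrier H" "hnorm H (h \<ominus>\<^bsub>H\<^esub> h') < \<epsilon> / 2 / (hnorm K k + 1)"
    by (rule H.denseE[OF S h])
  have "0 < \<epsilon> / 2 / (hnorm H h' + 1)" using \<epsilon> H.hnorm_nonneg[OF h'(2)] by simp
  then obtain k' where k': "k' \<in> S'" "k' \<in> carrier K" "hnorm K (k \<ominus>\<^bsub>K\<^esub> k') < \<epsilon> / 2 / (hnorm H h' + 1)"
    by (rule K.denseE[OF S' k])
  have *: "s * t < \<epsilon> / 2" if "0 \<le> s" "0 \<le> t" "s < \<epsilon> / 2 / (t + 1)" for s t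
  proof -
    have "s * t \<le> s * (t + 1)" using that by (simp add: mult_left_mono)
    also have "\<dots> < \<epsilon> / 2" using that by (simp add: pos_less_divide_eq algebra_simps)
    finally show ?thesis .
  qed
  have c: "\<sigma> h k \<in> carrier L" "\<sigma> h' k \<in> carrier L" "\<sigma> h' k' \<in> carrier L"
    using h k h' k' by auto
  have "\<sigma> h k \<ominus>\<^bsub>L\<^esub> \<sigma> h' k = \<sigma> (h \<ominus>\<^bsub>H\<^esub> h') k"
    using h k h' by (intro linear_on_diff[OF linear_left, symmetric] H.complex_module_axioms L.complex_module_axioms) auto
  then have 1: "hnorm L (\<sigma> h k \<ominus>\<^bsub>L\<^esub> \<sigma> h' k) < \<epsilon> / 2"
    using *[of "hnorm H (h \<ominus>\<^bsub>H\<^esub> h')" "hnorm K k"] h k h' by (simp add: hnorm_tensor H.hnorm_nonneg K.hnorm_nonneg)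
  have "\<sigma> h' k \<ominus>\<^bsub>L\<^esub> \<sigma> h' k' = \<sigma> h' (k \<ominus>\<^bsub>K\<^esub> k')"
    using h k h' k' by (intro linear_on_diff[OF linear_right, symmetric] K.complex_module_axioms L.complex_module_axioms) auto
  then have 2: "hnorm L (\<sigma> h' k \<ominus>\<^bsub>L\<^esub> \<sigma> h' k') < \<epsilon> / 2"
    using *[of "hnorm K (k \<ominus>\<^bsub>K\<^esub> k')" "hnorm H h'"] h k h' k'
    by (simp add: hnorm_tensor H.hnorm_nonneg K.hnorm_nonneg mult.commute)
  have "hnorm L (\<sigma> h k \<ominus>\<^bsub>L\<^esub> \<sigma> h' k') < \<epsilon>"
    using L.N_diff_triangle[OF c] 1 2 by simp
  then show ?thesis using h' k' by blast
qed

end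

lemma tensor_hilbertI: "hilbert_tensor H K L \<sigma> \<Longrightarrow> tensor_hilbert H K L \<sigma>"
  by (simp add: tensor_hilbert_def tensor_hilbert_axioms_def hilbert_tensor_def)

section \<open>Injective tensor products\<close>

locale tensor_cstar = A: cstar_algebra A + B: cstar_algebra B + T: cstar_algebra T
  for A :: "'a cstar" and B :: "'b cstar" and T :: "'c cstar" and \<tau> :: "'a \<Rightarrow> 'b \<Rightarrow> 'c" +
  assumes tensor: "injective_tensor A B T \<tau>"
begin

lemma bilinear: "bilinear_on A B T \<tau>"
  using tensor by (simp add: injective_tensor_def)

lemmas linear_right = bilinear_onD(1)[OF bilinear]
  and linear_left = bilinear_onD(2)[OF bilinear]
  and closed [simp, intro] = bilinear_onD(3)[OF bilinear]

lemma mult_tensor: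
  "\<lbrakk>a \<in> carrier A; a' \<in> carrier A; b \<in> carrier B; b' \<in> carrier B\<rbrakk> \<Longrightarrow>
    \<tau> a b \<otimes>\<^bsub>T\<^esub> \<tau> a' b' = \<tau> (a \<otimes>\<^bsub>A\<^esub> a') (b \<otimes>\<^bsub>B\<^esub> b')"
  using tensor unfolding injective_tensor_def by blast

lemma star_tensor:
  "\<lbrakk>a \<in> carrier A; b \<in> carrier B\<rbrakk> \<Longrightarrow> star T (\<tau> a b) = \<tau> (star A a) (star B b)"
  using tensor unfolding injective_tensor_def by blast

lemma total: "T.dense (finite_sums T (carrier A \<times> carrier B) (\<lambda>(a, b). \<tau> a b))"
  using tensor unfolding injective_tensor_def T.cdense_iff finite_sums_Times by blast

lemma spatial_norm_le:
  assumes "\<And>i. i < m \<Longrightarrow> a i \<in> carrier A \<and> b i \<in> carrier B" "x \<in> spatial_norms A B m a b"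
  shows "x \<le> cnorm T (\<Oplus>\<^bsub>T\<^esub>i\<in>{..<m}. \<tau> (a i) (b i))"
proof -
  have "isLub UNIV (spatial_norms A B m a b) (cnorm T (\<Oplus>\<^bsub>T\<^esub>i\<in>{..<m}. \<tau> (a i) (b i)))"
    using tensor assms(1) unfolding injective_tensor_def by blast
  then show ?thesis using assms(2) by (auto simp: isLub_def leastP_def isUb_def setle_def)
qed

text \<open>\<open>x\<close> acts on the left factor although x \<otimes> 1 need not be an element
  of \<open>T\<close>. The map x \<mapsto> N (\<tau> (x y) b) satisfies the GNS identity with vector
  \<open>N (\<tau> y b)\<close>, so automatic boundedness applies.\<close>

lemma mult_right_bounded:
  assumes gns: "gns_map T L N \<Xi>" and x: "x \<in> carrier A" and y: "y \<in> carrier A" and b: "b \<in> carrier B"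
  shows "hnorm L (N (\<tau> (x \<otimes>\<^bsub>A\<^esub> y) b)) \<le> cnorm A x * hnorm L (N (\<tau> y b))"
proof -
  interpret N: gns_map T L N \<Xi> by fact
  show ?thesis
  proof (rule gns_contractive[OF A.cstar_algebra_axioms N.H.hilbert_space_axioms _ _ _ x])
    show "linear_on A L (\<lambda>x. N (\<tau> (x \<otimes>\<^bsub>A\<^esub> y) b))"
      using y b by (intro linear_onI)
        (auto simp: A.mult_l_distr A.smult_mult_l linear_onD[OF linear_left] linear_onD[OF N.linear])
    show "N (\<tau> y b) \<in> carrier L" using y b by auto
    show "iprod L (N (\<tau> (c \<otimes>\<^bsub>A\<^esub> y) b)) (N (\<tau> (d \<otimes>\<^bsub>A\<^esub> y) b))
        = iprod L (N (\<tau> (star A d \<otimes>\<^bsub>A\<^esub> c \<otimes>\<^bsub>A\<^esub> y) b)) (N (\<tau> y b))"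
      if "c \<in> carrier A" "d \<in> carrier A" for c d
      using that y b by (simp add: N.gns star_tensor mult_tensor A.star_mult A.mult_assoc)
  qed
qed

end

lemma tensor_cstarI: "injective_tensor A B T \<tau> \<Longrightarrow> tensor_cstar A B T \<tau>"
  by (simp add: tensor_cstar_def tensor_cstar_axioms_def injective_tensor_def)

text \<open>Isometries preserve every entry of the Gram sums, so the map on sums of elementary
  tensors is norm-preserving and extends with constant 1.\<close>

lemma op_tensor_exists:
  assumes HK: "hilbert_tensor H K L \<sigma>" and HK': "hilbert_tensor H' K' L' \<sigma>'"
    and X: "isometry_op H H' X" and Y: "isometry_op K K' Y"
  obtains F where "op_tensor H K L \<sigma> L' \<sigma>' X Y F"
proof -
  interpret T: tensor_hilbert H K L \<sigma> using HK by (rule tensor_hilbertI)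
  interpret T': tensor_hilbert H' K' L' \<sigma>' using HK' by (rule tensor_hilbertI)
  have lX: "linear_on H H' X" and lY: "linear_on K K' Y"
    using X Y by (auto simp: isometry_op_def)
  note c = linear_onD(1)[OF lX] linear_onD(1)[OF lY]
  obtain F where F: "linear_on L L' F" "\<And>v. v \<in> carrier L \<Longrightarrow> hnorm L' (F v) \<le> 1 * hnorm L v"
    "\<And>p. p \<in> carrier H \<times> carrier K \<Longrightarrow> F ((\<lambda>(h, k). \<sigma> h k) p) = (\<lambda>(h, k). \<sigma>' (X h) (Y k)) p"
  proof (rule linear_bounded_extension_total[OF T.L.normed_module T'.L.normed_module T'.L.complete _ _ _ T.total,
        where e' = "\<lambda>(h, k). \<sigma>' (X h) (Y k)" and C = 1])
    fix c' p assume "p \<in> carrier H \<times> carrier K"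
    \<comment> \<open>The scalar is absorbed into the first factor.\<close>
    then show "\<exists>j\<in>carrier H \<times> carrier K.
        (\<lambda>(h, k). \<sigma> h k) j = c' \<odot>\<^bsub>L\<^esub> (\<lambda>(h, k). \<sigma> h k) p \<and>
        (\<lambda>(h, k). \<sigma>' (X h) (Y k)) j = c' \<odot>\<^bsub>L'\<^esub> (\<lambda>(h, k). \<sigma>' (X h) (Y k)) p"
      using c by (intro bexI[of _ "(c' \<odot>\<^bsub>H\<^esub> fst p, snd p)"])
        (auto simp: linear_onD[OF T.linear_left] linear_onD[OF T'.linear_left] linear_onD[OF lX])
  next
    fix n :: nat and p assume p: "\<forall>i<n. p i \<in> carrier H \<times> carrier K"
    define h k where "h i = fst (p i)" and "k i = snd (p i)" for i
    have hk: "p i = (h i, k i)" for i by (simp add: h_def k_def)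
    have hc: "h i \<in> carrier H" "k i \<in> carrier K" if "i < n" for i using p that by (auto simp: hk)
    have "alg_tensor_norm H' K' {..<n} (\<lambda>i. X (h i)) (\<lambda>i. Y (k i)) = alg_tensor_norm H K {..<n} h k"
      unfolding alg_tensor_norm_def
      using hc by (simp add: isometry_iprod[OF T.H.hilbert_space_axioms T'.H.hilbert_space_axioms X]
          isometry_iprod[OF T.K.hilbert_space_axioms T'.K.hilbert_space_axioms Y])
    then have "hnorm L' (\<Oplus>\<^bsub>L'\<^esub>i\<in>{..<n}. \<sigma>' (X (h i)) (Y (k i))) = hnorm L (\<Oplus>\<^bsub>L\<^esub>i\<in>{..<n}. \<sigma> (h i) (k i))"
      using T.hnorm_sum_tensor[of n h k] T'.hnorm_sum_tensor[of n "\<lambda>i. X (h i)" "\<lambda>i. Y (k i)"] hc c by auto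
    then show "hnorm L' (\<Oplus>\<^bsub>L'\<^esub>i\<in>{..<n}. (\<lambda>(h, k). \<sigma>' (X h) (Y k)) (p i))
        \<le> 1 * hnorm L (\<Oplus>\<^bsub>L\<^esub>i\<in>{..<n}. (\<lambda>(h, k). \<sigma> h k) (p i))"
      by (simp add: hk)
  qed (use c in auto)
  have "op_tensor H K L \<sigma> L' \<sigma>' X Y F"
    unfolding op_tensor_def bounded_op_def
  proof (intro conjI ballI)
    show "F (\<sigma> h k) = \<sigma>' (X h) (Y k)" if "h \<in> carrier H" "k \<in> carrier K" for h k
      using F(3)[of "(h, k)"] that by simp
    show "\<exists>C. \<forall>x\<in>carrier L. hnorm L' (F x) \<le> C * hnorm L x" using F(2) by blast
  qed (rule F(1))
  then show thesis by (rule that)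
qed

section \<open>The GNS map of a tensor product\<close>

lemma sum_Times_lessThan_1: "(\<Sum>p\<in>{..<m::nat} \<times> {..<1::nat}. f p) = (\<Sum>i<m. f (i, 0))"
  using sum.cartesian_product[of "\<lambda>i j. f (i, j)" "{..<1::nat}" "{..<m}"] by simp

text \<open>With the representations \<open>\<pi>\<close> and \<open>\<rho>\<close> built from the
  GNS maps, the sum of the \<Lambda> (a i) \<otimes> M (b i) corresponds to the image of \<zeta>
  \<otimes> \<eta> under the operator of the sum of the a i \<otimes> b i. A multiple of its norm is
  thus a member of \<open>spatial_norms\<close>. The GNS identity holds on elementary tensors
  because it holds in both factors, and density extends it.\<close>

lemma tensor_gns_map:
  fixes A :: "'a cstar" and B :: "'b cstar"
  assumes gnsA: "gns_map A H \<Lambda> \<zeta>" and gnsB: "gns_map B K M \<eta>"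
    and AB: "injective_tensor A B T \<tau>" and HK: "hilbert_tensor H K L \<sigma>"
  obtains N where "gns_map T L N (\<sigma> \<zeta> \<eta>)"
    "\<And>a b. \<lbrakk>a \<in> carrier A; b \<in> carrier B\<rbrakk> \<Longrightarrow> N (\<tau> a b) = \<sigma> (\<Lambda> a) (M b)"
proof -
  interpret \<Lambda>: gns_map A H \<Lambda> \<zeta> by fact
  interpret M: gns_map B K M \<eta> by fact
  interpret C: tensor_cstar A B T \<tau> using AB by (rule tensor_cstarI)
  interpret S: tensor_hilbert H K L \<sigma> using HK by (rule tensor_hilbertI)
  obtain H' :: "('a \<Rightarrow> complex) hilb" and \<Lambda>' \<zeta>'
    where gnsA': "gns_map A H' \<Lambda>' \<zeta>'" and \<zeta>': "hnorm H' \<zeta>' = hnorm H \<zeta>"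
      and \<Lambda>': "\<And>a b. \<lbrakk>a \<in> carrier A; b \<in> carrier A\<rbrakk> \<Longrightarrow> iprod H' (\<Lambda>' a) (\<Lambda>' b) = iprod H (\<Lambda> a) (\<Lambda> b)"
    using \<Lambda>.transport by blast
  obtain K' :: "('b \<Rightarrow> complex) hilb" and M' \<eta>'
    where gnsB': "gns_map B K' M' \<eta>'" and \<eta>': "hnorm K' \<eta>' = hnorm K \<eta>"
      and M': "\<And>a b. \<lbrakk>a \<in> carrier B; b \<in> carrier B\<rbrakk> \<Longrightarrow> iprod K' (M' a) (M' b) = iprod K (M a) (M b)"
    using M.transport by blast
  interpret \<Lambda>': gns_map A H' \<Lambda>' \<zeta>' by fact
  interpret M': gns_map B K' M' \<eta>' by fact
  obtain \<pi> where \<pi>: "representation A H' \<pi>" "\<And>a. a \<in> carrier A \<Longrightarrow> \<pi> a \<zeta>' = \<Lambda>' a"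
    using \<Lambda>'.exists_representation by blast
  obtain \<rho> where \<rho>: "representation B K' \<rho>" "\<And>b. b \<in> carrier B \<Longrightarrow> \<rho> b \<eta>' = M' b"
    using M'.exists_representation by blast
  \<comment> \<open>The test vector r (\<zeta> \<otimes> \<eta>) must have norm at most 1; the
    summand 1 avoids a division by zero when \<zeta> or \<eta> vanishes.\<close>
  define r where "r = 1 / (hnorm H \<zeta> * hnorm K \<eta> + 1)"
  have nn: "0 \<le> hnorm H \<zeta> * hnorm K \<eta>"
    using \<Lambda>.cyclic_closed M.cyclic_closed by (simp add: \<Lambda>.H.hnorm_nonneg M.H.hnorm_nonneg)
  then have r: "0 < r" "r * (hnorm H \<zeta> * hnorm K \<eta>) \<le> 1" by (auto simp: r_def)
  have bound: "r * hnorm L (\<Oplus>\<^bsub>L\<^esub>i\<in>{..<m}. \<sigma> (\<Lambda> (a i)) (M (b i))) \<le> cnorm T (\<Oplus>\<^bsub>T\<^esub>i\<in>{..<m}. \<tau> (a i) (b i))"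
    if ab: "\<And>i. i < m \<Longrightarrow> a i \<in> carrier A \<and> b i \<in> carrier B" for m :: nat and a b
  proof (rule C.spatial_norm_le)
    show "a i \<in> carrier A \<and> b i \<in> carrier B" if "i < m" for i using that by (rule ab)
    \<comment> \<open>A single elementary tensor, the case n = 1 in \<open>spatial_norms\<close>,
      with the scalar put into its first factor.\<close>
    define h where "h = (\<lambda>j::nat. complex_of_real r \<odot>\<^bsub>H'\<^esub> \<zeta>')"
    define k where "k = (\<lambda>j::nat. \<eta>')"
    let ?n = "alg_tensor_norm H' K' ({..<m} \<times> {..<1}) (\<lambda>(i, j). \<pi> (a i) (h j)) (\<lambda>(i, j). \<rho> (b i) (k j))"
    have "alg_tensor_norm H' K' {..<1} h k = hnorm H' (h 0) * hnorm K' (k 0)"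
      using \<Lambda>'.cyclic_closed M'.cyclic_closed
      by (simp add: alg_tensor_norm_def h_def k_def \<Lambda>'.H.iprod_self M'.H.iprod_self real_sqrt_mult
          \<Lambda>'.H.hnorm_nonneg M'.H.hnorm_nonneg)
    also have "\<dots> \<le> 1"
      using \<Lambda>'.cyclic_closed r by (simp add: h_def k_def \<Lambda>'.H.hnorm_smult \<zeta>' \<eta>' mult.assoc)
    finally have "alg_tensor_norm H' K' {..<1} h k \<le> 1" .
    then have "?n \<in> spatial_norms A B m a b"
      unfolding spatial_norms_def using \<pi>(1) \<rho>(1) \<Lambda>'.cyclic_closed M'.cyclic_closed
      by (intro CollectI exI[of _ H'] exI[of _ \<pi>] exI[of _ K'] exI[of _ \<rho>] exI[of _ 1] exI[of _ h] exI[of _ k])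
        (simp add: h_def k_def)
    also have "?n = r * alg_tensor_norm H K {..<m} (\<lambda>i. \<Lambda> (a i)) (\<lambda>i. M (b i))"
    proof -
      have lin: "linear_on H' H' (\<pi> (a i))" if "i < m" for i
        using \<pi>(1) ab[OF that] by (simp add: representation_def bounded_op_def)
      have "iprod H' (\<pi> (a i) (h 0)) (\<pi> (a j) (h 0)) * iprod K' (\<rho> (b i) (k 0)) (\<rho> (b j) (k 0))
          = complex_of_real (r\<^sup>2) * (iprod H (\<Lambda> (a i)) (\<Lambda> (a j)) * iprod K (M (b i)) (M (b j)))"
        if "i < m" "j < m" for i j
        using ab[OF that(1)] ab[OF that(2)] \<Lambda>'.cyclic_closed linear_onD(3)[OF lin[OF that(1)]] linear_onD(3)[OF lin[OF that(2)]]
        by (simp add: h_def k_def \<pi>(2) \<rho>(2) \<Lambda>' M' \<Lambda>'.H.iprod_smult \<Lambda>'.H.iprod_smult_right power2_eq_square)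
      then have "(\<Sum>i<m. \<Sum>j<m. iprod H' (\<pi> (a i) (h 0)) (\<pi> (a j) (h 0)) * iprod K' (\<rho> (b i) (k 0)) (\<rho> (b j) (k 0)))
          = complex_of_real (r\<^sup>2) * (\<Sum>i<m. \<Sum>j<m. iprod H (\<Lambda> (a i)) (\<Lambda> (a j)) * iprod K (M (b i)) (M (b j)))"
        by (simp add: sum_distrib_left)
      then show ?thesis
        using r unfolding alg_tensor_norm_def sum_Times_lessThan_1
        by (simp add: real_sqrt_mult Re_complex_of_real del: of_real_power)
    qed
    also have "alg_tensor_norm H K {..<m} (\<lambda>i. \<Lambda> (a i)) (\<lambda>i. M (b i)) = hnorm L (\<Oplus>\<^bsub>L\<^esub>i\<in>{..<m}. \<sigma> (\<Lambda> (a i)) (M (b i)))"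
      using ab by (intro S.hnorm_sum_tensor[symmetric]) auto
    finally show "r * hnorm L (\<Oplus>\<^bsub>L\<^esub>i\<in>{..<m}. \<sigma> (\<Lambda> (a i)) (M (b i))) \<in> spatial_norms A B m a b" .
  qed
  obtain N where lin: "linear_on T L N"
    and bd: "\<And>x. x \<in> carrier T \<Longrightarrow> hnorm L (N x) \<le> (1 / r) * cnorm T x"
    and N': "\<And>p. p \<in> carrier A \<times> carrier B \<Longrightarrow> N ((\<lambda>(a, b). \<tau> a b) p) = (\<lambda>(a, b). \<sigma> (\<Lambda> a) (M b)) p"
  proof (rule linear_bounded_extension_total[OF C.T.normed_module S.L.normed_module S.L.complete _ _ _ C.total,
        where e' = "\<lambda>(a, b). \<sigma> (\<Lambda> a) (M b)" and C = "1 / r"])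
    fix c p assume "p \<in> carrier A \<times> carrier B"
    then show "\<exists>j\<in>carrier A \<times> carrier B.
        (\<lambda>(a, b). \<tau> a b) j = c \<odot>\<^bsub>T\<^esub> (\<lambda>(a, b). \<tau> a b) p \<and>
        (\<lambda>(a, b). \<sigma> (\<Lambda> a) (M b)) j = c \<odot>\<^bsub>L\<^esub> (\<lambda>(a, b). \<sigma> (\<Lambda> a) (M b)) p"
      by (intro bexI[of _ "(c \<odot>\<^bsub>A\<^esub> fst p, snd p)"])
        (auto simp: linear_onD[OF C.linear_left] linear_onD[OF S.linear_left] linear_onD[OF \<Lambda>.linear])
  next
    fix n :: nat and p assume p: "\<forall>i<n. p i \<in> carrier A \<times> carrier B"
    define a b where "a i = fst (p i)" and "b i = snd (p i)" for i
    have ab: "p i = (a i, b i)" for i by (simp add: a_def b_def)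
    have "r * hnorm L (\<Oplus>\<^bsub>L\<^esub>i\<in>{..<n}. \<sigma> (\<Lambda> (a i)) (M (b i))) \<le> cnorm T (\<Oplus>\<^bsub>T\<^esub>i\<in>{..<n}. \<tau> (a i) (b i))"
      using p by (intro bound) (auto simp: ab)
    then show "hnorm L (\<Oplus>\<^bsub>L\<^esub>i\<in>{..<n}. (\<lambda>(a, b). \<sigma> (\<Lambda> a) (M b)) (p i))
        \<le> (1 / r) * cnorm T (\<Oplus>\<^bsub>T\<^esub>i\<in>{..<n}. (\<lambda>(a, b). \<tau> a b) (p i))"
      using r by (simp add: ab field_simps)
  qed (use r in auto)
  have N: "N (\<tau> a b) = \<sigma> (\<Lambda> a) (M b)" if "a \<in> carrier A" "b \<in> carrier B" for a b
    using N'[of "(a, b)"] that by simp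
  have Nc [simp]: "N x \<in> carrier L" if "x \<in> carrier T" for x using lin that by (rule linear_onD)
  have \<Xi>: "\<sigma> \<zeta> \<eta> \<in> carrier L" using \<Lambda>.cyclic_closed M.cyclic_closed by simp
  have bd2: "cmod (iprod L (N x) v) \<le> (1 / r * hnorm L v) * cnorm T x" if "x \<in> carrier T" "v \<in> carrier L" for x v
    using S.L.Cauchy_Schwarz[of "N x" v] mult_right_mono[OF bd[OF that(1)] S.L.hnorm_nonneg[OF that(2)]] that
    by (simp add: mult.commute mult.left_commute)
  \<comment> \<open>The first slot is arbitrary and the second an elementary tensor;
    \<open>gns\<close> then frees the second slot.\<close>
  have gns1: "iprod L (N x) (N (\<tau> c d)) = iprod L (N (star T (\<tau> c d) \<otimes>\<^bsub>T\<^esub> x)) (\<sigma> \<zeta> \<eta>)"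
    if x: "x \<in> carrier T" and cd: "c \<in> carrier A" "d \<in> carrier B" for x c d
  proof (rule functional_bounded_agree_total[OF C.T.normed_module _ _ _ _ C.total _ _ x])
    let ?y = "star T (\<tau> c d)"
    have y: "?y \<in> carrier T" using cd by simp
    show "linear_functional T (\<lambda>x. iprod L (N x) (N (\<tau> c d)))"
      by (rule linear_functional_comp[OF lin S.L.linear_functional_iprod_left]) (use cd in simp)
    show "cmod (iprod L (N x) (N (\<tau> c d))) \<le> (1 / r * hnorm L (N (\<tau> c d))) * cnorm T x"
      if "x \<in> carrier T" for x using cd that by (intro bd2) auto
    show "linear_functional T (\<lambda>x. iprod L (N (?y \<otimes>\<^bsub>T\<^esub> x)) (\<sigma> \<zeta> \<eta>))"
    proof (rule linear_functional_comp[OF _ S.L.linear_functional_iprod_left[OF \<Xi>]])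
      show "linear_on T L (\<lambda>x. N (?y \<otimes>\<^bsub>T\<^esub> x))"
        using y by (intro linear_onI) (auto simp: C.T.mult_r_distr C.T.smult_mult_r linear_onD[OF lin])
    qed
    show "cmod (iprod L (N (?y \<otimes>\<^bsub>T\<^esub> x)) (\<sigma> \<zeta> \<eta>)) \<le> (1 / r * hnorm L (\<sigma> \<zeta> \<eta>) * cnorm T ?y) * cnorm T x"
      if x: "x \<in> carrier T" for x
    proof -
      have "cmod (iprod L (N (?y \<otimes>\<^bsub>T\<^esub> x)) (\<sigma> \<zeta> \<eta>)) \<le> (1 / r * hnorm L (\<sigma> \<zeta> \<eta>)) * cnorm T (?y \<otimes>\<^bsub>T\<^esub> x)"
        using x y \<Xi> by (intro bd2) auto
      also have "\<dots> \<le> (1 / r * hnorm L (\<sigma> \<zeta> \<eta>)) * (cnorm T ?y * cnorm T x)"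
        using x y \<Xi> r by (intro mult_left_mono C.T.cnorm_mult) (auto simp: S.L.hnorm_nonneg)
      finally show ?thesis by (simp add: mult.assoc)
    qed
    fix p assume "p \<in> carrier A \<times> carrier B"
    then show "iprod L (N ((\<lambda>(a, b). \<tau> a b) p)) (N (\<tau> c d)) = iprod L (N (?y \<otimes>\<^bsub>T\<^esub> (\<lambda>(a, b). \<tau> a b) p)) (\<sigma> \<zeta> \<eta>)"
      using cd \<Lambda>.cyclic_closed M.cyclic_closed
      by (auto simp: C.star_tensor C.mult_tensor N S.iprod_tensor \<Lambda>.gns M.gns)
  qed auto
  \<comment> \<open>Both inner products are conjugate-linear in \<open>y\<close>; conjugation makes
    them linear functionals.\<close>
  have gns: "cnj (iprod L (N x) (N y)) = cnj (iprod L (N (star T y \<otimes>\<^bsub>T\<^esub> x)) (\<sigma> \<zeta> \<eta>))"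
    if x: "x \<in> carrier T" and y: "y \<in> carrier T" for x y
  proof (rule functional_bounded_agree_total[OF C.T.normed_module _ _ _ _ C.total _ _ y])
    show "linear_functional T (\<lambda>y. cnj (iprod L (N x) (N y)))"
      by (rule linear_functional_comp[OF lin S.L.linear_functional_iprod_right]) (use x in simp)
    show "cmod (cnj (iprod L (N x) (N y))) \<le> (1 / r * hnorm L (N x)) * cnorm T y" if "y \<in> carrier T" for y
      using bd2[OF that, of "N x"] S.L.iprod_cnj[of "N x" "N y"] x that by simp
    show "linear_functional T (\<lambda>y. cnj (iprod L (N (star T y \<otimes>\<^bsub>T\<^esub> x)) (\<sigma> \<zeta> \<eta>)))"
      using x \<Xi> by (simp add: linear_functional_def C.T.star_add C.T.star_smult C.T.mult_l_distr
          C.T.smult_mult_l linear_onD[OF lin] S.L.iprod_add S.L.iprod_smult)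
    show "cmod (cnj (iprod L (N (star T y \<otimes>\<^bsub>T\<^esub> x)) (\<sigma> \<zeta> \<eta>))) \<le> (1 / r * hnorm L (\<sigma> \<zeta> \<eta>) * cnorm T x) * cnorm T y"
      if y: "y \<in> carrier T" for y
    proof -
      have "cmod (iprod L (N (star T y \<otimes>\<^bsub>T\<^esub> x)) (\<sigma> \<zeta> \<eta>)) \<le> (1 / r * hnorm L (\<sigma> \<zeta> \<eta>)) * cnorm T (star T y \<otimes>\<^bsub>T\<^esub> x)"
        using x y \<Xi> by (intro bd2) auto
      also have "\<dots> \<le> (1 / r * hnorm L (\<sigma> \<zeta> \<eta>)) * (cnorm T (star T y) * cnorm T x)"
        using x y \<Xi> r by (intro mult_left_mono C.T.cnorm_mult) (auto simp: S.L.hnorm_nonneg)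
      finally show ?thesis using y by (simp add: C.T.cnorm_star mult.assoc mult.commute mult.left_commute)
    qed
    show "cnj (iprod L (N x) (N ((\<lambda>(a, b). \<tau> a b) p))) = cnj (iprod L (N (star T ((\<lambda>(a, b). \<tau> a b) p) \<otimes>\<^bsub>T\<^esub> x)) (\<sigma> \<zeta> \<eta>))"
      if "p \<in> carrier A \<times> carrier B" for p
      using that gns1[OF x] by auto
  qed auto
  have "gns_map T L N (\<sigma> \<zeta> \<eta>)"
  proof
    show "S.L.dense (N ` carrier T)"
    proof (rule S.L.dense_if_total_approximable[OF S.total])
      show "\<exists>y\<in>N ` carrier T. hnorm L ((\<lambda>(h, k). \<sigma> h k) p \<ominus>\<^bsub>L\<^esub> y) < \<epsilon>"
        if pHK: "p \<in> carrier H \<times> carrier K" and \<epsilon>: "0 < \<epsilon>" for p \<epsilon>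
      proof -
        obtain h k where p: "p = (h, k)" "h \<in> carrier H" "k \<in> carrier K" using pHK by auto
        obtain a b where "a \<in> carrier A" "b \<in> carrier B" "hnorm L (\<sigma> h k \<ominus>\<^bsub>L\<^esub> \<sigma> (\<Lambda> a) (M b)) < \<epsilon>"
          using S.approximable[OF \<Lambda>.dense M.dense p(2,3) \<epsilon>] by auto
        then show ?thesis using p imageI[of "\<tau> a b" "carrier T" N]
          by (intro bexI[of _ "N (\<tau> a b)"]) (auto simp: N)
      qed
      have "N (0 \<odot>\<^bsub>T\<^esub> \<zero>\<^bsub>T\<^esub>) = 0 \<odot>\<^bsub>L\<^esub> N \<zero>\<^bsub>T\<^esub>" by (rule linear_onD(3)[OF lin]) simp
      then have "N \<zero>\<^bsub>T\<^esub> = \<zero>\<^bsub>L\<^esub>" by simp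
      then show "\<zero>\<^bsub>L\<^esub> \<in> N ` carrier T" by (metis C.T.zero_closed imageI)
      show "x \<oplus>\<^bsub>L\<^esub> y \<in> N ` carrier T" if xy: "x \<in> N ` carrier T" "y \<in> N ` carrier T" for x y
      proof -
        obtain u v where "u \<in> carrier T" "v \<in> carrier T" "x = N u" "y = N v" using xy by blast
        then show ?thesis using linear_onD(2)[OF lin, of u v] by (intro image_eqI[of _ _ "u \<oplus>\<^bsub>T\<^esub> v"]) auto
      qed
    qed auto
    show "iprod L (N x) (N y) = iprod L (N (star T y \<otimes>\<^bsub>T\<^esub> x)) (\<sigma> \<zeta> \<eta>)" if "x \<in> carrier T" "y \<in> carrier T" for x y
      using gns[OF that] complex_cnj_cancel_iff by blast
  qed (rule lin \<Xi>)+
  then show thesis using N by (rule that)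
qed

text \<open>
  Agreement on the tensors \<open>\<tau> (e i) c\<close> does not extend to \<open>\<tau> x c\<close> by continuity, as no bound for \<open>\<tau>\<close>
  in \<open>x\<close> is at hand. Instead, \<open>x \<mapsto> N (\<tau> (x y) c)\<close> is bounded for fixed \<open>y\<close> by automatic
  boundedness, and \<open>\<langle>N (\<tau> x c), N (\<tau> y d)\<rangle>\<close> is the conjugate of \<open>\<langle>N (\<tau> (x\<^sup>* y) (c\<^sup>* d)), \<Xi>\<rangle>\<close>.
\<close>

lemma gns_map_tensor_unique:
  assumes N1: "gns_map P L N1 \<Xi>" and N2: "gns_map P L N2 \<Xi>" and TC: "injective_tensor T C P \<tau>"
    and total: "normed_module.dense T (cnorm T) (finite_sums T D e)"
    and e: "\<And>i. i \<in> D \<Longrightarrow> e i \<in> carrier T"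
    and e_mult: "\<And>i j. \<lbrakk>i \<in> D; j \<in> D\<rbrakk> \<Longrightarrow> \<exists>k\<in>D. e i \<otimes>\<^bsub>T\<^esub> e j = e k"
    and eq: "\<And>i c. \<lbrakk>i \<in> D; c \<in> carrier C\<rbrakk> \<Longrightarrow> N1 (\<tau> (e i) c) = N2 (\<tau> (e i) c)"
    and bounded: "\<And>c. c \<in> carrier C \<Longrightarrow> \<exists>K. \<forall>y\<in>carrier T. hnorm L (N1 (\<tau> y c)) \<le> K * cnorm T y"
    and p: "p \<in> carrier P"
  shows "N1 p = N2 p"
proof -
  interpret N1: gns_map P L N1 \<Xi> by fact
  interpret N2: gns_map P L N2 \<Xi> by fact
  interpret S: tensor_cstar T C P \<tau> using TC by (rule tensor_cstarI)
  have prods: "N1 (\<tau> (x \<otimes>\<^bsub>T\<^esub> e i) c) = N2 (\<tau> (x \<otimes>\<^bsub>T\<^esub> e i) c)"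
    if i: "i \<in> D" and c: "c \<in> carrier C" and x: "x \<in> carrier T" for i c x
  proof (rule linear_bounded_agree_total[OF S.A.normed_module N1.H.normed_module _ _ _ _ total _ _ x])
    have lin: "linear_on T P (\<lambda>x. \<tau> (x \<otimes>\<^bsub>T\<^esub> e i) c)"
      using i c e by (intro linear_onI)
        (auto simp: S.A.mult_l_distr S.A.smult_mult_l linear_onD[OF S.linear_left])
    show "linear_on T L (\<lambda>x. N1 (\<tau> (x \<otimes>\<^bsub>T\<^esub> e i) c))" by (rule linear_on_comp[OF lin N1.linear])
    show "linear_on T L (\<lambda>x. N2 (\<tau> (x \<otimes>\<^bsub>T\<^esub> e i) c))" by (rule linear_on_comp[OF lin N2.linear])
    show "hnorm L (N1 (\<tau> (x \<otimes>\<^bsub>T\<^esub> e i) c)) \<le> hnorm L (N1 (\<tau> (e i) c)) * cnorm T x" if "x \<in> carrier T" for x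
      using S.mult_right_bounded[OF N1 that e[OF i] c] by (simp add: mult.commute)
    show "hnorm L (N2 (\<tau> (x \<otimes>\<^bsub>T\<^esub> e i) c)) \<le> hnorm L (N2 (\<tau> (e i) c)) * cnorm T x" if "x \<in> carrier T" for x
      using S.mult_right_bounded[OF N2 that e[OF i] c] by (simp add: mult.commute)
    \<comment> \<open>A product of two members of the total family is again a member, so
      \<open>eq\<close> applies.\<close>
    show "N1 (\<tau> (e j \<otimes>\<^bsub>T\<^esub> e i) c) = N2 (\<tau> (e j \<otimes>\<^bsub>T\<^esub> e i) c)" if "j \<in> D" for j
      using e_mult[OF that i] eq c by auto
  qed (use e in auto)
  have elem: "N1 (\<tau> x c) = N2 (\<tau> x c)" if x: "x \<in> carrier T" and c: "c \<in> carrier C" for x c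
  proof -
    \<comment> \<open>\<open>u\<close> is shown to be orthogonal to N1 (\<tau> (e i) d), then to N1
      (\<tau> y d), where the bound for \<open>N1\<close> enters, and finally to the whole range of
      \<open>N1\<close>.\<close>
    define u where "u = N1 (\<tau> x c) \<ominus>\<^bsub>L\<^esub> N2 (\<tau> x c)"
    have u: "u \<in> carrier L" using x c by (simp add: u_def)
    have flip: "iprod L (N (\<tau> x c)) (N (\<tau> (e i) d)) = cnj (iprod L (N (\<tau> (star T x \<otimes>\<^bsub>T\<^esub> e i) (star C c \<otimes>\<^bsub>C\<^esub> d))) \<Xi>)"
      if "gns_map P L N \<Xi>" "i \<in> D" "d \<in> carrier C" for N i d
    proof -
      interpret N: gns_map P L N \<Xi> by fact
      have "iprod L (N (\<tau> x c)) (N (\<tau> (e i) d)) = cnj (iprod L (N (\<tau> (e i) d)) (N (\<tau> x c)))"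
        using that x c e by (intro N1.H.iprod_cnj) auto
      then show ?thesis using that x c e by (simp add: N.gns S.star_tensor S.mult_tensor)
    qed
    have 1: "iprod L u (N1 (\<tau> (e i) d)) = 0" if i: "i \<in> D" and d: "d \<in> carrier C" for i d
    proof -
      \<comment> \<open>\<open>eq\<close> exchanges \<open>N1\<close> for \<open>N2\<close> in the
        second slot; \<open>flip\<close> and \<open>prods\<close> then exchange both slots at
        once.\<close>
      have "iprod L (N2 (\<tau> x c)) (N1 (\<tau> (e i) d)) = iprod L (N2 (\<tau> x c)) (N2 (\<tau> (e i) d))"
        using eq[OF i d] by simp
      also have "\<dots> = iprod L (N1 (\<tau> x c)) (N1 (\<tau> (e i) d))"
        using flip[OF N1 i d] flip[OF N2 i d] prods[OF i, of "star C c \<otimes>\<^bsub>C\<^esub> d" "star T x"] x c d by simp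
      finally show ?thesis using x c d i e by (simp add: u_def N1.H.iprod_diff)
    qed
    have 2: "cnj (iprod L u (N1 (\<tau> y d))) = 0" if y: "y \<in> carrier T" and d: "d \<in> carrier C" for y d
    proof -
      obtain K where K: "\<And>y. y \<in> carrier T \<Longrightarrow> hnorm L (N1 (\<tau> y d)) \<le> K * cnorm T y"
        using bounded[OF d] by blast
      show ?thesis
      proof (rule functional_bounded_agree_total[OF S.A.normed_module _ _ _ _ total _ _ y])
        show "linear_functional T (\<lambda>y. cnj (iprod L u (N1 (\<tau> y d))))"
          by (rule linear_functional_comp[OF linear_on_comp[OF S.linear_left[OF d] N1.linear] N1.H.linear_functional_iprod_right[OF u]])
        show "cmod (cnj (iprod L u (N1 (\<tau> y d)))) \<le> (hnorm L u * K) * cnorm T y" if "y \<in> carrier T" for y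
          using N1.H.Cauchy_Schwarz[OF u, of "N1 (\<tau> y d)"] mult_left_mono[OF K[OF that] N1.H.hnorm_nonneg[OF u]] that d
          by (simp add: mult.assoc)
        show "linear_functional T (\<lambda>_. 0)" by (simp add: linear_functional_def)
        show "cmod 0 \<le> 0 * cnorm T y" if "y \<in> carrier T" for y by simp
        show "cnj (iprod L u (N1 (\<tau> (e i) d))) = 0" if "i \<in> D" for i using 1[OF that d] by simp
      qed (rule e)
    qed
    have 3: "cnj (iprod L u (N1 q)) = 0" if q: "q \<in> carrier P" for q
    proof (rule functional_bounded_agree_total[OF N1.A.normed_module _ _ _ _ S.total _ _ q])
      show "linear_functional P (\<lambda>q. cnj (iprod L u (N1 q)))"
        by (rule linear_functional_comp[OF N1.linear N1.H.linear_functional_iprod_right[OF u]])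
      show "cmod (cnj (iprod L u (N1 q))) \<le> (hnorm L u * hnorm L \<Xi>) * cnorm P q" if "q \<in> carrier P" for q
        using N1.H.Cauchy_Schwarz[OF u, of "N1 q"] mult_left_mono[OF N1.bounded[OF that] N1.H.hnorm_nonneg[OF u]] that
        by (simp add: mult.assoc)
      show "linear_functional P (\<lambda>_. 0)" by (simp add: linear_functional_def)
      show "cmod 0 \<le> 0 * cnorm P q" if "q \<in> carrier P" for q by simp
      show "cnj (iprod L u (N1 ((\<lambda>(x, y). \<tau> x y) i))) = 0" if "i \<in> carrier T \<times> carrier C" for i
        using that 2 by auto
    qed auto
    have "u = \<zero>\<^bsub>L\<^esub>"
      by (rule N1.H.orthogonal_dense_imp_zero[OF N1.dense u]) (use 3 in auto)
    then show ?thesis using x c by (simp add: u_def N1.H.diff_eq_zero_iff)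
  qed
  show ?thesis
    by (rule linear_bounded_agree_total[OF N1.A.normed_module N1.H.normed_module N1.linear N1.bounded
          N2.linear N2.bounded S.total _ _ p]) (use elem in auto)
qed

section \<open>The isometries and their intertwining relations\<close>

lemma induced_isometry:
  assumes gns: "gns_map A H \<Lambda> \<xi>" and L: "hilbert_space L" and f: "linear_on A L f"
    and norm: "\<And>a. a \<in> carrier A \<Longrightarrow> hnorm L (f a) = hnorm H (\<Lambda> a)"
  obtains V where "isometry_op H L V" "\<And>a. a \<in> carrier A \<Longrightarrow> V (\<Lambda> a) = f a"
proof -
  interpret \<Lambda>: gns_map A H \<Lambda> \<xi> by fact
  interpret L: hilbert_space L by fact
  have fc: "f a \<in> carrier L" if "a \<in> carrier A" for a using f that by (rule linear_onD)
  \<comment> \<open>Equality of norms makes \<open>R\<close> single-valued: \<open>f\<close>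
    vanishes wherever \<open>\<Lambda>\<close> does.\<close>
  define R where "R v w \<longleftrightarrow> (\<exists>a\<in>carrier A. v = \<Lambda> a \<and> w = f a)" for v w
  obtain V where V: "linear_on H L V" "\<And>v. v \<in> carrier H \<Longrightarrow> hnorm L (V v) \<le> 1 * hnorm H v"
    "\<And>v w. R v w \<Longrightarrow> V v = w"
  proof (rule linear_bounded_extension[OF \<Lambda>.H.normed_module L.normed_module L.complete, of R 1])
    show "v \<in> carrier H \<and> w \<in> carrier L" if "R v w" for v w using that fc by (auto simp: R_def)
    show "R (v \<oplus>\<^bsub>H\<^esub> v') (w \<oplus>\<^bsub>L\<^esub> w')" if vw: "R v w" "R v' w'" for v w v' w'
    proof -
      obtain a a' where "a \<in> carrier A" "a' \<in> carrier A" "v = \<Lambda> a" "w = f a" "v' = \<Lambda> a'" "w' = f a'"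
        using vw unfolding R_def by blast
      then show ?thesis unfolding R_def
        by (intro bexI[of _ "a \<oplus>\<^bsub>A\<^esub> a'"]) (simp_all add: linear_onD[OF \<Lambda>.linear] linear_onD[OF f])
    qed
    show "R (c \<odot>\<^bsub>H\<^esub> v) (c \<odot>\<^bsub>L\<^esub> w)" if vw: "R v w" for c v w
    proof -
      obtain a where "a \<in> carrier A" "v = \<Lambda> a" "w = f a" using vw unfolding R_def by blast
      then show ?thesis unfolding R_def
        by (intro bexI[of _ "c \<odot>\<^bsub>A\<^esub> a"]) (simp_all add: linear_onD[OF \<Lambda>.linear] linear_onD[OF f])
    qed
    have "{v. \<exists>w. R v w} = \<Lambda> ` carrier A" by (auto simp: R_def)
    then show "\<Lambda>.H.dense {v. \<exists>w. R v w}" using \<Lambda>.dense by simp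
    show "hnorm L w \<le> 1 * hnorm H v" if "R v w" for v w using that norm by (auto simp: R_def)
  next
    fix V assume "linear_on H L V" "\<And>v. v \<in> carrier H \<Longrightarrow> hnorm L (V v) \<le> 1 * hnorm H v" "\<And>v w. R v w \<Longrightarrow> V v = w"
    then show thesis by (rule that)
  qed simp
  have V\<Lambda>: "V (\<Lambda> a) = f a" if "a \<in> carrier A" for a using that by (intro V(3)) (auto simp: R_def)
  have Vc: "V v \<in> carrier L" if "v \<in> carrier H" for v using V(1) that by (rule linear_onD)
  \<comment> \<open>The extension gives only \<le>. The two norms are Lipschitz functions that agree
    on the dense range of \<open>\<Lambda>\<close>, hence everywhere.\<close>
  have "hnorm L (V v) = hnorm H v" if v: "v \<in> carrier H" for v
  proof (rule \<Lambda>.H.dense_agree[OF \<Lambda>.dense _ v])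
    show "hnorm L (V x) = hnorm H x" if "x \<in> \<Lambda> ` carrier A" for x using that V\<Lambda> norm by auto
    show "norm (hnorm L (V x) - hnorm L (V y)) \<le> 1 * hnorm H (x \<ominus>\<^bsub>H\<^esub> y)"
      if "x \<in> carrier H" "y \<in> carrier H" for x y
      using L.abs_N_diff_le[of "V x" "V y"] V(2)[of "x \<ominus>\<^bsub>H\<^esub> y"] Vc that
        linear_on_diff[OF V(1) \<Lambda>.H.complex_module_axioms L.complex_module_axioms that] by simp
    show "norm (hnorm H x - hnorm H y) \<le> 1 * hnorm H (x \<ominus>\<^bsub>H\<^esub> y)"
      if "x \<in> carrier H" "y \<in> carrier H" for x y
      using \<Lambda>.H.abs_N_diff_le[OF that] by simp
  qed
  then have "isometry_op H L V" using V(1) by (simp add: isometry_op_def)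
  then show thesis using V\<Lambda> by (rule that)
qed

text \<open>The squared norm of N (\<Delta> a) is \<omega> at (\<Delta> a)* (\<Delta> a) = \<Delta>
  (a* a), hence \<phi> (a* a) by the co-unit identity, and this is the squared norm of \<Lambda>
  a.\<close>

lemma counit_norm:
  assumes gns: "gns_map A H \<Lambda> \<xi>" and \<phi>: "\<And>a. a \<in> carrier A \<Longrightarrow> \<phi> a = iprod H (\<Lambda> a) \<xi>"
    and gns1: "gns_map A1 H1 \<Lambda>1 \<xi>1" and \<phi>1: "\<And>a. a \<in> carrier A1 \<Longrightarrow> \<phi>1 a = iprod H1 (\<Lambda>1 a) \<xi>1"
    and gns2: "gns_map A2 H2 \<Lambda>2 \<xi>2" and \<phi>2: "\<And>a. a \<in> carrier A2 \<Longrightarrow> \<phi>2 a = iprod H2 (\<Lambda>2 a) \<xi>2"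
    and T: "injective_tensor A1 A2 T \<tau>" and L: "hilbert_tensor H1 H2 L \<sigma>"
    and N: "gns_map T L N (\<sigma> \<xi>1 \<xi>2)"
    and N_tensor: "\<And>a b. \<lbrakk>a \<in> carrier A1; b \<in> carrier A2\<rbrakk> \<Longrightarrow> N (\<tau> a b) = \<sigma> (\<Lambda>1 a) (\<Lambda>2 b)"
    and \<Delta>: "star_hom A T \<Delta>" and \<omega>: "functional_tensor A1 A2 T \<tau> \<phi>1 \<phi>2 \<omega>"
    and counit: "\<And>a. a \<in> carrier A \<Longrightarrow> \<phi> a = \<omega> (\<Delta> a)" and a: "a \<in> carrier A"
  shows "hnorm L (N (\<Delta> a)) = hnorm H (\<Lambda> a)"
proof -
  interpret \<Lambda>: gns_map A H \<Lambda> \<xi> by fact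
  interpret \<Lambda>1: gns_map A1 H1 \<Lambda>1 \<xi>1 by fact
  interpret \<Lambda>2: gns_map A2 H2 \<Lambda>2 \<xi>2 by fact
  interpret N: gns_map T L N "\<sigma> \<xi>1 \<xi>2" by fact
  interpret C: tensor_cstar A1 A2 T \<tau> using T by (rule tensor_cstarI)
  interpret S: tensor_hilbert H1 H2 L \<sigma> using L by (rule tensor_hilbertI)
  obtain K where lin\<omega>: "linear_functional T \<omega>" and K: "\<And>x. x \<in> carrier T \<Longrightarrow> cmod (\<omega> x) \<le> K * cnorm T x"
    and \<omega>\<tau>: "\<And>a b. \<lbrakk>a \<in> carrier A1; b \<in> carrier A2\<rbrakk> \<Longrightarrow> \<omega> (\<tau> a b) = \<phi>1 a * \<phi>2 b"
    using \<omega> unfolding functional_tensor_def by blast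
  \<comment> \<open>A bounded functional is determined by its values on elementary tensors, so
    \<open>\<omega>\<close> is the vector functional of \<open>N\<close> at the tensor of the two
    cyclic vectors.\<close>
  have \<omega>_eq: "\<omega> x = iprod L (N x) (\<sigma> \<xi>1 \<xi>2)" if x: "x \<in> carrier T" for x
  proof (rule functional_bounded_agree_total[OF N.A.normed_module lin\<omega> K _ _ C.total _ _ x])
    show "linear_functional T (\<lambda>x. iprod L (N x) (\<sigma> \<xi>1 \<xi>2))"
      by (rule linear_functional_comp[OF N.linear N.H.linear_functional_iprod_left[OF N.cyclic_closed]])
    show "cmod (iprod L (N x) (\<sigma> \<xi>1 \<xi>2)) \<le> (hnorm L (\<sigma> \<xi>1 \<xi>2) * hnorm L (\<sigma> \<xi>1 \<xi>2)) * cnorm T x"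
      if "x \<in> carrier T" for x
      using N.H.Cauchy_Schwarz[OF N.closed[OF that] N.cyclic_closed]
        mult_right_mono[OF N.bounded[OF that] N.H.hnorm_nonneg[OF N.cyclic_closed]]
      by (simp add: mult.commute mult.left_commute)
    show "\<omega> ((\<lambda>(a, b). \<tau> a b) p) = iprod L (N ((\<lambda>(a, b). \<tau> a b) p)) (\<sigma> \<xi>1 \<xi>2)"
      if "p \<in> carrier A1 \<times> carrier A2" for p
      using that \<Lambda>1.cyclic_closed \<Lambda>2.cyclic_closed
      by (auto simp: \<omega>\<tau> N_tensor S.iprod_tensor \<phi>1 \<phi>2)
  qed auto
  have \<Delta>': "\<Delta> x \<in> carrier T" "\<Delta> (star A x \<otimes>\<^bsub>A\<^esub> x) = star T (\<Delta> x) \<otimes>\<^bsub>T\<^esub> \<Delta> x" if "x \<in> carrier A" for x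
    using \<Delta> that by (auto simp: star_hom_def linear_onD(1))
  have "iprod L (N (\<Delta> a)) (N (\<Delta> a)) = \<omega> (\<Delta> (star A a \<otimes>\<^bsub>A\<^esub> a))"
    using \<Delta>'[OF a] by (simp add: N.gns \<omega>_eq)
  also have "\<dots> = iprod H (\<Lambda> a) (\<Lambda> a)"
    using a counit[of "star A a \<otimes>\<^bsub>A\<^esub> a"] \<phi>[of "star A a \<otimes>\<^bsub>A\<^esub> a"] by (simp add: \<Lambda>.gns)
  finally show ?thesis by (simp add: hnorm_def)
qed

text \<open>Both composites are bounded, and on \<open>\<tau> a b\<close> both give
  \<open>\<sigma>' (\<Lambda>' (f a)) (M' (g b))\<close>. This serves both sides of
  co-associativity, with one of \<open>f\<close>, \<open>g\<close> the identity and the other a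
  comultiplication.\<close>

lemma tensor_intertwine:
  assumes N: "gns_map T L N \<Xi>" and N': "gns_map T' L' N' \<Xi>'"
    and T: "injective_tensor A B T \<tau>"
    and F: "op_tensor H K L \<sigma> L' \<sigma>' X Y F" and E: "hom_tensor A B T \<tau> T' \<tau>' f g E"
    and \<Lambda>: "\<And>a. a \<in> carrier A \<Longrightarrow> \<Lambda> a \<in> carrier H" and M: "\<And>b. b \<in> carrier B \<Longrightarrow> M b \<in> carrier K"
    and f: "\<And>a. a \<in> carrier A \<Longrightarrow> f a \<in> carrier A'" and g: "\<And>b. b \<in> carrier B \<Longrightarrow> g b \<in> carrier B'"
    and N_tensor: "\<And>a b. \<lbrakk>a \<in> carrier A; b \<in> carrier B\<rbrakk> \<Longrightarrow> N (\<tau> a b) = \<sigma> (\<Lambda> a) (M b)"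
    and N'_tensor: "\<And>a b. \<lbrakk>a \<in> carrier A'; b \<in> carrier B'\<rbrakk> \<Longrightarrow> N' (\<tau>' a b) = \<sigma>' (\<Lambda>' a) (M' b)"
    and X: "\<And>a. a \<in> carrier A \<Longrightarrow> X (\<Lambda> a) = \<Lambda>' (f a)" and Y: "\<And>b. b \<in> carrier B \<Longrightarrow> Y (M b) = M' (g b)"
    and x: "x \<in> carrier T"
  shows "F (N x) = N' (E x)"
proof -
  interpret N: gns_map T L N \<Xi> by fact
  interpret N': gns_map T' L' N' \<Xi>' by fact
  interpret C: tensor_cstar A B T \<tau> using T by (rule tensor_cstarI)
  have bF: "bounded_op L L' F" and linF: "linear_on L L' F"
    and F\<sigma>: "\<And>h k. \<lbrakk>h \<in> carrier H; k \<in> carrier K\<rbrakk> \<Longrightarrow> F (\<sigma> h k) = \<sigma>' (X h) (Y k)"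
    using F by (auto simp: op_tensor_def bounded_op_def)
  obtain C1 where C1: "0 \<le> C1" "\<And>v. v \<in> carrier L \<Longrightarrow> hnorm L' (F v) \<le> C1 * hnorm L v"
    using bounded_opE[OF bF N.H.hilbert_space_axioms] by blast
  have linE: "linear_on T T' E" and E\<tau>: "\<And>a b. \<lbrakk>a \<in> carrier A; b \<in> carrier B\<rbrakk> \<Longrightarrow> E (\<tau> a b) = \<tau>' (f a) (g b)"
    using E by (auto simp: hom_tensor_def star_hom_def)
  obtain C2 where C2: "\<And>x. x \<in> carrier T \<Longrightarrow> cnorm T' (E x) \<le> C2 * cnorm T x"
    using E unfolding hom_tensor_def by blast
  show ?thesis
  proof (rule linear_bounded_agree_total[OF N.A.normed_module N'.H.normed_module _ _ _ _ C.total _ _ x])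
    show "linear_on T L' (\<lambda>x. F (N x))" using N.linear linF by (rule linear_on_comp)
    show "linear_on T L' (\<lambda>x. N' (E x))" using linE N'.linear by (rule linear_on_comp)
    show "hnorm L' (F (N x)) \<le> (C1 * hnorm L \<Xi>) * cnorm T x" if x: "x \<in> carrier T" for x
    proof -
      have "hnorm L' (F (N x)) \<le> C1 * hnorm L (N x)" using x by (intro C1) auto
      also have "\<dots> \<le> C1 * (hnorm L \<Xi> * cnorm T x)" using C1(1) x by (intro mult_left_mono N.bounded)
      finally show ?thesis by (simp add: mult.assoc)
    qed
    show "hnorm L' (N' (E x)) \<le> (hnorm L' \<Xi>' * C2) * cnorm T x" if x: "x \<in> carrier T" for x
    proof -
      have "hnorm L' (N' (E x)) \<le> hnorm L' \<Xi>' * cnorm T' (E x)"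
        by (rule N'.bounded) (rule linear_onD(1)[OF linE x])
      also have "\<dots> \<le> hnorm L' \<Xi>' * (C2 * cnorm T x)"
        by (intro mult_left_mono C2 x N'.H.hnorm_nonneg N'.cyclic_closed)
      finally show ?thesis by (simp add: mult.assoc)
    qed
    show "F (N ((\<lambda>(a, b). \<tau> a b) p)) = N' (E ((\<lambda>(a, b). \<tau> a b) p))" if "p \<in> carrier A \<times> carrier B" for p
      using that \<Lambda> M f g by (auto simp: N_tensor F\<sigma> X Y E\<tau> N'_tensor)
  qed auto
qed

lemma isometry_op_id: "isometry_op H H (\<lambda>x. x)"
  by (auto simp: isometry_op_def linear_on_def)

section \<open>Assembly of the subproduct system\<close>

theorem proposition6p4:
  fixes A :: "real \<Rightarrow> real \<Rightarrow> 'a cstar"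
    and T :: "real \<Rightarrow> real \<Rightarrow> real \<Rightarrow> 'b cstar"
    and \<tau> :: "real \<Rightarrow> real \<Rightarrow> real \<Rightarrow> 'a \<Rightarrow> 'a \<Rightarrow> 'b"
    and T3 :: "real \<Rightarrow> real \<Rightarrow> real \<Rightarrow> real \<Rightarrow> 'c cstar"
    and \<tau>l :: "real \<Rightarrow> real \<Rightarrow> real \<Rightarrow> real \<Rightarrow> 'b \<Rightarrow> 'a \<Rightarrow> 'c"
    and \<tau>r :: "real \<Rightarrow> real \<Rightarrow> real \<Rightarrow> real \<Rightarrow> 'a \<Rightarrow> 'b \<Rightarrow> 'c"
    and \<Delta> :: "real \<Rightarrow> real \<Rightarrow> real \<Rightarrow> 'a \<Rightarrow> 'b"
    and \<phi> :: "real \<Rightarrow> real \<Rightarrow> 'a \<Rightarrow> complex"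
    and H :: "real \<Rightarrow> real \<Rightarrow> 'h hilb"
    and \<pi> :: "real \<Rightarrow> real \<Rightarrow> 'a \<Rightarrow> 'h \<Rightarrow> 'h"
    and L :: "real \<Rightarrow> real \<Rightarrow> real \<Rightarrow> 'k hilb"
    and \<sigma> :: "real \<Rightarrow> real \<Rightarrow> real \<Rightarrow> 'h \<Rightarrow> 'h \<Rightarrow> 'k"
    and L3 :: "real \<Rightarrow> real \<Rightarrow> real \<Rightarrow> real \<Rightarrow> 'l hilb"
    and \<sigma>l :: "real \<Rightarrow> real \<Rightarrow> real \<Rightarrow> real \<Rightarrow> 'k \<Rightarrow> 'h \<Rightarrow> 'l"
    and \<sigma>r :: "real \<Rightarrow> real \<Rightarrow> real \<Rightarrow> real \<Rightarrow> 'h \<Rightarrow> 'k \<Rightarrow> 'l"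
  assumes "cstar_tensor_family A T \<tau> T3 \<tau>l \<tau>r"
    and "cstar_subproduct_system A T \<tau> T3 \<tau>l \<tau>r \<Delta>"
    and "counit A T \<tau> \<Delta> \<phi>"
    and "\<And>s t. 0 < s \<Longrightarrow> s < t \<Longrightarrow> gns_representation (A s t) (\<phi> s t) (H s t) (\<pi> s t)"
    and "hilbert_tensor_family H L \<sigma> L3 \<sigma>l \<sigma>r"
  shows "\<exists>V. tsirelson_subproduct_system H L \<sigma> L3 \<sigma>l \<sigma>r V"
proof -
  have inj: "injective_tensor (A r s) (A s t) (T r s t) (\<tau> r s t)" if "0 < r" "r < s" "s < t" for r s t
    using assms(1) that by (simp add: cstar_tensor_family_def)
  have hil: "hilbert_tensor (H r s) (H s t) (L r s t) (\<sigma> r s t)" if "0 < r" "r < s" "s < t" for r s t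
    using assms(5) that by (simp add: hilbert_tensor_family_def)
  have cstar: "cstar_algebra (A s t)" if "0 < s" "s < t" for s t
    using assms(2) that by (simp add: cstar_subproduct_system_def)
  have hom: "star_hom (A r t) (T r s t) (\<Delta> r s t)" if "0 < r" "r < s" "s < t" for r s t
    using assms(2) that by (simp add: cstar_subproduct_system_def star_mono_def)

  \<comment> \<open>Bundling the properties in one predicate lets \<open>\<xi>\<close> be chosen for
    all intervals at once; \<open>Q\<close> and \<open>W\<close> below serve the same end for
    \<open>N\<close> and \<open>V\<close>.\<close>
  define P where "P s t x \<longleftrightarrow> gns_map (A s t) (H s t) (\<lambda>a. \<pi> s t a x) x \<and>
    (\<forall>a\<in>carrier (A s t). \<phi> s t a = iprod (H s t) (\<pi> s t a x) x)" for s t x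
  have "\<exists>x. P s t x" if "0 < s" "s < t" for s t
    using gns_representation_imp_gns_map[OF cstar[OF that] assms(4)[OF that]] unfolding P_def by metis
  then obtain \<xi> where \<xi>: "\<And>s t. 0 < s \<Longrightarrow> s < t \<Longrightarrow> P s t (\<xi> s t)" by metis
  define \<Lambda> where "\<Lambda> s t a = \<pi> s t a (\<xi> s t)" for s t a
  have \<Lambda>: "gns_map (A s t) (H s t) (\<Lambda> s t) (\<xi> s t)" if "0 < s" "s < t" for s t
    using \<xi>[OF that] by (simp add: P_def \<Lambda>_def[abs_def])
  have \<phi>: "\<phi> s t a = iprod (H s t) (\<Lambda> s t a) (\<xi> s t)" if "0 < s" "s < t" "a \<in> carrier (A s t)" for s t a
    using \<xi>[OF that(1,2)] that(3) by (simp add: P_def \<Lambda>_def)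
  have \<Lambda>_closed: "\<Lambda> s t a \<in> carrier (H s t)" if "0 < s" "s < t" "a \<in> carrier (A s t)" for s t a
    using gns_map.closed[OF \<Lambda>] that by blast

  define Q where "Q r s t n \<longleftrightarrow> gns_map (T r s t) (L r s t) n (\<sigma> r s t (\<xi> r s) (\<xi> s t)) \<and>
    (\<forall>a\<in>carrier (A r s). \<forall>b\<in>carrier (A s t). n (\<tau> r s t a b) = \<sigma> r s t (\<Lambda> r s a) (\<Lambda> s t b))" for r s t n
  have "\<exists>n. Q r s t n" if "0 < r" "r < s" "s < t" for r s t
  proof -
    have "0 < s" using that by simp
    then show ?thesis
      using tensor_gns_map[OF \<Lambda>[OF that(1,2)] \<Lambda>[OF _ that(3)] inj[OF that] hil[OF that]] unfolding Q_def by metis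
  qed
  then obtain N where N_Q: "\<And>r s t. 0 < r \<Longrightarrow> r < s \<Longrightarrow> s < t \<Longrightarrow> Q r s t (N r s t)" by metis
  have N: "gns_map (T r s t) (L r s t) (N r s t) (\<sigma> r s t (\<xi> r s) (\<xi> s t))" if "0 < r" "r < s" "s < t" for r s t
    using N_Q[OF that] by (simp add: Q_def)
  have N_tensor: "N r s t (\<tau> r s t a b) = \<sigma> r s t (\<Lambda> r s a) (\<Lambda> s t b)"
    if "0 < r" "r < s" "s < t" "a \<in> carrier (A r s)" "b \<in> carrier (A s t)" for r s t a b
    using N_Q[OF that(1-3)] that(4,5) by (simp add: Q_def)
  have \<Delta>_closed: "\<Delta> r s t a \<in> carrier (T r s t)" if "0 < r" "r < s" "s < t" "a \<in> carrier (A r t)" for r s t a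
    using hom[OF that(1-3)] that(4) by (auto simp: star_hom_def linear_onD(1))

  define W where "W r s t v \<longleftrightarrow> isometry_op (H r t) (L r s t) v \<and>
    (\<forall>a\<in>carrier (A r t). v (\<Lambda> r t a) = N r s t (\<Delta> r s t a))" for r s t v
  have "\<exists>v. W r s t v" if rst: "0 < r" "r < s" "s < t" for r s t
  proof -
    have pos: "0 < s" "r < t" using rst by simp_all
    interpret N: gns_map "T r s t" "L r s t" "N r s t" "\<sigma> r s t (\<xi> r s) (\<xi> s t)" by (rule N[OF rst])
    obtain \<omega> where \<omega>: "functional_tensor (A r s) (A s t) (T r s t) (\<tau> r s t) (\<phi> r s) (\<phi> s t) \<omega>"
      "\<And>a. a \<in> carrier (A r t) \<Longrightarrow> \<phi> r t a = \<omega> (\<Delta> r s t a)"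
      using assms(3) rst unfolding counit_def by metis
    have norm: "hnorm (L r s t) (N r s t (\<Delta> r s t a)) = hnorm (H r t) (\<Lambda> r t a)" if "a \<in> carrier (A r t)" for a
      by (rule counit_norm[OF \<Lambda>[OF rst(1) pos(2)] \<phi>[OF rst(1) pos(2)] \<Lambda>[OF rst(1,2)] \<phi>[OF rst(1,2)]
            \<Lambda>[OF pos(1) rst(3)] \<phi>[OF pos(1) rst(3)] inj[OF rst] hil[OF rst] N[OF rst] N_tensor[OF rst] hom[OF rst] \<omega> that])
    have "linear_on (A r t) (L r s t) (\<lambda>a. N r s t (\<Delta> r s t a))"
      by (rule linear_on_comp[OF _ N.linear]) (use hom[OF rst] in \<open>simp add: star_hom_def\<close>)
    from induced_isometry[OF \<Lambda>[OF rst(1) pos(2)] N.H.hilbert_space_axioms this norm] show ?thesis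
      unfolding W_def by metis
  qed
  then obtain V where V_W: "\<And>r s t. 0 < r \<Longrightarrow> r < s \<Longrightarrow> s < t \<Longrightarrow> W r s t (V r s t)" by metis
  have V: "isometry_op (H r t) (L r s t) (V r s t)" if "0 < r" "r < s" "s < t" for r s t
    using V_W[OF that] by (simp add: W_def)
  have V\<Lambda>: "V r s t (\<Lambda> r t a) = N r s t (\<Delta> r s t a)" if "0 < r" "r < s" "s < t" "a \<in> carrier (A r t)" for r s t a
    using V_W[OF that(1-3)] that(4) by (simp add: W_def)

  have coassoc: "\<exists>F G. op_tensor (H r s) (H s u) (L r s u) (\<sigma> r s u) (L3 r s t u) (\<sigma>r r s t u) (\<lambda>x. x) (V s t u) F \<and>
      op_tensor (H r t) (H t u) (L r t u) (\<sigma> r t u) (L3 r s t u) (\<sigma>l r s t u) (V r s t) (\<lambda>x. x) G \<and>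
      (\<forall>x\<in>carrier (H r u). F (V r s u x) = G (V r t u x))"
    if rstu: "0 < r" "r < s" "s < t" "t < u" for r s t u
  proof -
    have pos: "0 < s" "0 < t" "r < t" "s < u" "r < u" using rstu by simp_all
    have Tl: "injective_tensor (T r s t) (A t u) (T3 r s t u) (\<tau>l r s t u)"
      and Tr: "injective_tensor (A r s) (T s t u) (T3 r s t u) (\<tau>r r s t u)"
      and \<tau>lr: "\<And>a b c. \<lbrakk>a \<in> carrier (A r s); b \<in> carrier (A s t); c \<in> carrier (A t u)\<rbrakk> \<Longrightarrow>
        \<tau>l r s t u (\<tau> r s t a b) c = \<tau>r r s t u a (\<tau> s t u b c)"
      using assms(1) rstu by (simp_all add: cstar_tensor_family_def)
    have Ll: "hilbert_tensor (L r s t) (H t u) (L3 r s t u) (\<sigma>l r s t u)"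
      and Lr: "hilbert_tensor (H r s) (L s t u) (L3 r s t u) (\<sigma>r r s t u)"
      and \<sigma>lr: "\<And>x y z. \<lbrakk>x \<in> carrier (H r s); y \<in> carrier (H s t); z \<in> carrier (H t u)\<rbrakk> \<Longrightarrow>
        \<sigma>l r s t u (\<sigma> r s t x y) z = \<sigma>r r s t u x (\<sigma> s t u y z)"
      using assms(5) rstu by (simp_all add: hilbert_tensor_family_def)
    obtain E D where E: "hom_tensor (A r s) (A s u) (T r s u) (\<tau> r s u) (T3 r s t u) (\<tau>r r s t u) (\<lambda>a. a) (\<Delta> s t u) E"
      and D: "hom_tensor (A r t) (A t u) (T r t u) (\<tau> r t u) (T3 r s t u) (\<tau>l r s t u) (\<Delta> r s t) (\<lambda>a. a) D"
      and ED: "\<And>a. a \<in> carrier (A r u) \<Longrightarrow> E (\<Delta> r s u a) = D (\<Delta> r t u a)"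
      using assms(2) rstu unfolding cstar_subproduct_system_def by metis
    note rst = rstu(1-3) and stu = pos(1) rstu(3,4) and rsu = rstu(1,2) pos(4) and rtu = rstu(1) pos(3) rstu(4)
    obtain F where F: "op_tensor (H r s) (H s u) (L r s u) (\<sigma> r s u) (L3 r s t u) (\<sigma>r r s t u) (\<lambda>x. x) (V s t u) F"
      using op_tensor_exists[OF hil[OF rsu] Lr isometry_op_id V[OF stu]] by blast
    obtain G where G: "op_tensor (H r t) (H t u) (L r t u) (\<sigma> r t u) (L3 r s t u) (\<sigma>l r s t u) (V r s t) (\<lambda>x. x) G"
      using op_tensor_exists[OF hil[OF rtu] Ll V[OF rst] isometry_op_id] by blast
    obtain Nl where Nl: "gns_map (T3 r s t u) (L3 r s t u) Nl (\<sigma>l r s t u (\<sigma> r s t (\<xi> r s) (\<xi> s t)) (\<xi> t u))"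
      and Nl_tensor: "\<And>x c. \<lbrakk>x \<in> carrier (T r s t); c \<in> carrier (A t u)\<rbrakk> \<Longrightarrow>
        Nl (\<tau>l r s t u x c) = \<sigma>l r s t u (N r s t x) (\<Lambda> t u c)"
      using tensor_gns_map[OF N[OF rst] \<Lambda>[OF pos(2) rstu(4)] Tl Ll] by blast
    obtain Nr where Nr': "gns_map (T3 r s t u) (L3 r s t u) Nr (\<sigma>r r s t u (\<xi> r s) (\<sigma> s t u (\<xi> s t) (\<xi> t u)))"
      and Nr_tensor: "\<And>a y. \<lbrakk>a \<in> carrier (A r s); y \<in> carrier (T s t u)\<rbrakk> \<Longrightarrow>
        Nr (\<tau>r r s t u a y) = \<sigma>r r s t u (\<Lambda> r s a) (N s t u y)"
      using tensor_gns_map[OF \<Lambda>[OF rst(1,2)] N[OF stu] Tr Lr] by blast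
    \<comment> \<open>The two bracketings of the three cyclic vectors give the same vector by
      \<open>\<sigma>lr\<close>, as a comparison of \<open>Nl\<close> and \<open>Nr\<close>
      requires.\<close>
    have Nr: "gns_map (T3 r s t u) (L3 r s t u) Nr (\<sigma>l r s t u (\<sigma> r s t (\<xi> r s) (\<xi> s t)) (\<xi> t u))"
      using Nr' \<sigma>lr gns_map.cyclic_closed[OF \<Lambda>] rstu pos by simp

    interpret Nl: gns_map "T3 r s t u" "L3 r s t u" Nl "\<sigma>l r s t u (\<sigma> r s t (\<xi> r s) (\<xi> s t)) (\<xi> t u)" by (rule Nl)
    interpret Nrst: gns_map "T r s t" "L r s t" "N r s t" "\<sigma> r s t (\<xi> r s) (\<xi> s t)" by (rule N[OF rst])
    interpret Crst: tensor_cstar "A r s" "A s t" "T r s t" "\<tau> r s t" using inj[OF rst] by (rule tensor_cstarI)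
    interpret Cstu: tensor_cstar "A s t" "A t u" "T s t u" "\<tau> s t u" using inj[OF stu] by (rule tensor_cstarI)
    interpret Sl: tensor_hilbert "L r s t" "H t u" "L3 r s t u" "\<sigma>l r s t u" using Ll by (rule tensor_hilbertI)
    interpret \<Lambda>ru: gns_map "A r u" "H r u" "\<Lambda> r u" "\<xi> r u" by (rule \<Lambda>[OF rstu(1) pos(5)])

    \<comment> \<open>\<open>Nl\<close> takes the role of \<open>N1\<close>: the bound in
      \<open>y\<close> is visible for it, since the norm of Nl (\<tau>l y c) is the product of the
      norms of N y and \<Lambda> c.\<close>
    have Nlr: "Nl p = Nr p" if "p \<in> carrier (T3 r s t u)" for p
    proof (rule gns_map_tensor_unique[OF Nl Nr Tl Crst.total _ _ _ _ that])
      fix i j assume "i \<in> carrier (A r s) \<times> carrier (A s t)" "j \<in> carrier (A r s) \<times> carrier (A s t)"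
      then show "\<exists>k\<in>carrier (A r s) \<times> carrier (A s t).
          (case i of (a, b) \<Rightarrow> \<tau> r s t a b) \<otimes>\<^bsub>T r s t\<^esub> (case j of (a, b) \<Rightarrow> \<tau> r s t a b) = (case k of (a, b) \<Rightarrow> \<tau> r s t a b)"
        by (intro bexI[of _ "(fst i \<otimes>\<^bsub>A r s\<^esub> fst j, snd i \<otimes>\<^bsub>A s t\<^esub> snd j)"]) (auto simp: Crst.mult_tensor)
    next
      fix i c assume i: "i \<in> carrier (A r s) \<times> carrier (A s t)" and c: "c \<in> carrier (A t u)"
      obtain a b where ab: "i = (a, b)" "a \<in> carrier (A r s)" "b \<in> carrier (A s t)" using i by auto
      have "Nl (\<tau>l r s t u (\<tau> r s t a b) c) = \<sigma>l r s t u (\<sigma> r s t (\<Lambda> r s a) (\<Lambda> s t b)) (\<Lambda> t u c)"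
        using ab c rst by (simp add: Nl_tensor N_tensor)
      also have "\<dots> = \<sigma>r r s t u (\<Lambda> r s a) (\<sigma> s t u (\<Lambda> s t b) (\<Lambda> t u c))"
        using ab c rstu pos by (simp add: \<sigma>lr \<Lambda>_closed)
      also have "\<dots> = Nr (\<tau>l r s t u (\<tau> r s t a b) c)"
        using ab c stu by (simp add: \<tau>lr Nr_tensor N_tensor)
      finally show "Nl (\<tau>l r s t u (case i of (a, b) \<Rightarrow> \<tau> r s t a b) c) = Nr (\<tau>l r s t u (case i of (a, b) \<Rightarrow> \<tau> r s t a b) c)"
        using ab by simp
    next
      fix c assume c: "c \<in> carrier (A t u)"
      have "hnorm (L3 r s t u) (Nl (\<tau>l r s t u y c))
          \<le> (hnorm (L r s t) (\<sigma> r s t (\<xi> r s) (\<xi> s t)) * hnorm (H t u) (\<Lambda> t u c)) * cnorm (T r s t) y"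
        if y: "y \<in> carrier (T r s t)" for y
        using mult_right_mono[OF Nrst.bounded[OF y] Sl.K.hnorm_nonneg[of "\<Lambda> t u c"]] y c \<Lambda>_closed[OF pos(2) rstu(4) c]
        by (simp add: Nl_tensor Sl.hnorm_tensor mult_ac)
      then show "\<exists>K. \<forall>y\<in>carrier (T r s t). hnorm (L3 r s t u) (Nl (\<tau>l r s t u y c)) \<le> K * cnorm (T r s t) y" by blast
    qed auto

    \<comment> \<open>\<open>F\<close> and \<open>E\<close> land in the right bracketing,
      \<open>G\<close> and \<open>D\<close> in the left one; they are intertwined by
      \<open>Nr\<close> and \<open>Nl\<close> respectively, and \<open>Nlr\<close> joins the
      two.\<close>
    have FE: "F (N r s u x) = Nr (E x)" if "x \<in> carrier (T r s u)" for x
      by (rule tensor_intertwine[OF N[OF rsu] Nr inj[OF rsu] F E, where \<Lambda> = "\<Lambda> r s" and M = "\<Lambda> s u"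
            and \<Lambda>' = "\<Lambda> r s" and M' = "N s t u" and A' = "A r s" and B' = "T s t u"])
        (use that rsu stu pos in \<open>auto simp: \<Lambda>_closed \<Delta>_closed N_tensor Nr_tensor V\<Lambda>\<close>)
    have GD: "G (N r t u x) = Nl (D x)" if "x \<in> carrier (T r t u)" for x
      by (rule tensor_intertwine[OF N[OF rtu] Nl inj[OF rtu] G D, where \<Lambda> = "\<Lambda> r t" and M = "\<Lambda> t u"
            and \<Lambda>' = "N r s t" and M' = "\<Lambda> t u" and A' = "T r s t" and B' = "A t u"])
        (use that rst rtu pos in \<open>auto simp: \<Lambda>_closed \<Delta>_closed N_tensor Nl_tensor V\<Lambda>\<close>)

    have bV: "linear_on (H r u) (L r s u) (V r s u)" "linear_on (H r u) (L r t u) (V r t u)"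
      "\<And>x. x \<in> carrier (H r u) \<Longrightarrow> hnorm (L r s u) (V r s u x) = hnorm (H r u) x"
      "\<And>x. x \<in> carrier (H r u) \<Longrightarrow> hnorm (L r t u) (V r t u x) = hnorm (H r u) x"
      using V[OF rsu] V[OF rtu] by (simp_all add: isometry_op_def)
    have lin: "linear_on (L r s u) (L3 r s t u) F" "linear_on (L r t u) (L3 r s t u) G"
      using F G by (simp_all add: op_tensor_def bounded_op_def)
    obtain CF where CF: "\<And>x. x \<in> carrier (L r s u) \<Longrightarrow> hnorm (L3 r s t u) (F x) \<le> CF * hnorm (L r s u) x"
      using F unfolding op_tensor_def bounded_op_def by blast
    obtain CG where CG: "\<And>x. x \<in> carrier (L r t u) \<Longrightarrow> hnorm (L3 r s t u) (G x) \<le> CG * hnorm (L r t u) x"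
      using G unfolding op_tensor_def bounded_op_def by blast
    \<comment> \<open>On the dense set of vectors \<open>\<Lambda> r u a\<close> the claim becomes
      co-associativity of \<open>\<Delta>\<close>, seen through the common GNS map of the triple
      tensor product.\<close>
    have "F (V r s u x) = G (V r t u x)" if x: "x \<in> carrier (H r u)" for x
    proof (rule linear_bounded_agree[OF \<Lambda>ru.H.normed_module Nl.H.normed_module _ _ _ _ \<Lambda>ru.dense _ x])
      show "linear_on (H r u) (L3 r s t u) (\<lambda>x. F (V r s u x))" using bV(1) lin(1) by (rule linear_on_comp)
      show "linear_on (H r u) (L3 r s t u) (\<lambda>x. G (V r t u x))" using bV(2) lin(2) by (rule linear_on_comp)
      show "hnorm (L3 r s t u) (F (V r s u x)) \<le> CF * hnorm (H r u) x" if "x \<in> carrier (H r u)" for x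
        using CF[OF linear_onD(1)[OF bV(1) that]] bV(3)[OF that] by simp
      show "hnorm (L3 r s t u) (G (V r t u x)) \<le> CG * hnorm (H r u) x" if "x \<in> carrier (H r u)" for x
        using CG[OF linear_onD(1)[OF bV(2) that]] bV(4)[OF that] by simp
      fix x assume "x \<in> \<Lambda> r u ` carrier (A r u)"
      then obtain a where a: "a \<in> carrier (A r u)" "x = \<Lambda> r u a" by blast
      have Da: "D (\<Delta> r t u a) \<in> carrier (T3 r s t u)"
        using D \<Delta>_closed[OF rtu a(1)] by (auto simp: hom_tensor_def star_hom_def linear_onD(1))
      have "F (V r s u x) = Nr (E (\<Delta> r s u a))" using a V\<Lambda>[OF rsu] FE \<Delta>_closed[OF rsu] by simp
      also have "\<dots> = Nl (D (\<Delta> r t u a))" using ED[OF a(1)] Nlr[OF Da] by simp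
      also have "\<dots> = G (V r t u x)" using a V\<Lambda>[OF rtu] GD \<Delta>_closed[OF rtu] by simp
      finally show "F (V r s u x) = G (V r t u x)" .
    qed
    with F G show ?thesis by blast
  qed
  have "hilbert_space (H s t)" if "0 < s" "s < t" for s t
    using assms(4)[OF that] by (simp add: gns_representation_def representation_def)
  with V coassoc show ?thesis
    by (intro exI[of _ V]) (simp add: tsirelson_subproduct_system_def)
qed

end
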